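(* Let $\mathcal{X}$ be an infinite-dimensional complex Banach space with open unit ball $B$, and let $\mathcal{M}_0$ be the fiber over $0$ of the spectrum $\mathcal{M}$ of $H^\infty(B)$. Then there are analytic disks in $\mathcal{M}_0$. In fact, there is an analytic embedding of $(\beta(\mathbb{N})\setminus\mathbb{N})\times\Delta$ into $\mathcal{M}_0$, that is, a homeomorphism $\Psi$ of $(\beta(\mathbb{N})\setminus\mathbb{N})\times\Delta$ onto a subset of $\mathcal{M}_0$ such that for every $f\in H^\infty(B)$ and every $p\in\beta(\mathbb{N})\setminus\mathbb{N}$ the function $\lambda\mapsto f(\Psi(p,\lambda))$ is analytic on $\Delta$.
   Context: $H^\infty(B)$ is the algebra of bounded analytic (holomorphic) functions on $B$ with the supremum norm. Its spectrum $\mathcal{M}$ is the set of nonzero complex-valued algebra homomorphisms of $H^\infty(B)$, with the (compact Hausdorff) weak-star, i.e. Gelfand, topology. For $f\in H^\infty(B)$ and $\varphi\in\mathcal{M}$ write $f(\varphi)=\varphi(f)$. Regard $\mathcal{X}^*\subset H^\infty(B)$ by restriction of functionals to $B$; the fiber over $0$ is $\mathcal{M}_0=\{\varphi\in\mathcal{M}:\varphi(L)=0 \text{ for all } L\in\mathcal{X}^*\}$. $\Delta$ is the open unit disk in $\mathbb{C}$ and $\beta(\mathbb{N})$ is the Stone–Čech compactification of the positive integers. An analytic disk in $\mathcal{M}_0$ is (the image of) a one-to-one map $\tau:\Delta\to\mathcal{M}_0$ such that $f\circ\tau$ is analytic on $\Delta$ for all $f\in H^\infty(B)$. *)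

theory Defs
  imports "HOL-Analysis.Analysis"
begin

section \<open>Complex Banach spaces\<close>

class complex_banach = banach +
  fixes scaleC :: "complex \<Rightarrow> 'a \<Rightarrow> 'a" (infixr "*\<^sub>C" 75)
  assumes scaleC_add_right: "c *\<^sub>C (x + y) = c *\<^sub>C x + c *\<^sub>C y"
    and scaleC_add_left: "(c + d) *\<^sub>C x = c *\<^sub>C x + d *\<^sub>C x"
    and scaleC_scaleC: "c *\<^sub>C d *\<^sub>C x = (c * d) *\<^sub>C x"
    and scaleC_of_real: "complex_of_real r *\<^sub>C x = r *\<^sub>R x"
    and norm_scaleC: "norm (c *\<^sub>C x) = cmod c * norm x"

instantiation complex :: complex_banach
begin

definition scaleC_complex :: "complex \<Rightarrow> complex \<Rightarrow> complex"
  where "scaleC_complex c z = c * z"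

instance
  by standard (simp_all add: scaleC_complex_def algebra_simps norm_mult scaleR_conv_of_real)

end

interpretation complex_space: vector_space "scaleC :: complex \<Rightarrow> 'a \<Rightarrow> 'a::complex_banach"
proof
  show "1 *\<^sub>C x = x" for x :: 'a
    using scaleC_of_real[of 1 x] by simp
qed (simp_all add: scaleC_add_right scaleC_add_left scaleC_scaleC)

definition infinite_dimensional :: "'a::complex_banach itself \<Rightarrow> bool"
  where "infinite_dimensional _ \<longleftrightarrow>
    \<not> (\<exists>S :: 'a set. finite S \<and> module.span scaleC S = UNIV)"

definition clinear :: "('a::complex_banach \<Rightarrow> complex) \<Rightarrow> bool"
  where "clinear L \<longleftrightarrow> Vector_Spaces.linear scaleC (*) L"

definition dual_space :: "('a::complex_banach \<Rightarrow> complex) set"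
  where "dual_space = {L. bounded_linear L \<and> clinear L}"

section \<open>The algebra of bounded analytic functions on the unit ball\<close>

text \<open>Analytic means complex Frechet differentiable: the real derivative (a bounded
  real-linear map) is required to be complex linear.\<close>

definition analytic_fun_on :: "('a::complex_banach \<Rightarrow> complex) \<Rightarrow> 'a set \<Rightarrow> bool"
  where "analytic_fun_on f U \<longleftrightarrow>
    (\<forall>x\<in>U. \<exists>D. (f has_derivative D) (at x) \<and> clinear D)"

abbreviation unit_ball :: "'a::complex_banach set"
  where "unit_ball \<equiv> ball 0 1"

abbreviation unit_disk :: "complex set"
  where "unit_disk \<equiv> ball 0 1"

text \<open>Functions on the ball are represented by total functions that are \<^const>\<open>undefined\<close>
  off the ball, so that equality in \<open>Hinf\<close> is equality on the ball. The algebra operations are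
  the pointwise ones, restricted to the ball. Likewise characters are functions on \<open>Hinf\<close> that
  are \<^const>\<open>undefined\<close> off \<open>Hinf\<close>.\<close>

definition Hinf :: "('a::complex_banach \<Rightarrow> complex) set"
  where "Hinf = {f \<in> extensional unit_ball. analytic_fun_on f unit_ball \<and> bounded (f ` unit_ball)}"

definition spectrum :: "(('a::complex_banach \<Rightarrow> complex) \<Rightarrow> complex) set"
  where "spectrum = {\<phi> \<in> extensional Hinf.
    (\<forall>f\<in>Hinf. \<forall>g\<in>Hinf. \<phi> (\<lambda>x\<in>unit_ball. f x + g x) = \<phi> f + \<phi> g) \<and>
    (\<forall>c. \<forall>f\<in>Hinf. \<phi> (\<lambda>x\<in>unit_ball. c * f x) = c * \<phi> f) \<and>
    (\<forall>f\<in>Hinf. \<forall>g\<in>Hinf. \<phi> (\<lambda>x\<in>unit_ball. f x * g x) = \<phi> f * \<phi> g) \<and>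
    (\<exists>f\<in>Hinf. \<phi> f \<noteq> 0)}"

text \<open>The topology of pointwise convergence on \<open>Hinf\<close>.\<close>

definition gelfand_topology :: "(('a::complex_banach \<Rightarrow> complex) \<Rightarrow> complex) topology"
  where "gelfand_topology = subtopology (product_topology (\<lambda>_. euclidean) Hinf) spectrum"

definition fiber0 :: "(('a::complex_banach \<Rightarrow> complex) \<Rightarrow> complex) set"
  where "fiber0 = {\<phi> \<in> spectrum. \<forall>L\<in>dual_space. \<phi> (restrict L unit_ball) = 0}"

definition analytic_disk_map ::
    "(complex \<Rightarrow> ('a::complex_banach \<Rightarrow> complex) \<Rightarrow> complex) \<Rightarrow> bool"
  where "analytic_disk_map \<tau> \<longleftrightarrow>
    \<tau> ` unit_disk \<subseteq> fiber0 \<and> inj_on \<tau> unit_disk \<and>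
    (\<forall>f\<in>Hinf. (\<lambda>z. \<tau> z f) holomorphic_on unit_disk)"

section \<open>The Stone-Cech compactification\<close>

text \<open>For a Tychonoff space \<open>X\<close>, the closure of the image of \<open>X\<close> under the evaluation map into
  the cube \<open>[0,1]\<^sup>C\<close>, where \<open>C\<close> is the set of continuous maps from \<open>X\<close> to \<open>[0,1]\<close>.\<close>

definition unit_maps :: "'b topology \<Rightarrow> ('b \<Rightarrow> real) set"
  where "unit_maps X = {u \<in> extensional (topspace X). continuous_map X (top_of_set {0..1}) u}"

definition sc_cube :: "'b topology \<Rightarrow> (('b \<Rightarrow> real) \<Rightarrow> real) topology"
  where "sc_cube X = product_topology (\<lambda>_. top_of_set {0..1}) (unit_maps X)"

definition sc_eval :: "'b topology \<Rightarrow> 'b \<Rightarrow> ('b \<Rightarrow> real) \<Rightarrow> real"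
  where "sc_eval X x = (\<lambda>u\<in>unit_maps X. u x)"

definition stone_cech :: "'b topology \<Rightarrow> (('b \<Rightarrow> real) \<Rightarrow> real) topology"
  where "stone_cech X = subtopology (sc_cube X) (sc_cube X closure_of (sc_eval X ` topspace X))"

definition stone_cech_remainder :: "'b topology \<Rightarrow> (('b \<Rightarrow> real) \<Rightarrow> real) topology"
  where "stone_cech_remainder X =
    subtopology (stone_cech X) (topspace (stone_cech X) - sc_eval X ` topspace X)"

abbreviation positive_integers :: "nat topology"
  where "positive_integers \<equiv> discrete_topology {0<..}"

lemma compact_space_stone_cech: "compact_space (stone_cech X)"
  unfolding stone_cech_def
  by (rule compact_space_subtopology, rule closedin_compact_space)
    (simp_all add: sc_cube_def compact_space_product_topology compact_space_subtopology)

lemma Hausdorff_space_stone_cech: "Hausdorff_space (stone_cech X)"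
  unfolding stone_cech_def sc_cube_def
  by (intro Hausdorff_space_subtopology)
    (simp add: Hausdorff_space_product_topology Hausdorff_space_subtopology)

end

theory Submission
  imports Defs "HOL-Complex_Analysis.Complex_Analysis" "HOL-Library.Diagonal_Subsequence"
begin

text \<open>
  The disks are limits of the affine disks \<open>z \<mapsto> (1 - \<epsilon>\<^sub>n + \<epsilon>\<^sub>n z) x\<close> in the ball, where \<open>x\<close> runs
  along an ultrafilter \<open>F n\<close> on the unit sphere and then \<open>n\<close> along a free ultrafilter on the positive
  integers. The ultrafilters \<open>F n\<close> represent norm-one elements \<open>\<xi>\<^sub>n\<close> of the bidual that tend to \<open>0\<close> weak-star
  against the dual, so the limits lie in the fiber over \<open>0\<close>.

  The sequence \<open>\<xi>\<^sub>n\<close> comes from Rosenthal's dichotomy for a separated sequence on the unit sphere. If a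
  subsequence is weakly Cauchy, successive differences are weakly null. Otherwise a subsequence is
  independent; its averages with Rademacher signs over blocks of length \<open>2 ^ m\<close> stay away from \<open>0\<close>,
  and by Bessel's inequality their limits along an ultrafilter in \<open>m\<close> are weak-star null.

  To separate the limits, choose functionals \<open>L\<^sub>n\<close> of norm at most \<open>1\<close> with \<open>L\<^sub>n \<xi>\<^sub>n\<close> nearly \<open>1\<close> and
  \<open>L\<^sub>j \<xi>\<^sub>n\<close> nearly \<open>0\<close> for \<open>j < n\<close>. The sum \<open>H\<^sub>A\<close> of \<open>\<epsilon>\<^sub>k / (1 - L\<^sub>k)\<close> over \<open>k \<in> A\<close> maps the ball into the
  right half plane, so \<open>1 / (1 + H\<^sub>A)\<close> is bounded. On the \<open>n\<close>-th disk the \<open>n\<close>-th summand is nearly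
  \<open>1 / (1 - z)\<close>; the earlier summands are nearly constant and, if \<open>\<epsilon>\<^sub>n\<close> decreases fast enough, the later
  ones are negligible whatever the values of the corresponding functionals. In the limit, \<open>H\<^sub>A\<close> detects both
  \<open>z\<close> and whether \<open>A\<close> belongs to the ultrafilter.
\<close>

section \<open>Hahn--Banach separation\<close>

text \<open>Unit vectors that tend weakly to 0 need not exist: in the sequence space l^1 weak and
  norm convergence of sequences coincide. This forces the detour through the bidual. A bounded
  analytic function need not be weak-star continuous, so a point of the bidual alone does not
  determine a value; an ultrafilter of vectors does, and limits along it exist for all bounded
  functions at once and are multiplicative, which makes the limits characters.

  The disks must come close to the unit sphere, since the poles of the summands lie there. The
  radius of the \<open>n\<close>-th disk equals the weight of the \<open>n\<close>-th summand, so
  this summand keeps its size however small the radius is. A later summand \<open>k\<close> is only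
  known to be at most of the order \<open>eps k / eps n\<close>, and the sums of these ratios over
  \<open>k > n\<close> must tend to 0; geometric decay would not do.

  The product of the remainder and the open disk is not compact, so a continuous injection need not
  be an embedding. The inverse has to be shown continuous, which the test functions also
  achieve.\<close>

definition sublinear :: "('a::real_vector \<Rightarrow> real) \<Rightarrow> bool"
  where "sublinear p \<longleftrightarrow> (\<forall>x y. p (x + y) \<le> p x + p y) \<and> (\<forall>t\<ge>0. \<forall>x. p (t *\<^sub>R x) = t * p x)"

lemma sublinearD:
  assumes "sublinear p"
  shows "p (x + y) \<le> p x + p y" "0 \<le> t \<Longrightarrow> p (t *\<^sub>R x) = t * p x" "p 0 = 0" "- p (- x) \<le> p x"
proof -
  show add: "p (x + y) \<le> p x + p y" for x y
    using assms by (simp add: sublinear_def)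
  show scale: "0 \<le> t \<Longrightarrow> p (t *\<^sub>R x) = t * p x" for t x
    using assms by (simp add: sublinear_def)
  show zero: "p 0 = 0"
    using scale[of 0 0] by simp
  show "- p (- x) \<le> p x"
    using add[of x "- x"] zero by simp
qed

lemma sublinear_norm: "sublinear norm"
  by (simp add: sublinear_def norm_triangle_ineq)

text \<open>The inequality for \<open>inverse t\<close> at the point \<open>t *\<^sub>R x\<close> is
  the reverse of the one for \<open>t\<close> at \<open>x\<close>. Infima deliver only one
  direction, so this form fits them.\<close>

lemma sublinearI_le:
  assumes add: "\<And>x y. q (x + y) \<le> q x + q y" and zero: "q 0 = 0"
    and scale: "\<And>t x. 0 < t \<Longrightarrow> q (t *\<^sub>R x) \<le> t * q x"
  shows "sublinear q"
  unfolding sublinear_def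
proof (intro conjI allI impI add)
  fix t :: real and x
  assume "0 \<le> t"
  show "q (t *\<^sub>R x) = t * q x"
  proof (cases "t = 0")
    case False
    with \<open>0 \<le> t\<close> have t: "0 < t" by simp
    have "q x = q (inverse t *\<^sub>R (t *\<^sub>R x))"
      using t by simp
    also have "\<dots> \<le> inverse t * q (t *\<^sub>R x)"
      using t by (intro scale) simp
    finally have "t * q x \<le> q (t *\<^sub>R x)"
      using t by (simp add: field_simps)
    with scale[OF t, of x] show ?thesis by simp
  qed (simp add: zero)
qed

text \<open>The largest sublinear functional below \<open>p\<close> with value at most \<open>- d\<close> at \<open>- x\<close> for all \<open>x \<in> K\<close>.\<close>

definition tilt :: "('a::real_vector \<Rightarrow> real) \<Rightarrow> 'a set \<Rightarrow> real \<Rightarrow> 'a \<Rightarrow> real"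
  where "tilt p K d v = (INF (x, t)\<in>K \<times> {0..}. p (v + t *\<^sub>R x) - t * d)"

context
  fixes p :: "'a::real_vector \<Rightarrow> real" and K d
  assumes p: "sublinear p" and K: "convex K" "K \<noteq> {}" "\<And>x. x \<in> K \<Longrightarrow> d \<le> p x"
begin

text \<open>The bound \<open>d \<le> p x\<close> on \<open>K\<close> enters here: it keeps the
  infimum in \<open>tilt\<close> finite.\<close>

lemma tilt_lower:
  assumes "x \<in> K" "0 \<le> t"
  shows "- p (- v) \<le> p (v + t *\<^sub>R x) - t * d"
proof -
  have "p (t *\<^sub>R x) \<le> p (v + t *\<^sub>R x) + p (- v)"
    using sublinearD(1)[OF p, of "v + t *\<^sub>R x" "- v"] by simp
  moreover have "t * d \<le> p (t *\<^sub>R x)"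
    using assms K(3) by (simp add: sublinearD(2)[OF p] mult_left_mono)
  ultimately show ?thesis by simp
qed

lemma tilt_le:
  assumes "x \<in> K" "0 \<le> t"
  shows "tilt p K d v \<le> p (v + t *\<^sub>R x) - t * d"
  unfolding tilt_def
  by (rule cINF_lower2[of _ _ "(x, t)"])
    (use assms tilt_lower in \<open>auto intro!: bdd_belowI2[where m = "- p (- v)"]\<close>)

lemma tilt_greatest:
  assumes "\<And>x t. x \<in> K \<Longrightarrow> 0 \<le> t \<Longrightarrow> m \<le> p (v + t *\<^sub>R x) - t * d"
  shows "m \<le> tilt p K d v"
  unfolding tilt_def by (rule cINF_greatest) (use K(2) assms in auto)

lemma tilt_le_self: "tilt p K d v \<le> p v"
  using tilt_le[of _ 0 v] K(2) by auto

lemma tilt_minus_le: "x \<in> K \<Longrightarrow> tilt p K d (- x) \<le> - d"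
  using tilt_le[of x 1 "- x"] by (simp add: sublinearD(3)[OF p])

lemma tilt_approx:
  assumes "tilt p K d v < m"
  obtains x t where "x \<in> K" "0 \<le> t" "p (v + t *\<^sub>R x) - t * d < m"
  using assms tilt_greatest[of m v] by (meson not_le)

lemma sublinear_tilt: "sublinear (tilt p K d)"
proof (rule sublinearI_le)
  fix v w
  show "tilt p K d (v + w) \<le> tilt p K d v + tilt p K d w"
  proof (rule field_le_epsilon)
    fix e :: real
    assume "0 < e"
    obtain x t where x: "x \<in> K" "0 \<le> t" "p (v + t *\<^sub>R x) - t * d < tilt p K d v + e / 2"
      by (rule tilt_approx[of v "tilt p K d v + e / 2"]) (use \<open>0 < e\<close> in auto)
    obtain y s where y: "y \<in> K" "0 \<le> s" "p (w + s *\<^sub>R y) - s * d < tilt p K d w + e / 2"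
      by (rule tilt_approx[of w "tilt p K d w + e / 2"]) (use \<open>0 < e\<close> in auto)
    \<comment> \<open>Convexity of \<open>K\<close> merges the two rays into one with parameter
      \<open>t + s\<close>, directed by the weighted mean of \<open>x\<close> and
      \<open>y\<close>.\<close>
    obtain z where z: "z \<in> K" "(t + s) *\<^sub>R z = t *\<^sub>R x + s *\<^sub>R y"
    proof (cases "t + s = 0")
      case True
      with x(2) y(2) have "t = 0" "s = 0" by auto
      then show ?thesis using x(1) that[of x] by simp
    next
      case False
      let ?z = "(t / (t + s)) *\<^sub>R x + (s / (t + s)) *\<^sub>R y"
      have "?z \<in> K"
        using K(1) x y False by (intro convexD) (auto simp: add_divide_distrib[symmetric])
      moreover have "(t + s) *\<^sub>R ?z = t *\<^sub>R x + s *\<^sub>R y"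
        using False by (simp only: scaleR_add_right scaleR_scaleR) simp
      ultimately show ?thesis by (rule that)
    qed
    have "tilt p K d (v + w) \<le> p (v + w + (t + s) *\<^sub>R z) - (t + s) * d"
      using x(2) y(2) z(1) by (intro tilt_le) auto
    also have "v + w + (t + s) *\<^sub>R z = (v + t *\<^sub>R x) + (w + s *\<^sub>R y)"
      by (simp only: z(2)) (simp add: ac_simps)
    also have "p \<dots> \<le> p (v + t *\<^sub>R x) + p (w + s *\<^sub>R y)"
      by (rule sublinearD(1)[OF p])
    finally show "tilt p K d (v + w) \<le> tilt p K d v + tilt p K d w + e"
      using x(3) y(3) by (simp add: algebra_simps)
  qed
next
  have "0 \<le> tilt p K d 0"
    using tilt_lower[of _ _ 0] by (intro tilt_greatest) (simp add: sublinearD(3)[OF p])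
  then show "tilt p K d 0 = 0"
    using tilt_le_self[of 0] by (simp add: sublinearD(3)[OF p])
next
  fix t :: real and v
  assume t: "0 < t"
  have "tilt p K d (t *\<^sub>R v) / t \<le> tilt p K d v"
  proof (rule tilt_greatest)
    fix x s
    assume "x \<in> K" "0 \<le> (s::real)"
    then have "tilt p K d (t *\<^sub>R v) \<le> p (t *\<^sub>R v + (t * s) *\<^sub>R x) - (t * s) * d"
      using t by (intro tilt_le) auto
    also have "t *\<^sub>R v + (t * s) *\<^sub>R x = t *\<^sub>R (v + s *\<^sub>R x)"
      by (simp add: algebra_simps)
    also have "p \<dots> = t * p (v + s *\<^sub>R x)"
      using t by (simp add: sublinearD(2)[OF p])
    finally show "tilt p K d (t *\<^sub>R v) / t \<le> p (v + s *\<^sub>R x) - s * d"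
      using t by (simp add: field_simps)
  qed
  then show "tilt p K d (t *\<^sub>R v) \<le> t * tilt p K d v"
    using t by (simp add: field_simps)
qed

end

text \<open>Every sublinear functional below \<open>p\<close> is at least \<open>- p (- x)\<close>
  at \<open>x\<close>, so the pointwise infimum is finite. Of two members nearly optimal at
  \<open>x\<close> and at \<open>y\<close>, the smaller one is nearly optimal at both; this gives
  subadditivity.\<close>

lemma sublinear_INF_chain:
  assumes ne: "C \<noteq> {}" and sub: "\<And>q. q \<in> C \<Longrightarrow> sublinear q \<and> (\<forall>x. q x \<le> p x)"
    and chain: "\<And>q r. q \<in> C \<Longrightarrow> r \<in> C \<Longrightarrow> q \<le> r \<or> r \<le> q"
  shows "sublinear (\<lambda>x. INF q\<in>C. q x)" and "\<And>q x. q \<in> C \<Longrightarrow> (INF q\<in>C. q x) \<le> q x"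
proof -
  have low: "- p (- x) \<le> q x" if "q \<in> C" for q x
    using sublinearD(4)[of q x] sub[OF that] by (meson neg_le_iff_le order_trans)
  then have bdd: "bdd_below ((\<lambda>q. q x) ` C)" for x
    by (intro bdd_belowI2[where m = "- p (- x)"])
  show le: "(INF q\<in>C. q x) \<le> q x" if "q \<in> C" for q x
    using that bdd by (intro cINF_lower)
  have approx: "\<exists>q\<in>C. q x < (INF q\<in>C. q x) + e" if "0 < e" for x and e :: real
    using cINF_less_iff[OF ne bdd, of x "(INF q\<in>C. q x) + e"] that by simp
  show "sublinear (\<lambda>x. INF q\<in>C. q x)"
  proof (rule sublinearI_le)
    fix x y
    show "(INF q\<in>C. q (x + y)) \<le> (INF q\<in>C. q x) + (INF q\<in>C. q y)"
    proof (rule field_le_epsilon)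
      fix e :: real
      assume "0 < e"
      then obtain q r where q: "q \<in> C" "q x < (INF q\<in>C. q x) + e / 2"
        and r: "r \<in> C" "r y < (INF q\<in>C. q y) + e / 2"
        using approx[of "e / 2"] by (meson half_gt_zero)
      obtain w where w: "w \<in> C" "w \<le> q" "w \<le> r"
        using chain[OF q(1) r(1)] q(1) r(1) by auto
      have "(INF q\<in>C. q (x + y)) \<le> w x + w y"
        using le[OF w(1), of "x + y"] sublinearD(1)[of w x y] sub[OF w(1)] by auto
      also have "\<dots> \<le> q x + r y"
        using w by (simp add: le_fun_def add_mono)
      finally show "(INF q\<in>C. q (x + y)) \<le> (INF q\<in>C. q x) + (INF q\<in>C. q y) + e"
        using q r by simp
    qed
  next
    have "(\<lambda>q. q 0) ` C = {0}"
      using ne sub by (auto simp: sublinearD(3) image_iff)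
    then show "(INF q\<in>C. q 0) = 0" by simp
  next
    fix t :: real and x
    assume t: "0 < t"
    have "(INF q\<in>C. q (t *\<^sub>R x)) / t \<le> (INF q\<in>C. q x)"
    proof (rule cINF_greatest[OF ne])
      fix q
      assume q: "q \<in> C"
      have "(INF q\<in>C. q (t *\<^sub>R x)) \<le> t * q x"
        using le[OF q, of "t *\<^sub>R x"] sub[OF q] t by (simp add: sublinearD(2))
      then show "(INF q\<in>C. q (t *\<^sub>R x)) / t \<le> q x"
        using t by (simp add: field_simps)
    qed
    then show "(INF q\<in>C. q (t *\<^sub>R x)) \<le> t * (INF q\<in>C. q x)"
      using t by (simp add: field_simps)
  qed
qed

text \<open>A minimal sublinear functional is linear, since tilting it along a vector cannot lower it.\<close>

lemma Hahn_Banach: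
  fixes p :: "'a::real_vector \<Rightarrow> real"
  assumes "sublinear p"
  obtains f where "linear f" "\<And>x. f x \<le> p x"
proof -
  define A where "A = {q. sublinear q \<and> (\<forall>x. q x \<le> p x)}"
  have "\<exists>m\<in>A. \<forall>a\<in>A. a \<le> m \<longrightarrow> a = m"
  proof (rule predicate_Zorn[where P = "\<lambda>q r. r \<le> q"])
    show "partial_order_on A (relation_of (\<lambda>q r. r \<le> q) A)"
      by (rule partial_order_on_relation_ofI) auto
    fix C
    assume C: "C \<in> Chains (relation_of (\<lambda>q r. r \<le> q) A)"
    have CA: "C \<subseteq> A" and chain: "\<And>q r. q \<in> C \<Longrightarrow> r \<in> C \<Longrightarrow> q \<le> r \<or> r \<le> q"
      using C by (auto simp: Chains_def relation_of_def)
    show "\<exists>u\<in>A. \<forall>a\<in>C. u \<le> a"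
    proof (cases "C = {}")
      case True
      then show ?thesis using assms by (auto simp: A_def)
    next
      case False
      then obtain q0 where q0: "q0 \<in> C" by auto
      let ?u = "\<lambda>x. INF q\<in>C. q x"
      have sub: "\<And>q. q \<in> C \<Longrightarrow> sublinear q \<and> (\<forall>x. q x \<le> p x)"
        using CA by (auto simp: A_def)
      have INF: "sublinear ?u" "\<And>q x. q \<in> C \<Longrightarrow> ?u x \<le> q x"
        using sublinear_INF_chain[OF False sub chain] by auto
      have "?u x \<le> p x" for x
        using INF(2)[OF q0, of x] sub[OF q0] by (meson order_trans)
      then have "?u \<in> A"
        using INF(1) by (simp add: A_def)
      moreover have "\<forall>a\<in>C. ?u \<le> a"
        using INF(2) by (simp add: le_fun_def)
      ultimately show ?thesis by blast
    qed
  qed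
  then obtain f where fA: "f \<in> A" and "\<forall>a\<in>A. a \<le> f \<longrightarrow> a = f" ..
  then have f: "sublinear f" "\<And>x. f x \<le> p x"
    and min0: "\<And>q. q \<in> A \<Longrightarrow> q \<le> f \<Longrightarrow> q = f"
    by (auto simp: A_def)
  have min: "q = f" if "sublinear q" "\<And>x. q x \<le> f x" for q
  proof (rule min0)
    have "q x \<le> p x" for x
      using that(2)[of x] f(2)[of x] by simp
    with that show "q \<in> A" "q \<le> f" by (auto simp: A_def le_fun_def)
  qed
  have minus: "f (- x) = - f x" for x
  proof -
    have "tilt f {x} (f x) = f"
      by (rule min) (use f(1) in \<open>auto intro!: sublinear_tilt tilt_le_self\<close>)
    then have "f (- x) \<le> - f x"
      using tilt_minus_le[of f "{x}" "f x" x] f(1) by simp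
    with sublinearD(4)[OF f(1), of "x"] show ?thesis by simp
  qed
  have "linear f"
  proof (rule linearI)
    fix x y
    have "- f (x + y) \<le> - f x - f y"
      using sublinearD(1)[OF f(1), of "- x" "- y"] minus[of "x + y"] minus by simp
    then show "f (x + y) = f x + f y"
      using sublinearD(1)[OF f(1), of x y] by simp
  next
    fix t x
    show "f (t *\<^sub>R x) = t *\<^sub>R f x"
    proof (cases "0 \<le> t")
      case False
      then have "f (t *\<^sub>R x) = - f ((- t) *\<^sub>R x)"
        using minus[of "t *\<^sub>R x"] by simp
      then show ?thesis
        using False by (simp add: sublinearD(2)[OF f(1)] del: scaleR_minus_left)
    qed (simp add: sublinearD(2)[OF f(1)])
  qed
  then show ?thesis using f(2) that by blast
qed

section \<open>Complex functionals and the unit ball of the dual\<close>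

lemma clinear_iff:
  "clinear L \<longleftrightarrow> (\<forall>x y. L (x + y) = L x + L y) \<and> (\<forall>c x. L (c *\<^sub>C x) = c * L x)"
proof -
  have "vector_space (scaleC :: complex \<Rightarrow> 'a \<Rightarrow> 'a)"
    by (rule complex_space.vector_space_axioms)
  moreover have "vector_space ((*) :: complex \<Rightarrow> complex \<Rightarrow> complex)"
    by unfold_locales (auto simp: algebra_simps)
  ultimately show ?thesis
    by (auto simp: clinear_def Vector_Spaces.linear_iff)
qed

lemma clinearD:
  assumes "clinear L"
  shows "L (x + y) = L x + L y" "L (c *\<^sub>C x) = c * L x" "L (r *\<^sub>R x) = r *\<^sub>R L x"
    "L (x - y) = L x - L y" "L 0 = 0" "L (- x) = - L x"
proof -
  show add: "L (x + y) = L x + L y" and sc: "L (c *\<^sub>C x) = c * L x" for x y c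
    using assms by (auto simp: clinear_iff)
  show scR: "L (r *\<^sub>R x) = r *\<^sub>R L x" for r x
    using sc[of "complex_of_real r" x] by (simp add: scaleC_of_real scaleR_conv_of_real)
  show z: "L 0 = 0" using scR[of 0 0] by simp
  show neg: "L (- x) = - L x" for x using scR[of "-1" x] by simp
  show "L (x - y) = L x - L y" using add[of x "- y"] neg by simp
qed

lemma clinear_sum: "clinear L \<Longrightarrow> L (\<Sum>i\<in>I. f i) = (\<Sum>i\<in>I. L (f i))"
  by (induction I rule: infinite_finite_induct) (simp_all add: clinearD)

lemma clinear_imp_linear: "clinear L \<Longrightarrow> linear L"
  by (rule linearI) (simp_all add: clinearD)

definition dual_ball :: "('a::complex_banach \<Rightarrow> complex) set"
  where "dual_ball = {L. clinear L \<and> (\<forall>x. cmod (L x) \<le> norm x)}"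

lemma dual_ballD:
  assumes "L \<in> dual_ball"
  shows "clinear L" "cmod (L x) \<le> norm x" "bounded_linear L"
  using assms linear_conv_bounded_linear
  by (auto simp: dual_ball_def clinear_imp_linear intro!: bounded_linear_intro[where K = 1] clinearD)

lemma dual_space_scale:
  assumes "L \<in> dual_space"
  obtains M L' where "0 < M" "L' \<in> dual_ball" "\<And>x. L x = of_real M * L' x"
proof -
  obtain M where M: "0 < M" "\<And>x. norm (L x) \<le> norm x * M"
    using assms bounded_linear.pos_bounded[of L] by (auto simp: dual_space_def)
  have L: "clinear L" using assms by (simp add: dual_space_def)
  show ?thesis
  proof (rule that[of M "\<lambda>x. L x / of_real M"])
    show "(\<lambda>x. L x / of_real M) \<in> dual_ball"
      using L M by (auto simp: dual_ball_def clinear_iff add_divide_distrib norm_divide divide_le_eq)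
  qed (use M in auto)
qed

lemma scaleC_real_combine: "c *\<^sub>C x = Re c *\<^sub>R x + Im c *\<^sub>R (\<i> *\<^sub>C x)"
proof -
  have "c *\<^sub>C x = (complex_of_real (Re c) + complex_of_real (Im c) * \<i>) *\<^sub>C x"
    by (simp add: complex_eq mult.commute)
  then show ?thesis
    unfolding scaleC_add_left scaleC_scaleC[symmetric] scaleC_of_real .
qed

text \<open>A real functional below \<open>tilt norm K d\<close> is at most \<open>norm\<close>
  everywhere and at most \<open>- d\<close> at \<open>- x\<close> for \<open>x\<close> in
  \<open>K\<close>. Separating \<open>K\<close> from a ball around 0 is the only case
  needed.\<close>

lemma dual_ball_separation:
  fixes K :: "'a::complex_banach set"
  assumes "convex K" "K \<noteq> {}" "\<And>x. x \<in> K \<Longrightarrow> d \<le> norm x"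
  obtains L where "L \<in> dual_ball" "\<And>x. x \<in> K \<Longrightarrow> d \<le> Re (L x)"
proof -
  note tilt = assms(1,2) assms(3)
  obtain f where f: "linear f" "\<And>x. f x \<le> tilt norm K d x"
    using Hahn_Banach[OF sublinear_tilt[OF sublinear_norm tilt]] by blast
  have fle: "f x \<le> norm x" for x
    using f(2)[of x] tilt_le_self[OF sublinear_norm tilt, of x] by linarith
  \<comment> \<open>The complex functional with real part \<open>f\<close>; complex linearity leaves
    no choice for its imaginary part.\<close>
  define L where "L x = Complex (f x) (- f (\<i> *\<^sub>C x))" for x
  note lin = linear_add[OF f(1)] linear_scale[OF f(1)] linear_neg[OF f(1)]
    linear_diff[OF f(1)]
  have ii: "\<i> *\<^sub>C \<i> *\<^sub>C x = - x" for x :: 'a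
    using scaleC_of_real[of "-1" x] by (simp add: scaleC_scaleC)
  have iR: "\<i> *\<^sub>C (r *\<^sub>R x) = r *\<^sub>R (\<i> *\<^sub>C x)" for r and x :: 'a
    by (simp add: scaleC_scaleC mult.commute flip: scaleC_of_real)
  have cl: "clinear L"
    unfolding clinear_iff
  proof (intro conjI allI)
    fix x y
    show "L (x + y) = L x + L y"
      by (simp add: L_def lin scaleC_add_right complex_eq_iff)
  next
    fix c x
    have "f (c *\<^sub>C x) = Re c * f x + Im c * f (\<i> *\<^sub>C x)"
      by (subst scaleC_real_combine) (simp add: lin)
    moreover have "f (\<i> *\<^sub>C (c *\<^sub>C x)) = Re c * f (\<i> *\<^sub>C x) - Im c * f x"
      by (subst scaleC_real_combine[of c]) (simp add: lin scaleC_add_right iR ii del: scaleC_scaleC)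
    ultimately show "L (c *\<^sub>C x) = c * L x"
      by (simp add: L_def complex_eq_iff)
  qed
  have "cmod (L x) \<le> norm x" for x
  proof (cases "L x = 0")
    case False
    \<comment> \<open>This phase rotates \<open>L x\<close> onto the positive reals, where
      \<open>L\<close> and its real part \<open>f\<close> agree.\<close>
    let ?c = "cnj (L x) / cmod (L x)"
    have "cnj (L x) * L x = (cmod (L x))\<^sup>2"
      using complex_norm_square[of "L x"] by (simp add: mult.commute)
    then have "?c * L x = complex_of_real (cmod (L x))"
      using False by (simp add: power2_eq_square)
    then have "L (?c *\<^sub>C x) = cmod (L x)"
      using clinearD(2)[OF cl, of ?c x] by simp
    then have "cmod (L x) = f (?c *\<^sub>C x)"
      by (metis L_def Re_complex_of_real complex.sel(1))
    also have "\<dots> \<le> norm (?c *\<^sub>C x)" by (rule fle)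
    also have "\<dots> = norm x"
      using False by (simp add: norm_scaleC norm_divide)
    finally show ?thesis .
  qed simp
  moreover have "d \<le> Re (L x)" if "x \<in> K" for x
    using f(2)[of "- x"] tilt_minus_le[OF sublinear_norm tilt that] lin(3)[of x]
    by (simp add: L_def)
  ultimately show ?thesis using cl that by (auto simp: dual_ball_def)
qed

lemma dual_ball_norming:
  fixes x :: "'a::complex_banach"
  obtains L where "L \<in> dual_ball" "L x = complex_of_real (norm x)"
proof -
  obtain L :: "'a \<Rightarrow> complex" where L: "L \<in> dual_ball" "\<And>y. y \<in> {x} \<Longrightarrow> norm x \<le> Re (L y)"
    by (rule dual_ball_separation[of "{x}" "norm x"]) auto
  have Re: "Re (L x) = norm x" "cmod (L x) = norm x"
    using L(2)[of x] dual_ballD(2)[OF L(1), of x] complex_Re_le_cmod[of "L x"] by auto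
  with cmod_power2[of "L x"] have "Im (L x) = 0" by simp
  with Re have "L x = complex_of_real (norm x)"
    by (simp add: complex_eq_iff)
  with L(1) show ?thesis by (rule that)
qed

section \<open>Ultrafilters\<close>

definition ultra :: "'i filter \<Rightarrow> bool"
  where "ultra F \<longleftrightarrow> F \<noteq> bot \<and> (\<forall>P. eventually P F \<or> eventually (\<lambda>x. \<not> P x) F)"

lemma ultra_not_bot: "ultra F \<Longrightarrow> F \<noteq> bot"
  by (simp add: ultra_def)

lemma not_eventually_ultra: "ultra F \<Longrightarrow> \<not> eventually P F \<longleftrightarrow> eventually (\<lambda>x. \<not> P x) F"
  unfolding ultra_def by (metis (mono_tags, lifting) eventually_const eventually_elim2)

lemma ex_ultra_le:
  fixes F :: "'i filter"
  assumes "F \<noteq> bot"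
  obtains G where "ultra G" "G \<le> F"
proof -
  define A where "A = {G. G \<noteq> bot \<and> G \<le> F}"
  have "\<exists>m\<in>A. \<forall>a\<in>A. a \<le> m \<longrightarrow> a = m"
  proof (rule predicate_Zorn[where P = "\<lambda>q r. r \<le> q"])
    show "partial_order_on A (relation_of (\<lambda>q r. r \<le> q) A)"
      by (rule partial_order_on_relation_ofI) auto
    fix C
    assume C: "C \<in> Chains (relation_of (\<lambda>q r. r \<le> q) A)"
    have CA: "C \<subseteq> A" and chain: "\<And>q r. q \<in> C \<Longrightarrow> r \<in> C \<Longrightarrow> q \<le> r \<or> r \<le> q"
      using C by (auto simp: Chains_def relation_of_def)
    show "\<exists>u\<in>A. \<forall>a\<in>C. u \<le> a"
    proof (cases "C = {}")
      case True
      then show ?thesis using assms by (auto simp: A_def)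
    next
      case False
      \<comment> \<open>Along a chain no finite intersections have to be added, so the infimum is
        proper because each member is.\<close>
      have "eventually P (Inf C) \<longleftrightarrow> (\<exists>b\<in>C. eventually P b)" for P
      proof (rule eventually_Inf_base[OF False])
        fix G H
        assume "G \<in> C" "H \<in> C"
        then show "\<exists>x\<in>C. x \<le> inf G H"
          using chain[of G H] by (auto simp: inf_absorb1 inf_absorb2)
      qed
      then have "Inf C \<noteq> bot"
        using CA by (auto simp: A_def trivial_limit_def)
      moreover have "Inf C \<le> F"
        using False CA by (auto simp: A_def intro: Inf_lower2)
      ultimately show ?thesis
        by (auto simp: A_def intro!: bexI[of _ "Inf C"] Inf_lower)
    qed
  qed
  then obtain G where "G \<in> A" and "\<forall>a\<in>A. a \<le> G \<longrightarrow> a = G" ..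
  then have G: "G \<noteq> bot" "G \<le> F" and min: "\<And>H. H \<noteq> bot \<Longrightarrow> H \<le> G \<Longrightarrow> H = G"
    by (auto simp: A_def)
  have "eventually P G \<or> eventually (\<lambda>x. \<not> P x) G" for P
  \<comment> \<open>A minimal proper filter either excludes \<open>P\<close> altogether or is
    unchanged by restriction to it.\<close>
  proof (cases "inf G (principal {x. P x}) = bot")
    case True
    then show ?thesis
      by (auto simp: trivial_limit_def eventually_inf_principal)
  next
    case False
    then have "inf G (principal {x. P x}) = G"
      by (intro min) auto
    then show ?thesis
      using eventually_inf_principal[of P G "{x. P x}"] by simp
  qed
  with G show ?thesis by (intro that[of G]) (auto simp: ultra_def)
qed

text \<open>Compactness gives a cluster point of the image filter. A set that an ultrafilter meets
  frequently is one that it enters eventually, so the cluster point is a limit.\<close>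

lemma ultra_tendsto_compact:
  fixes g :: "'i \<Rightarrow> 'b::topological_space"
  assumes "ultra F" "compact K" "eventually (\<lambda>x. g x \<in> K) F"
  obtains l where "l \<in> K" "(g \<longlongrightarrow> l) F"
proof -
  have "filtermap g F \<noteq> bot"
    using assms(1) by (simp add: ultra_def filtermap_bot_iff)
  moreover have "eventually (\<lambda>x. x \<in> K) (filtermap g F)"
    using assms(3) by (simp add: eventually_filtermap)
  ultimately obtain l where l: "l \<in> K" "inf (nhds l) (filtermap g F) \<noteq> bot"
    using assms(2) unfolding compact_filter by blast
  have "(g \<longlongrightarrow> l) F"
  proof (rule ccontr)
    assume "\<not> (g \<longlongrightarrow> l) F"
    then obtain S where S: "open S" "l \<in> S" "\<not> eventually (\<lambda>x. g x \<in> S) F"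
      by (auto simp: tendsto_def)
    then have "eventually (\<lambda>x. g x \<notin> S) F"
      using assms(1) by (simp add: not_eventually_ultra)
    then have "eventually (\<lambda>x. x \<notin> S) (filtermap g F)"
      by (simp add: eventually_filtermap)
    moreover have "eventually (\<lambda>x. x \<in> S) (nhds l)"
      using S by (auto simp: eventually_nhds)
    ultimately have "eventually (\<lambda>x. False) (inf (nhds l) (filtermap g F))"
      unfolding eventually_inf by (metis (mono_tags))
    with l(2) show False by (simp add: trivial_limit_def)
  qed
  with l(1) show ?thesis by (rule that)
qed

lemma ultra_tendsto_Lim:
  fixes g :: "'i \<Rightarrow> complex"
  assumes "ultra F" "eventually (\<lambda>x. cmod (g x) \<le> C) F"
  shows "(g \<longlongrightarrow> Lim F g) F" "cmod (Lim F g) \<le> C"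
proof -
  obtain l where l: "l \<in> cball 0 C" "(g \<longlongrightarrow> l) F"
    by (rule ultra_tendsto_compact[OF assms(1) compact_cball[of "0::complex" C]]) (use assms in auto)
  then have "Lim F g = l"
    using assms(1) by (intro tendsto_Lim) (auto simp: ultra_def)
  with l show "(g \<longlongrightarrow> Lim F g) F" "cmod (Lim F g) \<le> C" by auto
qed

section \<open>Limits of bounded families of holomorphic functions\<close>

text \<open>Cauchy's estimate for the derivative on circles of radius \<open>(1 - r) / 2\<close>
  about points of \<open>cball 0 r\<close>, which stay inside the unit disk.\<close>

lemma bounded_holomorphic_Lipschitz:
  assumes "h holomorphic_on unit_disk" "\<And>z. z \<in> unit_disk \<Longrightarrow> cmod (h z) \<le> C"
    and "0 < r" "r < 1" "cmod w \<le> r" "cmod z \<le> r"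
  shows "cmod (h w - h z) \<le> 2 * C / (1 - r) * cmod (w - z)"
proof (rule field_differentiable_bound[of "cball 0 r"])
  fix \<xi> :: complex
  assume \<xi>: "\<xi> \<in> cball 0 r"
  show "(h has_field_derivative deriv h \<xi>) (at \<xi> within cball 0 r)"
    using assms \<xi> by (intro DERIV_subset[OF holomorphic_derivI[of _ "unit_disk"]]) auto
  let ?s = "(1 - r) / 2"
  have sub: "cball \<xi> ?s \<subseteq> unit_disk"
  proof
    fix y
    assume "y \<in> cball \<xi> ?s"
    then have "cmod (y - \<xi>) \<le> ?s" by (simp add: dist_norm norm_minus_commute)
    moreover have "cmod \<xi> \<le> r" using \<xi> by simp
    ultimately have "cmod y \<le> r + ?s"
      using norm_triangle_ineq2[of y \<xi>] by linarith
    then show "y \<in> unit_disk"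
      using assms(4) by (simp add: field_simps)
  qed
  have "cmod ((deriv ^^ 1) h \<xi>) \<le> fact 1 * C / ?s ^ 1"
  proof (rule Cauchy_inequality)
    show "h holomorphic_on ball \<xi> ?s"
      using assms(1) by (rule holomorphic_on_subset) (use sub ball_subset_cball in blast)
    show "continuous_on (cball \<xi> ?s) h"
      using assms(1) sub holomorphic_on_imp_continuous_on continuous_on_subset by blast
    fix y
    assume "cmod (\<xi> - y) = ?s"
    then have "y \<in> cball \<xi> ?s" by (simp add: dist_norm)
    then have "y \<in> unit_disk" by (rule subsetD[OF sub])
    then show "cmod (h y) \<le> C" by (rule assms(2))
  qed (use assms in auto)
  then show "cmod (deriv h \<xi>) \<le> 2 * C / (1 - r)"
    by (simp add: field_simps)
qed (use assms in auto)

text \<open>The filter need not come from a sequence. A common Lipschitz constant on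
  \<open>cball 0 r\<close> turns pointwise into uniform convergence there, as in the Arzela-Ascoli
  argument, and uniform limits of holomorphic functions are holomorphic.\<close>

lemma holomorphic_tendsto:
  assumes F: "F \<noteq> bot"
    and h: "\<forall>\<^sub>F i in F. h i holomorphic_on unit_disk \<and> (\<forall>z\<in>unit_disk. cmod (h i z) \<le> C)"
    and lim: "\<And>z. z \<in> unit_disk \<Longrightarrow> ((\<lambda>i. h i z) \<longlongrightarrow> g z) F"
  shows "g holomorphic_on unit_disk"
proof (rule holomorphic_on_open[THEN iffD2, OF open_ball], safe)
  fix z0 :: complex
  assume "z0 \<in> unit_disk"
  then have "cmod z0 < 1" by simp
  then obtain r where r: "cmod z0 < r" "r < 1" using dense by blast
  then have "0 < r" using norm_ge_zero[of z0] by linarith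
  obtain i where "\<forall>z\<in>unit_disk. cmod (h i z) \<le> C"
    using eventually_happens[OF h] F by auto
  then have "cmod (h i 0) \<le> C" by simp
  then have C: "0 \<le> C" using norm_ge_zero order_trans by blast
  \<comment> \<open>The summand 1 keeps \<open>K\<close> positive even for \<open>C = 0\<close>, so
    that \<open>d\<close> below can be defined by division.\<close>
  define K where "K = 2 * C / (1 - r) + 1"
  have K: "0 < K" using C r by (simp add: K_def add_nonneg_pos)
  have Lip: "\<forall>\<^sub>F i in F. \<forall>w\<in>cball (0::complex) r. \<forall>z\<in>cball (0::complex) r. cmod (h i w - h i z) \<le> K * cmod (w - z)"
    using h
  proof (eventually_elim, intro ballI)
    fix i and w z :: complex
    assume hi: "h i holomorphic_on unit_disk \<and> (\<forall>z\<in>unit_disk. cmod (h i z) \<le> C)"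
      and wz: "w \<in> cball 0 r" "z \<in> cball 0 r"
    have "cmod (h i w - h i z) \<le> 2 * C / (1 - r) * cmod (w - z)"
      using hi wz r \<open>0 < r\<close> by (intro bounded_holomorphic_Lipschitz) auto
    also have "\<dots> \<le> K * cmod (w - z)"
      by (intro mult_right_mono) (auto simp: K_def)
    finally show "cmod (h i w - h i z) \<le> K * cmod (w - z)" .
  qed
  have sub: "cball 0 r \<subseteq> unit_disk" using r by auto
  have Lip': "cmod (g w - g z) \<le> K * cmod (w - z)" if "w \<in> cball 0 r" "z \<in> cball 0 r" for w z
  proof (rule tendsto_upperbound[OF _ _ F])
    show "((\<lambda>i. cmod (h i w - h i z)) \<longlongrightarrow> cmod (g w - g z)) F"
      using that sub by (intro tendsto_intros lim) auto
    show "\<forall>\<^sub>F i in F. cmod (h i w - h i z) \<le> K * cmod (w - z)"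
      using Lip by eventually_elim (use that in blast)
  qed
  have "uniform_limit (cball 0 r) h g F"
  proof (rule uniform_limitI)
    fix e :: real
    assume e: "0 < e"
    \<comment> \<open>On a finite \<open>d\<close>-net, two Lipschitz steps and the error at a net
      point cost \<open>e / 4\<close> each.\<close>
    define d where "d = e / (4 * K)"
    have d: "0 < d" "K * d = e / 4" using e K by (auto simp: d_def)
    have "cball (0::complex) r \<subseteq> (\<Union>x\<in>cball 0 r. ball x d)"
      using d(1) by force
    then obtain k where k: "k \<subseteq> cball (0::complex) r" "finite k" "cball 0 r \<subseteq> (\<Union>x\<in>k. ball x d)"
      by (rule compactE_image[OF compact_cball open_ball])
    have "eventually (\<lambda>i. \<forall>x\<in>k. dist (h i x) (g x) < e / 4) F"
      using k(1,2) sub e by (intro eventually_ball_finite ballI tendstoD[OF lim]) auto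
    with Lip show "\<forall>\<^sub>F i in F. \<forall>x\<in>cball 0 r. dist (h i x) (g x) < e"
    proof eventually_elim
      case (elim i)
      show ?case
      proof
        fix z :: complex
        assume z: "z \<in> cball 0 r"
        then obtain x where x: "x \<in> k" "dist x z < d" using k(3) by auto
        then have "x \<in> cball 0 r" using k(1) by auto
        then have "cmod (h i z - h i x) \<le> K * cmod (z - x)" "cmod (g x - g z) \<le> K * cmod (x - z)"
          using z elim(1) Lip'[of x z] by auto
        moreover have "K * cmod (x - z) \<le> K * d" "cmod (z - x) = cmod (x - z)"
          using x(2) K by (auto simp: dist_norm norm_minus_commute intro!: mult_left_mono)
        moreover have "cmod (h i x - g x) < e / 4"
          using elim(2) x(1) by (simp add: dist_norm)
        moreover have "cmod (h i z - g z) \<le> cmod (h i z - h i x) + cmod (h i x - g x) + cmod (g x - g z)"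
          using norm_triangle_ineq[of "h i z - h i x" "h i x - g x"]
            norm_triangle_ineq[of "h i z - g x" "g x - g z"] by simp
        ultimately show "dist (h i z) (g z) < e"
          using d(2) e unfolding dist_norm by simp
      qed
    qed
  qed
  moreover have "\<forall>\<^sub>F i in F. continuous_on (cball 0 r) (h i) \<and> h i holomorphic_on ball 0 r"
    using h
  proof eventually_elim
    case (elim i)
    then have "h i holomorphic_on cball 0 r" "h i holomorphic_on ball 0 r"
      using sub ball_subset_cball by (blast intro: holomorphic_on_subset)+
    then show ?case by (simp add: holomorphic_on_imp_continuous_on)
  qed
  ultimately have "g holomorphic_on ball 0 r"
    using holomorphic_uniform_limit F by blast
  then show "\<exists>f'. (g has_field_derivative f') (at z0)"
    using r(1) by (auto simp: holomorphic_on_open)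
qed

section \<open>Rosenthal's dichotomy\<close>

text \<open>For \<open>A n\<close> the set where \<open>v n \<ge> s\<close> and \<open>B n\<close>
  the set where \<open>v n \<le> r\<close>: every subsequence from \<open>M\<close> crosses the gap
  between \<open>r\<close> and \<open>s\<close> infinitely often at some point of
  \<open>T\<close>.\<close>

definition oscillates :: "(nat \<Rightarrow> 's set) \<Rightarrow> (nat \<Rightarrow> 's set) \<Rightarrow> 's set \<Rightarrow> nat set \<Rightarrow> bool"
  where "oscillates A B T M \<longleftrightarrow>
    (\<forall>M'\<subseteq>M. infinite M' \<longrightarrow> (\<exists>t\<in>T. infinite {n \<in> M'. t \<in> A n} \<and> infinite {n \<in> M'. t \<in> B n}))"

lemma not_oscillatesE:
  assumes "\<not> oscillates A B T M"
  obtains M' where "M' \<subseteq> M" "infinite M'"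
    "\<And>t. t \<in> T \<Longrightarrow> infinite {n \<in> M'. t \<in> A n} \<Longrightarrow> infinite {n \<in> M'. t \<in> B n} \<Longrightarrow> False"
  using assms unfolding oscillates_def by blast

text \<open>The splitting step of Rosenthal's argument. If it failed, every infinite
  \<open>N\<close> would contain an infinite \<open>N'\<close> settled on one of the two parts of
  some \<open>T\<close> cut at the least element of \<open>N\<close>. Iterate: infinitely many
  stages share the same \<open>T\<close> and the same side, and the least elements from these stages
  contradict the oscillation on \<open>T\<close>.\<close>

lemma oscillates_refine:
  fixes A B :: "nat \<Rightarrow> 's set"
  assumes fin: "finite \<T>" and inf: "infinite M" and osc: "\<And>T. T \<in> \<T> \<Longrightarrow> oscillates A B T M"
  shows "\<exists>n M'. M' \<subseteq> M \<and> infinite M' \<and>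
    (\<forall>T\<in>\<T>. oscillates A B (T \<inter> A n) M' \<and> oscillates A B (T \<inter> B n) M')"
proof (rule ccontr)
  assume neg: "\<not> ?thesis"
  define C where "C e n = (if e then A n else B n)" for e n
  define settled where "settled T M \<longleftrightarrow>
    (\<forall>t\<in>T. \<not> (infinite {n \<in> M. t \<in> A n} \<and> infinite {n \<in> M. t \<in> B n}))" for T M
  have settled_mono: "settled T N" if "settled T N'" "N \<subseteq> N'" for T N N'
  proof -
    have inf: "infinite {n \<in> N'. Q n}" if "infinite {n \<in> N. Q n}" for Q
      using that \<open>N \<subseteq> N'\<close> finite_subset[of "{n \<in> N. Q n}" "{n \<in> N'. Q n}"] by auto
    show ?thesis
      unfolding settled_def
    proof (intro ballI notI)
      fix t
      assume "t \<in> T" "infinite {n \<in> N. t \<in> A n} \<and> infinite {n \<in> N. t \<in> B n}"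
      with that(1) inf[of "\<lambda>n. t \<in> A n"] inf[of "\<lambda>n. t \<in> B n"] show False
        by (auto simp: settled_def)
    qed
  qed
  \<comment> \<open>Staying above \<open>Inf N\<close> makes the least elements of the nested sets
    strictly increasing.\<close>
  have "\<exists>N' T e. N' \<subseteq> N \<inter> {Inf N<..} \<and> infinite N' \<and> T \<in> \<T> \<and> settled (T \<inter> C e (Inf N)) N'"
    if N: "N \<subseteq> M" "infinite N" for N
  proof -
    let ?N = "N \<inter> {Inf N<..}"
    have "N - {..Inf N} \<subseteq> ?N" by auto
    then have "infinite ?N"
      using N(2) by (meson Diff_infinite_finite finite_atMost finite_subset)
    moreover have "?N \<subseteq> M" using N by auto
    ultimately obtain T e where T: "T \<in> \<T>" and "\<not> oscillates A B (T \<inter> C e (Inf N)) ?N"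
      using neg unfolding C_def by (metis (full_types))
    then show ?thesis
      using T unfolding oscillates_def settled_def by blast
  qed
  then obtain \<phi> \<tau> \<epsilon> where step: "\<And>N. N \<subseteq> M \<Longrightarrow> infinite N \<Longrightarrow>
      \<phi> N \<subseteq> N \<inter> {Inf N<..} \<and> infinite (\<phi> N) \<and> \<tau> N \<in> \<T> \<and> settled (\<tau> N \<inter> C (\<epsilon> N) (Inf N)) (\<phi> N)"
    by metis
  define N where "N j = (\<phi> ^^ j) M" for j
  have N: "N j \<subseteq> M \<and> infinite (N j)" for j
  proof (induction j)
    case 0
    then show ?case using inf by (simp add: N_def)
  next
    case (Suc j)
    then have "\<phi> (N j) \<subseteq> N j \<inter> {Inf (N j)<..} \<and> infinite (\<phi> (N j))"
      using step[of "N j"] by blast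
    with Suc show ?case by (auto simp: N_def)
  qed
  have N_Suc: "N (Suc j) \<subseteq> N j \<inter> {Inf (N j)<..}" "\<tau> (N j) \<in> \<T>"
      "settled (\<tau> (N j) \<inter> C (\<epsilon> (N j)) (Inf (N j))) (N (Suc j))" for j
    using step[of "N j"] N[of j] by (simp_all add: N_def)
  have N_dec: "N k \<subseteq> N j" if "j \<le> k" for j k
    using that by (induction rule: dec_induct) (use N_Suc(1) in blast)+
  have Inf_in: "Inf (N j) \<in> N j" for j
    using N[of j] by (intro Inf_nat_def1) auto
  have "strict_mono (\<lambda>j. Inf (N j))"
    unfolding strict_mono_Suc_iff using Inf_in N_Suc(1) by fastforce
  then have inj: "inj (\<lambda>j. Inf (N j))" by (rule strict_mono_imp_inj_on)
  have "finite ((\<lambda>j. (\<tau> (N j), \<epsilon> (N j))) ` UNIV)"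
    by (rule finite_subset[of _ "\<T> \<times> UNIV"]) (use N_Suc(2) fin in auto)
  then obtain j0 where "infinite {j. (\<tau> (N j), \<epsilon> (N j)) = (\<tau> (N j0), \<epsilon> (N j0))}"
    using pigeonhole_infinite[of UNIV "\<lambda>j. (\<tau> (N j), \<epsilon> (N j))"] by auto
  then obtain J T e where J: "infinite J" "\<And>j. j \<in> J \<Longrightarrow> \<tau> (N j) = T \<and> \<epsilon> (N j) = e"
    by (metis (mono_tags, lifting) mem_Collect_eq prod.inject)
  from J(1) have "J \<noteq> {}" by auto
  then obtain j1 where "j1 \<in> J" by auto
  then have T: "T \<in> \<T>" using N_Suc(2) J(2) by blast
  define M2 where "M2 = (\<lambda>j. Inf (N j)) ` J"
  have "infinite M2"
    using J(1) inj_on_subset[OF inj] by (simp add: M2_def finite_image_iff)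
  moreover have "Inf (N j) \<in> M" for j
    using N[of j] Inf_in[of j] by blast
  then have "M2 \<subseteq> M" by (auto simp: M2_def)
  ultimately obtain t where t: "t \<in> T" "infinite {n \<in> M2. t \<in> A n}" "infinite {n \<in> M2. t \<in> B n}"
    using osc[OF T] unfolding oscillates_def by blast
  then have "infinite {n \<in> M2. t \<in> C e n}" by (cases e) (simp_all add: C_def)
  then obtain n where "n \<in> M2" "t \<in> C e n"
    by (metis (mono_tags, lifting) mem_Collect_eq not_finite_existsD)
  then obtain j where j: "j \<in> J" "t \<in> C e (Inf (N j))" by (auto simp: M2_def)
  \<comment> \<open>All but finitely many of the chosen least elements lie in
    \<open>N (Suc j)\<close>, so what recurs along \<open>M2\<close> recurs along
    \<open>N (Suc j)\<close>.\<close>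
  have tail: "infinite {n \<in> N (Suc j). Q n}" if "infinite {n \<in> M2. Q n}" for Q
  proof
    assume "finite {n \<in> N (Suc j). Q n}"
    moreover have "{n \<in> M2. Q n} \<subseteq> {n \<in> N (Suc j). Q n} \<union> (\<lambda>i. Inf (N i)) ` {..j}"
    proof
      fix n
      assume "n \<in> {n \<in> M2. Q n}"
      then obtain i where i: "i \<in> J" "n = Inf (N i)" "Q n" by (auto simp: M2_def)
      show "n \<in> {n \<in> N (Suc j). Q n} \<union> (\<lambda>i. Inf (N i)) ` {..j}"
      proof (cases "i \<le> j")
        case False
        then have "N i \<subseteq> N (Suc j)" by (intro N_dec) simp
        then show ?thesis using i Inf_in[of i] by auto
      qed (use i in auto)
    qed
    ultimately have "finite {n \<in> M2. Q n}"
      by (meson finite_UnI finite_atMost finite_imageI finite_subset)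
    with that show False by simp
  qed
  have "settled (T \<inter> C e (Inf (N j))) (N (Suc j))"
    using N_Suc(3)[of j] J(2)[OF j(1)] by simp
  with t(1) j(2) tail[OF t(2)] tail[OF t(3)] show False
    unfolding settled_def by blast
qed

text \<open>Repeated splitting of \<open>{S}\<close> produces all \<open>2 ^ k\<close> intersections
  with one side chosen at each of the first \<open>k\<close> indices. Each still oscillates along an
  infinite set, and an oscillating set has a point.\<close>

lemma oscillates_independent:
  fixes A B :: "nat \<Rightarrow> 's set"
  assumes "infinite M" "oscillates A B S M"
  obtains \<nu> where "\<And>(k::nat) P. \<exists>t\<in>S. \<forall>i<k. if i \<in> P then t \<in> A (\<nu> i) else t \<in> B (\<nu> i)"
proof -
  define good where "good \<T> M \<longleftrightarrow> finite \<T> \<and> infinite M \<and> (\<forall>T\<in>\<T>. oscillates A B T M)" for \<T> M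
  define split where "split n \<T> = (\<lambda>T. T \<inter> A n) ` \<T> \<union> (\<lambda>T. T \<inter> B n) ` \<T>" for n \<T>
  have "\<exists>n M'. good (split n \<T>) M'" if "good \<T> M" for \<T> M
  proof -
    obtain n M' where "infinite M'"
      "\<forall>T\<in>\<T>. oscillates A B (T \<inter> A n) M' \<and> oscillates A B (T \<inter> B n) M'"
      using oscillates_refine[of \<T> M A B] \<open>good \<T> M\<close> unfolding good_def by blast
    moreover have "finite (split n \<T>)"
      using that by (simp add: good_def split_def)
    ultimately have "good (split n \<T>) M'"
      by (auto simp: good_def split_def)
    then show ?thesis by blast
  qed
  then have "\<forall>\<T> M. \<exists>n M'. good \<T> M \<longrightarrow> good (split n \<T>) M'" by blast
  then obtain f g where fg: "\<And>\<T> M. good \<T> M \<Longrightarrow> good (split (f \<T> M) \<T>) (g \<T> M)"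
    unfolding choice_iff by blast
  define st where "st = rec_nat ({S}, M) (\<lambda>_ (\<T>, M). (split (f \<T> M) \<T>, g \<T> M))"
  define \<T> where "\<T> k = fst (st k)" for k
  define \<nu> where "\<nu> k = f (fst (st k)) (snd (st k))" for k
  have st_Suc: "st (Suc k) = (split (\<nu> k) (\<T> k), g (\<T> k) (snd (st k)))" for k
    by (simp add: st_def \<nu>_def \<T>_def case_prod_beta)
  have good: "good (\<T> k) (snd (st k))" for k
  proof (induction k)
    case 0
    then show ?case using assms by (simp add: good_def \<T>_def st_def)
  next
    case (Suc k)
    then show ?case
      using fg[of "\<T> k" "snd (st k)"] st_Suc[of k] by (simp add: \<T>_def \<nu>_def)
  qed
  have mem: "S \<inter> (\<Inter>i<k. if i \<in> P then A (\<nu> i) else B (\<nu> i)) \<in> \<T> k" for k P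
  proof (induction k)
    case 0
    then show ?case by (simp add: \<T>_def st_def)
  next
    case (Suc k)
    let ?X = "\<lambda>i. if i \<in> P then A (\<nu> i) else B (\<nu> i)"
    have "S \<inter> (\<Inter>i<Suc k. ?X i) = S \<inter> (\<Inter>i<k. ?X i) \<inter> ?X k"
      by (auto simp: lessThan_Suc)
    also have "\<dots> \<in> split (\<nu> k) (\<T> k)"
      using Suc by (auto simp: split_def)
    also have "\<dots> = \<T> (Suc k)"
      by (simp add: \<T>_def st_Suc)
    finally show ?case .
  qed
  show ?thesis
  proof (rule that)
    fix k :: nat and P
    let ?T = "S \<inter> (\<Inter>i<k. if i \<in> P then A (\<nu> i) else B (\<nu> i))"
    have "infinite (snd (st k))" "oscillates A B ?T (snd (st k))"
      using good[of k] mem[where k = k and P = P] by (auto simp: good_def)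
    then obtain t where "t \<in> ?T" unfolding oscillates_def by blast
    then show "\<exists>t\<in>S. \<forall>i<k. if i \<in> P then t \<in> A (\<nu> i) else t \<in> B (\<nu> i)"
      by (intro bexI[of _ t]) (auto split: if_splits)
  qed
qed

text \<open>Some subsequence converges to a number \<open>l\<close>, while infinitely many terms
  stay at distance \<open>e\<close> on one side of it; the thresholds fit in between. They are
  rational so that a diagonal argument meets only countably many pairs.\<close>

lemma not_convergent_oscillates:
  fixes a :: "nat \<Rightarrow> real"
  assumes "bounded (range a)" "\<not> convergent a"
  obtains r s :: rat where "r < s" "infinite {n. of_rat s \<le> a n}" "infinite {n. a n \<le> of_rat r}"
proof -
  obtain l \<rho> where l: "strict_mono \<rho>" "(a \<circ> \<rho>) \<longlonglongrightarrow> l"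
    using bounded_imp_convergent_subsequence[OF assms(1)] by (auto simp: o_def)
  from assms(2) have "\<not> a \<longlonglongrightarrow> l" by (auto simp: convergent_def)
  then obtain e where e: "0 < e" "\<not> eventually (\<lambda>n. dist (a n) l < e) sequentially"
    by (auto simp: tendsto_iff)
  then have "infinite {n. \<not> dist (a n) l < e}"
    by (simp add: eventually_cofinite cofinite_eq_sequentially[symmetric])
  moreover have "{n. \<not> dist (a n) l < e} = {n. l + e \<le> a n} \<union> {n. a n \<le> l - e}"
    using e(1) by (auto simp: dist_real_def)
  ultimately have alt: "infinite {n. l + e \<le> a n} \<or> infinite {n. a n \<le> l - e}"
    by simp
  have near: "infinite {n. \<bar>a n - l\<bar> < d}" if "0 < d" for d
  proof -
    have "eventually (\<lambda>k. dist (a (\<rho> k)) l < d) sequentially"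
      using l(2) that by (auto simp: tendsto_iff)
    then obtain K where "\<And>k. K \<le> k \<Longrightarrow> dist (a (\<rho> k)) l < d"
      by (auto simp: eventually_sequentially)
    then have "\<rho> ` {K..} \<subseteq> {n. \<bar>a n - l\<bar> < d}" by (auto simp: dist_real_def)
    moreover have "infinite (\<rho> ` {K..})"
      using strict_mono_imp_inj_on[OF l(1)] infinite_Ici[of K]
      by (metis finite_imageD inj_on_subset subset_UNIV)
    ultimately show ?thesis using finite_subset by blast
  qed
  have sup: "infinite {n. Q n}" if "infinite {n. P n}" "\<And>n. P n \<Longrightarrow> Q n" for P Q :: "nat \<Rightarrow> bool"
    using that finite_subset[of "{n. P n}" "{n. Q n}"] by blast
  from alt show ?thesis
  proof
    assume inf: "infinite {n. l + e \<le> a n}"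
    obtain s :: rat where s: "l + e / 2 < of_rat s" "of_rat s < l + e"
      using of_rat_dense[of "l + e / 2" "l + e"] e(1) by auto
    obtain r :: rat where r: "l + e / 3 < of_rat r" "of_rat r < l + e / 2"
      using of_rat_dense[of "l + e / 3" "l + e / 2"] e(1) by auto
    show ?thesis
    proof (rule that[of r s])
      show "r < s" using r(2) s(1) by (simp add: of_rat_less[symmetric, where 'a = real])
      show "infinite {n. of_rat s \<le> a n}" by (rule sup[OF inf]) (use s in auto)
      show "infinite {n. a n \<le> of_rat r}"
      proof (rule sup[OF near[of "e / 3"]])
        fix n
        assume "\<bar>a n - l\<bar> < e / 3"
        with r show "a n \<le> of_rat r" by linarith
      qed (use e(1) in simp)
    qed
  next
    assume inf: "infinite {n. a n \<le> l - e}"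
    obtain r :: rat where r: "l - e < of_rat r" "of_rat r < l - e / 2"
      using of_rat_dense[of "l - e" "l - e / 2"] e(1) by auto
    obtain s :: rat where s: "l - e / 2 < of_rat s" "of_rat s < l - e / 3"
      using of_rat_dense[of "l - e / 2" "l - e / 3"] e(1) by auto
    show ?thesis
    proof (rule that[of r s])
      show "r < s" using r(2) s(1) by (simp add: of_rat_less[symmetric, where 'a = real])
      show "infinite {n. a n \<le> of_rat r}" by (rule sup[OF inf]) (use r in auto)
      show "infinite {n. of_rat s \<le> a n}"
      proof (rule sup[OF near[of "e / 3"]])
        fix n
        assume "\<bar>a n - l\<bar> < e / 3"
        with s show "of_rat s \<le> a n" by linarith
      qed (use e(1) in simp)
    qed
  qed
qed

text \<open>If no pair \<open>r < s\<close> oscillates along any infinite set, every subsequence can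
  be thinned until it stops crossing a given gap at all points of \<open>S\<close>. Diagonalizing
  over the rational gaps leaves a sequence that converges on \<open>S\<close>.\<close>

lemma Rosenthal_dichotomy:
  fixes v :: "nat \<Rightarrow> 's \<Rightarrow> real"
  assumes bdd: "\<And>t. t \<in> S \<Longrightarrow> bounded (range (\<lambda>n. v n t))"
  obtains (convergent) \<nu> where "strict_mono \<nu>" "\<And>t. t \<in> S \<Longrightarrow> convergent (\<lambda>k. v (\<nu> k) t)"
  | (independent) r s :: real and \<nu> where "r < s"
      "\<And>(k::nat) P. \<exists>t\<in>S. \<forall>i<k. if i \<in> P then s \<le> v (\<nu> i) t else v (\<nu> i) t \<le> r"
proof (cases "\<exists>r s M. (r::real) < s \<and> infinite M \<and> oscillates (\<lambda>n. {t. s \<le> v n t}) (\<lambda>n. {t. v n t \<le> r}) S M")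
  case True
  then obtain r s M where rs: "(r::real) < s" and M: "infinite M"
    "oscillates (\<lambda>n. {t. s \<le> v n t}) (\<lambda>n. {t. v n t \<le> r}) S M"
    by blast
  obtain \<nu> where \<nu>: "\<And>(k::nat) P. \<exists>t\<in>S. \<forall>i<k. if i \<in> P then t \<in> {t. s \<le> v (\<nu> i) t} else t \<in> {t. v (\<nu> i) t \<le> r}"
    using oscillates_independent[OF M] by blast
  show ?thesis
    by (rule independent[OF rs, of \<nu>]) (use \<nu> in \<open>simp only: mem_Collect_eq\<close>)
next
  case False
  define q :: "nat \<Rightarrow> rat \<times> rat" where "q = from_nat"
  \<comment> \<open>The condition is vacuous unless the pair is increasing, so all of
    \<open>rat \<times> rat\<close> can be enumerated.\<close>
  define Q where "Q n \<sigma> \<longleftrightarrow> (fst (q n) < snd (q n) \<longrightarrow>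
    (\<forall>t\<in>S. \<not> (infinite {i. of_rat (snd (q n)) \<le> v (\<sigma> i) t} \<and> infinite {i. v (\<sigma> i) t \<le> of_rat (fst (q n))})))"
    for n and \<sigma> :: "nat \<Rightarrow> nat"
  have image: "infinite {n \<in> range \<sigma>. R n}" if "strict_mono \<sigma>" "infinite {i. R (\<sigma> i)}"
    for \<sigma> :: "nat \<Rightarrow> nat" and R
  proof -
    have "\<sigma> ` {i. R (\<sigma> i)} \<subseteq> {n \<in> range \<sigma>. R n}" by auto
    moreover have "infinite (\<sigma> ` {i. R (\<sigma> i)})"
      using that strict_mono_imp_inj_on[of \<sigma>] by (metis finite_imageD inj_on_subset subset_UNIV)
    ultimately show ?thesis using finite_subset by blast
  qed
  interpret subseqs Q
  proof
    fix n and \<sigma> :: "nat \<Rightarrow> nat"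
    assume \<sigma>: "strict_mono \<sigma>"
    show "\<exists>\<rho>. strict_mono \<rho> \<and> Q n (\<sigma> \<circ> \<rho>)"
    proof (cases "fst (q n) < snd (q n)")
      case True
      then have "real_of_rat (fst (q n)) < real_of_rat (snd (q n))"
        by (simp add: of_rat_less)
      moreover have "infinite (range \<sigma>)"
        using \<sigma> by (simp add: finite_image_iff strict_mono_imp_inj_on)
      ultimately have "\<not> oscillates (\<lambda>m. {t. of_rat (snd (q n)) \<le> v m t}) (\<lambda>m. {t. v m t \<le> of_rat (fst (q n))}) S (range \<sigma>)"
        using False by blast
      then obtain M' where M': "M' \<subseteq> range \<sigma>" "infinite M'"
        "\<And>t. t \<in> S \<Longrightarrow> infinite {m \<in> M'. t \<in> {t. of_rat (snd (q n)) \<le> v m t}} \<Longrightarrow>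
          infinite {m \<in> M'. t \<in> {t. v m t \<le> of_rat (fst (q n))}} \<Longrightarrow> False"
        by (rule not_oscillatesE) blast
      define I where "I = \<sigma> -` M'"
      have M'I: "M' = \<sigma> ` I" using M'(1) by (auto simp: I_def)
      then have I: "infinite I" using M'(2) by auto
      have enum: "strict_mono (enumerate I)" "range (enumerate I) = I"
        using I strict_mono_enumerate range_enumerate by auto
      then have "range (\<sigma> \<circ> enumerate I) = M'"
        by (metis M'I image_comp)
      moreover have "strict_mono (\<sigma> \<circ> enumerate I)"
        using \<sigma> enum(1) by (rule strict_mono_o)
      ultimately have img: "infinite {m \<in> M'. R m}" if "infinite {i. R ((\<sigma> \<circ> enumerate I) i)}" for R
        using image[of "\<sigma> \<circ> enumerate I" R] that by simp
      have "Q n (\<sigma> \<circ> enumerate I)"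
        unfolding Q_def
      proof (intro impI ballI notI, elim conjE)
        fix t
        assume "t \<in> S" "infinite {i. of_rat (snd (q n)) \<le> v ((\<sigma> \<circ> enumerate I) i) t}"
          "infinite {i. v ((\<sigma> \<circ> enumerate I) i) t \<le> of_rat (fst (q n))}"
        then show False
          using M'(3)[of t] img[of "\<lambda>m. of_rat (snd (q n)) \<le> v m t"]
            img[of "\<lambda>m. v m t \<le> of_rat (fst (q n))"] by simp
      qed
      with enum(1) show ?thesis by blast
    next
      case False
      then show ?thesis by (auto simp: Q_def intro!: exI[of _ id] strict_mono_id)
    qed
  qed
  have Q_stable: "Q n (\<sigma> \<circ> \<rho>)" if "strict_mono \<rho>" "Q n \<sigma>" for n \<sigma> \<rho>
  proof -
    have inf: "infinite {i. R (\<sigma> i)}" if "infinite {i. R ((\<sigma> \<circ> \<rho>) i)}" for R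
    proof -
      have "infinite (\<rho> ` {i. R ((\<sigma> \<circ> \<rho>) i)})"
        using that strict_mono_imp_inj_on[OF \<open>strict_mono \<rho>\<close>]
        by (metis finite_imageD inj_on_subset subset_UNIV)
      moreover have "\<rho> ` {i. R ((\<sigma> \<circ> \<rho>) i)} \<subseteq> {i. R (\<sigma> i)}" by auto
      ultimately show ?thesis using finite_subset by blast
    qed
    show ?thesis
      unfolding Q_def
    proof (intro impI ballI notI, elim conjE)
      fix t
      assume "fst (q n) < snd (q n)" "t \<in> S"
        "infinite {i. of_rat (snd (q n)) \<le> v ((\<sigma> \<circ> \<rho>) i) t}"
        "infinite {i. v ((\<sigma> \<circ> \<rho>) i) t \<le> of_rat (fst (q n))}"
      then show False
        using that(2) inf[of "\<lambda>m. of_rat (snd (q n)) \<le> v m t"]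
          inf[of "\<lambda>m. v m t \<le> of_rat (fst (q n))"] unfolding Q_def by blast
    qed
  qed
  have "convergent (\<lambda>k. v (diagseq k) t)" if t: "t \<in> S" for t
  proof (rule ccontr)
    assume "\<not> ?thesis"
    moreover have "bounded (range (\<lambda>k. v (diagseq k) t))"
      using bdd[OF t] by (rule bounded_subset) auto
    ultimately obtain r s :: rat where rs: "r < s" "infinite {k. of_rat s \<le> v (diagseq k) t}"
      "infinite {k. v (diagseq k) t \<le> of_rat r}"
      using not_convergent_oscillates by blast
    define n where "n = to_nat (r, s)"
    \<comment> \<open>Only the tail of the diagonal sequence obeys the \<open>n\<close>-th
      condition; the finitely many earlier terms do not affect an infinite set.\<close>
    have "Q n (diagseq \<circ> (+) (Suc n))"
      by (rule diagseq_holds) (rule Q_stable)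
    moreover have inf: "infinite {i. R ((diagseq \<circ> (+) (Suc n)) i)}" if "infinite {i. R (diagseq i)}" for R
    proof
      assume "finite {i. R ((diagseq \<circ> (+) (Suc n)) i)}"
      moreover have "{i. R (diagseq i)} \<subseteq> (+) (Suc n) ` {i. R ((diagseq \<circ> (+) (Suc n)) i)} \<union> {..n}"
      proof
        fix i
        assume "i \<in> {i. R (diagseq i)}"
        then show "i \<in> (+) (Suc n) ` {i. R ((diagseq \<circ> (+) (Suc n)) i)} \<union> {..n}"
          by (cases "i \<le> n") (auto intro!: image_eqI[of _ _ "i - Suc n"])
      qed
      ultimately show False
        using that by (meson finite_UnI finite_atMost finite_imageI finite_subset)
    qed
    ultimately show False
      using rs t inf[of "\<lambda>m. of_rat s \<le> v m t"] inf[of "\<lambda>m. v m t \<le> of_rat r"]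
      unfolding Q_def n_def q_def by auto
  qed
  with subseq_diagseq show ?thesis by (rule convergent)
qed

section \<open>Weak-star null sequences in the bidual\<close>

text \<open>If a new functional \<open>L\<close> does not vanish on the joint kernel so far, a
  single \<open>v\<close> in that kernel with \<open>L v \<noteq> 0\<close> is added to
  \<open>F\<close> and absorbs the value of \<open>L\<close>.\<close>

lemma finite_codimension:
  fixes S :: "('a::complex_banach \<Rightarrow> complex) set"
  assumes "finite S" "\<And>L. L \<in> S \<Longrightarrow> clinear L"
  shows "\<exists>F. finite F \<and> (\<forall>x. \<exists>y. (\<forall>L\<in>S. L y = 0) \<and> x - y \<in> complex_space.span F)"
  using assms
proof (induction S)
  case empty
  show ?case
    by (rule exI[of _ "{}"]) (auto intro!: exI[of "\<lambda>y. _ - y = 0"] complex_space.span_zero)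
next
  case (insert L S)
  then obtain F where F: "finite F"
    "\<And>x. \<exists>y. (\<forall>L\<in>S. L y = 0) \<and> x - y \<in> complex_space.span F"
    by auto
  have L: "clinear L" using insert.prems by simp
  show ?case
  proof (cases "\<exists>v. (\<forall>L\<in>S. L v = 0) \<and> L v \<noteq> 0")
    case True
    then obtain v where v: "\<And>L. L \<in> S \<Longrightarrow> L v = 0" "L v \<noteq> 0" by auto
    show ?thesis
    proof (intro exI[of _ "insert v F"] conjI allI)
      fix x
      obtain y where y: "\<And>L. L \<in> S \<Longrightarrow> L y = 0" "x - y \<in> complex_space.span F"
        using F(2)[of x] by auto
      let ?y = "y - (L y / L v) *\<^sub>C v"
      have "L' ?y = 0" if "L' \<in> insert L S" for L'
        using that v(2) v(1)[of L'] y(1)[of L'] L insert.prems[of L'] by (auto simp: clinearD)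
      moreover have "x - y \<in> complex_space.span (insert v F)"
        using y(2) complex_space.span_mono[of F "insert v F"] by auto
      then have "(x - y) + (L y / L v) *\<^sub>C v \<in> complex_space.span (insert v F)"
        by (intro complex_space.span_add complex_space.span_scale)
          (auto intro: complex_space.span_base)
      then have "x - ?y \<in> complex_space.span (insert v F)"
        by (simp add: algebra_simps)
      ultimately show "\<exists>y. (\<forall>L\<in>insert L S. L y = 0) \<and> x - y \<in> complex_space.span (insert v F)"
        by blast
    qed (use F(1) in simp)
  next
    case False
    then have "(\<forall>L\<in>insert L S. L y = 0) \<longleftrightarrow> (\<forall>L\<in>S. L y = 0)" for y by auto
    then show ?thesis using F by (intro exI[of _ F]) simp
  qed
qed

lemma infinite_dimensional_kernel:
  fixes S :: "('a::complex_banach \<Rightarrow> complex) set"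
  assumes inf: "infinite_dimensional TYPE('a)" and S: "finite S" "\<And>L. L \<in> S \<Longrightarrow> clinear L"
  obtains x where "norm x = 1" "\<And>L. L \<in> S \<Longrightarrow> L x = 0"
proof -
  obtain F where F: "finite F" "\<And>x. \<exists>y. (\<forall>L\<in>S. L y = 0) \<and> x - y \<in> complex_space.span F"
    using finite_codimension[OF S] by blast
  have "complex_space.span F \<noteq> UNIV"
    using inf F(1) by (auto simp: infinite_dimensional_def)
  then obtain x where "x \<notin> complex_space.span F" by auto
  then obtain y where y: "y \<noteq> 0" "\<And>L. L \<in> S \<Longrightarrow> L y = 0"
    using F(2)[of x] by force
  show ?thesis
    by (rule that[of "y /\<^sub>R norm y"]) (use y S(2) in \<open>auto simp: clinearD\<close>)
qed

text \<open>Each vector is taken in the kernel of norming functionals of all earlier ones. The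
  functional that norms \<open>x m\<close> then takes the value - 1 at
  \<open>x n - x m\<close>.\<close>

lemma ex_separated_sequence:
  assumes inf: "infinite_dimensional TYPE('a::complex_banach)"
  obtains x :: "nat \<Rightarrow> 'a::complex_banach" where "\<And>n. norm (x n) = 1" "\<And>m n. m < n \<Longrightarrow> 1 \<le> norm (x n - x m)"
proof -
  have ex: "\<exists>x L. norm x = 1 \<and> (\<forall>L\<in>S. L x = 0) \<and> L \<in> dual_ball \<and> L x = 1"
    if S: "finite S" "S \<subseteq> dual_ball" for S :: "('a \<Rightarrow> complex) set"
  proof -
    obtain x where x: "norm x = 1" "\<And>L. L \<in> S \<Longrightarrow> L x = 0"
      by (rule infinite_dimensional_kernel[OF inf S(1)]) (use S(2) dual_ballD(1) in auto)
    obtain L where "L \<in> dual_ball" "L x = complex_of_real (norm x)"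
      by (rule dual_ball_norming)
    with x show ?thesis by auto
  qed
  \<comment> \<open>The condition on \<open>S\<close> is a premise inside the relation, so that the
    choice functions are total.\<close>
  define extends where "extends S x L \<longleftrightarrow> (finite S \<and> S \<subseteq> dual_ball \<longrightarrow>
      norm x = 1 \<and> (\<forall>L\<in>S. L x = 0) \<and> L \<in> dual_ball \<and> L x = 1)"
    for S and x :: 'a and L
  have "\<exists>x L. extends S x L" for S
    using ex[of S] unfolding extends_def by blast
  then obtain \<xi> \<Lambda> where ext: "\<And>S. extends S (\<xi> S) (\<Lambda> S)" by metis
  have step: "norm (\<xi> S) = 1 \<and> (\<forall>L\<in>S. L (\<xi> S) = 0) \<and> \<Lambda> S \<in> dual_ball \<and> \<Lambda> S (\<xi> S) = 1"
    if "finite S" "S \<subseteq> dual_ball" for S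
    using ext[of S] that by (simp add: extends_def)
  define S where "S = rec_nat {} (\<lambda>_ S. insert (\<Lambda> S) S)"
  have S_Suc: "S (Suc n) = insert (\<Lambda> (S n)) (S n)" for n by (simp add: S_def)
  have S: "finite (S n) \<and> S n \<subseteq> dual_ball" for n
  proof (induction n)
    case (Suc n)
    then show ?case using step[of "S n"] by (simp add: S_Suc)
  qed (simp add: S_def)
  note step' = step[OF conjunct1[OF S] conjunct2[OF S]]
  have S_mono: "S m \<subseteq> S n" if "m \<le> n" for m n
    using that by (induction rule: dec_induct) (auto simp: S_Suc)
  show ?thesis
  proof (rule that[of "\<lambda>n. \<xi> (S n)"])
    show "norm (\<xi> (S n)) = 1" for n using step' by blast
    fix m n :: nat
    assume "m < n"
    then have "\<Lambda> (S m) \<in> S n"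
      using S_mono[of "Suc m" n] by (auto simp: S_Suc)
    then have "\<Lambda> (S m) (\<xi> (S n) - \<xi> (S m)) = - 1"
      using step' by (simp add: clinearD(4)[OF dual_ballD(1)])
    then show "1 \<le> norm (\<xi> (S n) - \<xi> (S m))"
      using dual_ballD(2)[of "\<Lambda> (S m)" "\<xi> (S n) - \<xi> (S m)"] step' by simp
  qed
qed

section \<open>Rademacher averages\<close>

definition rade :: "nat \<Rightarrow> nat \<Rightarrow> real"
  where "rade k j = (if bit j k then 1 else - 1)"

text \<open>Binary digits identify \<open>{..<2 ^ m}\<close> with the sign cube of dimension
  \<open>m\<close>, on which \<open>rade k\<close> is the \<open>k\<close>-th coordinate. Flipping
  digit \<open>k\<close> permutes the cube, negates \<open>rade k\<close> and leaves
  \<open>f\<close> alone.\<close>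

lemma sum_rade_flip:
  assumes "k < m" and "\<And>j. f (flip_bit k j) = f j"
  shows "(\<Sum>j<2 ^ m. rade k j * f j) = 0"
proof -
  have mem: "flip_bit k j < 2 ^ m" if "j < 2 ^ m" for j :: nat
    using that assms(1) by (simp add: take_bit_flip_bit_eq flip: take_bit_nat_eq_self_iff)
  have invol: "flip_bit k (flip_bit k j) = j" for j :: nat
    by (rule bit_eqI) (auto simp: bit_flip_bit_iff)
  have "bij_betw (flip_bit k) {..<2 ^ m} {..<(2::nat) ^ m}"
    by (rule bij_betw_byWitness[where f' = "flip_bit k"]) (auto simp: invol mem)
  then have "(\<Sum>j<2 ^ m. rade k j * f j) = (\<Sum>j<2 ^ m. rade k (flip_bit k j) * f (flip_bit k j))"
    by (rule sum.reindex_bij_betw[symmetric])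
  also have "\<dots> = (\<Sum>j<2 ^ m. - (rade k j * f j))"
    by (intro sum.cong) (auto simp: assms(2) rade_def bit_flip_bit_iff)
  finally show ?thesis by (simp add: sum_negf)
qed

lemma sum_rade: "k < m \<Longrightarrow> (\<Sum>j<2 ^ m. rade k j) = 0"
  using sum_rade_flip[of k m "\<lambda>_. 1"] by simp

lemma sum_rade_rade:
  assumes "k < m" "l < m"
  shows "(\<Sum>j<2 ^ m. rade k j * rade l j) = (if k = l then 2 ^ m else 0)"
proof (cases "k = l")
  case True
  have "(\<Sum>j<2 ^ m. rade k j * rade l j) = (\<Sum>j<(2::nat) ^ m. 1)"
    by (intro sum.cong) (auto simp: True rade_def)
  then show ?thesis using True by simp
next
  case False
  then show ?thesis
    using sum_rade_flip[OF assms(1), of "rade l"] by (simp add: rade_def bit_flip_bit_iff)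
qed

text \<open>In the normalized inner product on \<open>{..<2 ^ m}\<close> the functions
  \<open>rade k\<close> are orthonormal, and \<open>w\<close> is the orthogonal projection of
  \<open>v\<close> onto their span.\<close>

lemma rade_Bessel:
  fixes v :: "nat \<Rightarrow> real" and m :: nat
  defines "c \<equiv> \<lambda>k. (\<Sum>j<2 ^ m. rade k j * v j) / 2 ^ m"
  assumes "\<And>j. j < 2 ^ m \<Longrightarrow> \<bar>v j\<bar> \<le> 1"
  shows "(\<Sum>k<m. (c k)\<^sup>2) \<le> 1"
proof -
  define w where "w j = (\<Sum>k<m. c k * rade k j)" for j
  have c: "(\<Sum>j<2 ^ m. rade k j * v j) = 2 ^ m * c k" for k
    by (simp add: c_def)
  have "(\<Sum>j<2 ^ m. v j * w j) = (\<Sum>j<2 ^ m. \<Sum>k<m. c k * (rade k j * v j))"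
    by (simp add: w_def sum_distrib_left ac_simps)
  also have "\<dots> = (\<Sum>k<m. c k * (\<Sum>j<2 ^ m. rade k j * v j))"
    by (subst sum.swap) (simp add: sum_distrib_left)
  also have "\<dots> = 2 ^ m * (\<Sum>k<m. (c k)\<^sup>2)"
    unfolding c by (simp add: sum_distrib_left power2_eq_square ac_simps)
  finally have vw: "(\<Sum>j<2 ^ m. v j * w j) = 2 ^ m * (\<Sum>k<m. (c k)\<^sup>2)" .
  have "(\<Sum>j<2 ^ m. w j * w j) = (\<Sum>j<2 ^ m. \<Sum>k<m. \<Sum>l<m. c k * (c l * (rade k j * rade l j)))"
    by (simp add: w_def sum_product ac_simps)
  also have "\<dots> = (\<Sum>k<m. \<Sum>l<m. c k * (c l * (\<Sum>j<2 ^ m. rade k j * rade l j)))"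
    by (subst sum.swap, rule sum.cong[OF refl], subst sum.swap) (simp add: sum_distrib_left)
  also have "\<dots> = 2 ^ m * (\<Sum>k<m. (c k)\<^sup>2)"
    by (simp add: sum_rade_rade if_distrib[of "\<lambda>x. _ * x"] power2_eq_square sum_distrib_left ac_simps
        cong: if_cong)
  finally have ww: "(\<Sum>j<2 ^ m. w j * w j) = 2 ^ m * (\<Sum>k<m. (c k)\<^sup>2)" .
  have "0 \<le> (\<Sum>j<2 ^ m. (v j - w j)\<^sup>2)"
    by (intro sum_nonneg) auto
  also have "\<dots> = (\<Sum>j<2 ^ m. (v j)\<^sup>2) - 2 * (\<Sum>j<2 ^ m. v j * w j) + (\<Sum>j<2 ^ m. w j * w j)"
    by (simp add: power2_eq_square algebra_simps sum.distrib sum_subtractf sum_distrib_left)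
  also have "\<dots> = (\<Sum>j<2 ^ m. (v j)\<^sup>2) - 2 ^ m * (\<Sum>k<m. (c k)\<^sup>2)"
    by (simp add: vw ww)
  also have "(\<Sum>j<2 ^ m. (v j)\<^sup>2) \<le> (\<Sum>j<(2::nat) ^ m. 1)"
    using assms(2) by (intro sum_mono) (simp add: abs_square_le_1)
  finally show ?thesis by simp
qed

definition rade_avg :: "(nat \<Rightarrow> 'a::real_normed_vector) \<Rightarrow> nat \<Rightarrow> nat \<Rightarrow> 'a"
  where "rade_avg x k m = (\<Sum>j<2 ^ m. rade k j *\<^sub>R x j) /\<^sub>R 2 ^ m"

lemma norm_rade_avg_le:
  assumes "\<And>j. norm (x j) \<le> 1"
  shows "norm (rade_avg x k m) \<le> 1"
proof -
  have "norm (\<Sum>j<2 ^ m. rade k j *\<^sub>R x j) \<le> (\<Sum>j<(2::nat) ^ m. 1)"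
    using assms by (intro sum_norm_le) (simp add: rade_def)
  then show ?thesis by (simp add: rade_avg_def field_simps)
qed

lemma clinear_rade_avg:
  assumes "clinear L"
  shows "Re (L (rade_avg x k m)) = (\<Sum>j<2 ^ m. rade k j * Re (L (x j))) / 2 ^ m"
    and "Im (L (rade_avg x k m)) = (\<Sum>j<2 ^ m. rade k j * Im (L (x j))) / 2 ^ m"
  by (simp_all add: rade_avg_def clinearD[OF assms] clinear_sum[OF assms] divide_inverse)

text \<open>The bound is 2 because the real inequality is applied to real and imaginary parts
  separately.\<close>

lemma rade_avg_Bessel:
  assumes L: "L \<in> dual_ball" and x: "\<And>j. norm (x j) \<le> 1"
  shows "(\<Sum>k<m. (cmod (L (rade_avg x k m)))\<^sup>2) \<le> 2"
proof -
  have "cmod (L (x j)) \<le> 1" for j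
    using dual_ballD(2)[OF L, of "x j"] x[of j] by simp
  then have bd: "\<bar>Re (L (x j))\<bar> \<le> 1" "\<bar>Im (L (x j))\<bar> \<le> 1" for j
    using abs_Re_le_cmod abs_Im_le_cmod order_trans by blast+
  have "(\<Sum>k<m. (cmod (L (rade_avg x k m)))\<^sup>2) =
      (\<Sum>k<m. (Re (L (rade_avg x k m)))\<^sup>2) + (\<Sum>k<m. (Im (L (rade_avg x k m)))\<^sup>2)"
    by (simp add: cmod_power2 sum.distrib)
  also have "\<dots> \<le> 1 + 1"
    unfolding clinear_rade_avg[OF dual_ballD(1)[OF L]]
    by (intro add_mono rade_Bessel bd)
  finally show ?thesis by simp
qed

lemma Re_rade_avg_ge:
  assumes L: "clinear L" and "k < m"
    and x: "\<And>j. j < 2 ^ m \<Longrightarrow> if bit j k then s \<le> Re (L (x j)) else Re (L (x j)) \<le> r"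
  shows "(s - r) / 2 \<le> Re (L (rade_avg x k m))"
proof -
  \<comment> \<open>The summand equals \<open>s\<close> where digit \<open>k\<close> is 1 and
    \<open>- r\<close> where it is 0; its part with \<open>rade k j\<close> sums to 0.\<close>
  have "2 ^ m * ((s - r) / 2) = (\<Sum>j<2 ^ m. (s - r) / 2 + (s + r) / 2 * rade k j)"
    by (simp only: sum.distrib sum_distrib_left[symmetric] sum_rade[OF \<open>k < m\<close>]) simp
  also have "\<dots> \<le> (\<Sum>j<2 ^ m. rade k j * Re (L (x j)))"
    using x by (intro sum_mono) (force simp: rade_def field_simps split: if_splits)
  finally show ?thesis
    by (simp add: clinear_rade_avg[OF L] field_simps)
qed

text \<open>Suppose more than \<open>2 / e\<^sup>2\<close> indices \<open>k\<close> were bad. Since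
  \<open>q\<close> is a free ultrafilter, one \<open>m\<close> beyond all of them would be bad for
  each, against the bound 2 on the sum of squares.\<close>

lemma rade_avg_null:
  assumes L: "L \<in> dual_ball" and x: "\<And>j. norm (x j) \<le> 1" and q: "ultra q" "q \<le> sequentially"
    and e: "0 < e"
  shows "finite {k. \<not> (\<forall>\<^sub>F m in q. cmod (L (rade_avg x k m)) \<le> e)}" (is "finite ?B")
proof (rule ccontr)
  assume inf: "infinite ?B"
  obtain n :: nat where n: "2 / e\<^sup>2 < n" using reals_Archimedean2 by blast
  obtain T where T: "finite T" "card T = n" "T \<subseteq> ?B"
    using infinite_arbitrarily_large[OF inf] by blast
  have "\<forall>\<^sub>F m in q. \<forall>k\<in>T. \<not> cmod (L (rade_avg x k m)) \<le> e"
    using T(3) not_eventually_ultra[OF q(1)] by (intro eventually_ball_finite[OF T(1)]) auto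
  moreover have "\<forall>\<^sub>F m in q. \<forall>k\<in>T. k < m"
    using q(2) by (intro eventually_ball_finite[OF T(1)] ballI filter_leD[OF q(2)]) (rule eventually_gt_at_top)
  ultimately have "\<forall>\<^sub>F m in q. (\<forall>k\<in>T. k < m \<and> e \<le> cmod (L (rade_avg x k m)))"
    by eventually_elim auto
  then obtain m where m: "\<And>k. k \<in> T \<Longrightarrow> k < m \<and> e \<le> cmod (L (rade_avg x k m))"
    using ultra_not_bot[OF q(1)] eventually_happens by blast
  have "n * e\<^sup>2 = (\<Sum>k\<in>T. e\<^sup>2)" by (simp add: T(2))
  also have "\<dots> \<le> (\<Sum>k\<in>T. (cmod (L (rade_avg x k m)))\<^sup>2)"
    using m e by (intro sum_mono power_mono) auto
  also have "\<dots> \<le> (\<Sum>k<m. (cmod (L (rade_avg x k m)))\<^sup>2)"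
    using m by (intro sum_mono2) auto
  also have "\<dots> \<le> 2" by (rule rade_avg_Bessel[OF L x])
  finally show False using n e by (simp add: field_simps)
qed

text \<open>The sign of the \<open>j\<close>-th term depends on \<open>k\<close> but not on the
  block length \<open>2 ^ m\<close>. One functional adapted to digit \<open>k\<close> of all
  \<open>j < 2 ^ N\<close> is therefore at least \<open>(s - r) / 2\<close> on all averages with
  \<open>m \<le> N\<close> at once, hence on their convex combinations.\<close>

lemma independent_convex_hull_rade_avg:
  fixes x :: "nat \<Rightarrow> 'a::complex_banach"
  assumes ind: "\<And>(k::nat) P. \<exists>L\<in>dual_ball. \<forall>i<k. if i \<in> P then s \<le> Re (L (x i)) else Re (L (x i)) \<le> r"
    and z: "z \<in> convex hull {rade_avg x k m | m. k < m}"
  shows "(s - r) / 2 \<le> norm z"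
proof -
  define pat where "pat N L \<longleftrightarrow>
    L \<in> dual_ball \<and> (\<forall>i<2 ^ N. if bit i k then s \<le> Re (L (x i)) else Re (L (x i)) \<le> r)" for N L
  have pat_mono: "pat N L" if "pat N' L" "N \<le> N'" for N N' L
  proof -
    have "i < 2 ^ N'" if "i < 2 ^ N" for i :: nat
      using that power_increasing[OF \<open>N \<le> N'\<close>, of "2::nat"] by linarith
    with that(1) show ?thesis by (auto simp: pat_def)
  qed
  define W where "W = {z. \<exists>N. \<forall>L. pat N L \<longrightarrow> (s - r) / 2 \<le> Re (L z)}"
  have "convex hull {rade_avg x k m | m. k < m} \<subseteq> W"
  proof (rule hull_minimal)
    show "{rade_avg x k m | m. k < m} \<subseteq> W"
    proof safe
      fix m
      assume "k < m"
      then have "(s - r) / 2 \<le> Re (L (rade_avg x k m))" if "pat m L" for L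
        using that by (intro Re_rade_avg_ge) (auto simp: pat_def dual_ballD(1))
      then show "rade_avg x k m \<in> W" by (auto simp: W_def)
    qed
    show "convex W"
    proof (rule convexI)
      fix y z and u v :: real
      assume "y \<in> W" "z \<in> W" and uv: "0 \<le> u" "0 \<le> v" "u + v = 1"
      then obtain N N' where N: "\<And>L. pat N L \<Longrightarrow> (s - r) / 2 \<le> Re (L y)"
        "\<And>L. pat N' L \<Longrightarrow> (s - r) / 2 \<le> Re (L z)"
        by (auto simp: W_def)
      have "(s - r) / 2 \<le> Re (L (u *\<^sub>R y + v *\<^sub>R z))" if L: "pat (max N N') L" for L
      proof -
        have "(s - r) / 2 = u * ((s - r) / 2) + v * ((s - r) / 2)"
          using uv(3) by (simp flip: distrib_right)
        also have "\<dots> \<le> u * Re (L y) + v * Re (L z)"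
          using N(1)[OF pat_mono[OF L]] N(2)[OF pat_mono[OF L]] uv
          by (intro add_mono mult_left_mono) auto
        also have "\<dots> = Re (L (u *\<^sub>R y + v *\<^sub>R z))"
          using L by (simp add: pat_def clinearD[OF dual_ballD(1)])
        finally show ?thesis .
      qed
      then show "u *\<^sub>R y + v *\<^sub>R z \<in> W" by (auto simp: W_def)
    qed
  qed
  then obtain N where N: "\<And>L. pat N L \<Longrightarrow> (s - r) / 2 \<le> Re (L z)"
    using z by (auto simp: W_def)
  obtain L where "pat N L"
    using ind[of "2 ^ N" "{i. bit i k}"] by (auto simp: pat_def)
  then have "(s - r) / 2 \<le> Re (L z)" "cmod (L z) \<le> norm z"
    using N dual_ballD(2) by (auto simp: pat_def)
  then show ?thesis using complex_Re_le_cmod[of "L z"] by simp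
qed

section \<open>Filters of vectors that represent elements of the bidual\<close>

lemma dual_ball_uminus_ii: "L \<in> dual_ball \<Longrightarrow> (\<lambda>x. - \<i> * L x) \<in> dual_ball"
  by (auto simp: dual_ball_def clinear_iff algebra_simps norm_mult)

text \<open>Each \<open>Q k\<close> stands for an element of the bidual: a genuine vector in the
  weakly Cauchy case, a limit of averages otherwise. A lower bound on a whole convex hull is the
  form in which Hahn-Banach separation can use that this element is not small. The bound 2 allows
  for differences of unit vectors.\<close>

lemma ex_weak_null_filters:
  assumes inf: "infinite_dimensional TYPE('a::complex_banach)"
  obtains Q :: "nat \<Rightarrow> 'a::complex_banach filter" and c :: real where "0 < c" "\<And>k. Q k \<noteq> bot"
    "\<And>k. \<forall>\<^sub>F x in Q k. norm x \<le> 2"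
    "\<And>k. \<exists>P. (\<forall>\<^sub>F x in Q k. x \<in> P) \<and> (\<forall>z\<in>convex hull P. c \<le> norm z)"
    "\<And>L e. L \<in> dual_ball \<Longrightarrow> 0 < e \<Longrightarrow> \<forall>\<^sub>F k in sequentially. \<forall>\<^sub>F x in Q k. cmod (L x) \<le> e"
proof -
  obtain x :: "nat \<Rightarrow> 'a" where x: "\<And>n. norm (x n) = 1" "\<And>m n. m < n \<Longrightarrow> 1 \<le> norm (x n - x m)"
    by (rule ex_separated_sequence[OF inf]) blast
  have x1: "cmod (L (x n)) \<le> 1" if "L \<in> dual_ball" for L n
    using dual_ballD(2)[OF that, of "x n"] x(1)[of n] by simp
  show ?thesis
  proof (cases rule: Rosenthal_dichotomy[of "dual_ball :: ('a \<Rightarrow> complex) set" "\<lambda>n L. Re (L (x n))",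
        case_names bounded convergent independent])
    case (bounded L)
    then have "\<bar>Re (L (x n))\<bar> \<le> 1" for n
      using x1[of L n] abs_Re_le_cmod[of "L (x n)"] by simp
    then show ?case by (auto intro!: boundedI[where B = 1])
  next
    case (convergent \<nu>)
    let ?y = "\<lambda>k. x (\<nu> (Suc k)) - x (\<nu> k)"
    show ?thesis
    proof (rule that[of 1 "\<lambda>k. principal {?y k}"])
      fix k
      show "\<forall>\<^sub>F x in principal {?y k}. norm x \<le> 2"
        using norm_triangle_ineq4[of "x (\<nu> (Suc k))" "x (\<nu> k)"] x(1) by (simp add: eventually_principal)
      have "1 \<le> norm (?y k)"
        using strict_monoD[OF convergent(1), of k "Suc k"] by (intro x(2)) simp
      then show "\<exists>P. (\<forall>\<^sub>F x in principal {?y k}. x \<in> P) \<and> (\<forall>z\<in>convex hull P. 1 \<le> norm z)"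
        by (intro exI[of _ "{?y k}"]) (simp add: eventually_principal)
    next
      fix L :: "'a \<Rightarrow> complex" and e :: real
      assume L: "L \<in> dual_ball" and e: "0 < e"
      \<comment> \<open>The dichotomy concerns real parts only; applied to \<open>- \<i> * L\<close>
        it also yields the imaginary parts of \<open>L\<close>.\<close>
      have Im: "Re ((\<lambda>x. - \<i> * L x) y) = Im (L y)" for y by simp
      obtain a where a: "(\<lambda>k. Re (L (x (\<nu> k)))) \<longlonglongrightarrow> a"
        using convergent(2)[OF L] by (auto simp: convergent_def)
      obtain b where b: "(\<lambda>k. Im (L (x (\<nu> k)))) \<longlonglongrightarrow> b"
        using convergent(2)[OF dual_ball_uminus_ii[OF L]] unfolding Im by (auto simp: convergent_def)
      have "(\<lambda>k. L (x (\<nu> k))) \<longlonglongrightarrow> Complex a b"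
        using tendsto_Complex[OF a b] by simp
      from tendsto_diff[OF LIMSEQ_Suc[OF this] this]
      have "(\<lambda>k. L (?y k)) \<longlonglongrightarrow> 0"
        by (simp add: clinearD[OF dual_ballD(1)[OF L]])
      then have "\<forall>\<^sub>F k in sequentially. cmod (L (?y k)) < e"
        using e by (auto simp: tendsto_iff)
      then show "\<forall>\<^sub>F k in sequentially. \<forall>\<^sub>F x in principal {?y k}. cmod (L x) \<le> e"
        by eventually_elim (simp add: eventually_principal)
    qed (auto simp: principal_eq_bot_iff)
  next
    case (independent r s \<nu>)
    let ?y = "\<lambda>k. rade_avg (\<lambda>j. x (\<nu> j)) k"
    obtain q :: "nat filter" where q: "ultra q" "q \<le> sequentially"
      by (rule ex_ultra_le[OF sequentially_bot])
    show ?thesis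
    proof (rule that[of "(s - r) / 2" "\<lambda>k. filtermap (?y k) q"])
      fix k
      show "filtermap (?y k) q \<noteq> bot"
        using ultra_not_bot[OF q(1)] by (simp add: filtermap_bot_iff)
      have "norm (?y k m) \<le> 2" for m
        using norm_rade_avg_le[of "\<lambda>j. x (\<nu> j)" k m] x(1) by simp
      then show "\<forall>\<^sub>F x in filtermap (?y k) q. norm x \<le> 2"
        by (simp add: eventually_filtermap)
      have "\<forall>\<^sub>F m in q. k < m"
        by (rule filter_leD[OF q(2)]) (rule eventually_gt_at_top)
      then have "\<forall>\<^sub>F m in q. ?y k m \<in> {?y k m | m. k < m}"
        by eventually_elim auto
      then show "\<exists>P. (\<forall>\<^sub>F x in filtermap (?y k) q. x \<in> P) \<and> (\<forall>z\<in>convex hull P. (s - r) / 2 \<le> norm z)"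
        using independent_convex_hull_rade_avg[OF independent(2)] unfolding eventually_filtermap by blast
    next
      fix L :: "'a \<Rightarrow> complex" and e :: real
      assume "L \<in> dual_ball" "0 < e"
      then have "finite {k. \<not> (\<forall>\<^sub>F m in q. cmod (L (?y k m)) \<le> e)}"
        using x(1) by (intro rade_avg_null q) auto
      then show "\<forall>\<^sub>F k in sequentially. \<forall>\<^sub>F x in filtermap (?y k) q. cmod (L x) \<le> e"
        by (simp add: eventually_filtermap eventually_cofinite flip: cofinite_eq_sequentially)
    qed (use independent(1) in simp)
  qed
qed

text \<open>As in Goldstine's theorem, passing to convex combinations brings the norms down to the norm of the
  limit functional in the bidual, which is almost attained on the dual ball.\<close>

lemma ex_norming_filter:
  fixes Q :: "'a::complex_banach filter"
  assumes Q: "Q \<noteq> bot" "\<forall>\<^sub>F x in Q. norm x \<le> C" and c: "0 < c"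
    and P0: "\<forall>\<^sub>F x in Q. x \<in> P0" "\<And>z. z \<in> convex hull P0 \<Longrightarrow> c \<le> norm z"
  obtains F where "F \<noteq> bot" "\<forall>\<^sub>F x in F. norm x = 1"
    "\<And>L e. L \<in> dual_ball \<Longrightarrow> \<forall>\<^sub>F x in Q. cmod (L x) \<le> e \<Longrightarrow> \<forall>\<^sub>F x in F. cmod (L x) \<le> e / c"
    "\<And>\<delta>. 0 < \<delta> \<Longrightarrow> \<exists>L\<in>dual_ball. \<forall>\<^sub>F x in F. cmod (L x - 1) \<le> \<delta>"
proof -
  define \<P> where "\<P> = {P. (\<forall>\<^sub>F x in Q. x \<in> P) \<and> P \<subseteq> P0 \<inter> cball 0 C}"
  have ev: "\<forall>\<^sub>F x in Q. x \<in> P" if "P \<in> \<P>" for P using that by (simp add: \<P>_def)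
  have ne: "P \<noteq> {}" if "P \<in> \<P>" for P
    using ev[OF that] Q(1) by (auto simp: trivial_limit_def)
  have top: "P0 \<inter> cball 0 C \<in> \<P>"
    using Q(2) P0(1) by (auto simp: \<P>_def eventually_conj_iff)
  have restrict: "P \<inter> R \<in> \<P>" if "P \<in> \<P>" "\<forall>\<^sub>F x in Q. x \<in> R" for P R
    using that by (auto simp: \<P>_def eventually_conj_iff)
  have hull_c: "c \<le> norm z" if "z \<in> convex hull P" "P \<in> \<P>" for z P
    using that hull_mono[of P P0 convex] P0(2) by (auto simp: \<P>_def)
  have hull_C: "norm z \<le> C" if "z \<in> convex hull P" "P \<in> \<P>" for z P
    using that hull_minimal[of P "cball 0 C" convex] by (auto simp: \<P>_def)
  define d where "d P = (INF z\<in>convex hull P. norm z)" for P :: "'a set"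
  have bdd: "bdd_below (norm ` X)" for X :: "'a set"
    by (rule bdd_belowI2[of _ 0]) simp
  have d_le: "d P \<le> norm z" if "z \<in> convex hull P" for P z
    unfolding d_def using that by (rule cINF_lower[OF bdd])
  have d_C: "d P \<le> C" if P: "P \<in> \<P>" for P
  proof -
    obtain z where "z \<in> P" using ne[OF P] by auto
    then have "z \<in> convex hull P" by (rule hull_inc)
    then show ?thesis using d_le hull_C[OF _ P] by fastforce
  qed
  \<comment> \<open>If \<open>Q\<close> is an ultrafilter, \<open>D\<close> is the norm of its limit
    functional: separation gives members of the dual ball with real part at least \<open>d P\<close>
    on \<open>P\<close>, and a member with real part at least \<open>a\<close> on \<open>P\<close>
    forces \<open>a \<le> d P\<close>.\<close>
  define D where "D = (SUP P\<in>\<P>. d P)"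
  have bddD: "bdd_above (d ` \<P>)" using d_C by (rule bdd_aboveI2)
  have d_D: "d P \<le> D" if "P \<in> \<P>" for P
    unfolding D_def by (rule cSUP_upper[OF that bddD])
  define E where "E p = convex hull (fst p) \<inter> {z. norm z < D + snd p}" for p :: "'a set \<times> real"
  \<comment> \<open>Generated by the points of almost minimal norm in the hulls;
    \<open>d P \<le> D\<close> keeps the generating sets nonempty.\<close>
  define G where "G = (INF p\<in>\<P> \<times> {0<..}. principal (E p))"
  have evG: "eventually R G \<longleftrightarrow> (\<exists>P\<in>\<P>. \<exists>\<eta>>0. \<forall>z\<in>E (P, \<eta>). R z)" for R
  proof -
    have "eventually R G \<longleftrightarrow> (\<exists>p\<in>\<P> \<times> {0<..}. eventually R (principal (E p)))"
      unfolding G_def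
    proof (rule eventually_INF_base)
      show "\<P> \<times> {0::real<..} \<noteq> {}" using top by (auto intro: exI[of _ 1])
      fix p p' :: "'a set \<times> real"
      assume p: "p \<in> \<P> \<times> {0<..}" "p' \<in> \<P> \<times> {0<..}"
      let ?p = "(fst p \<inter> fst p', min (snd p) (snd p'))"
      have "?p \<in> \<P> \<times> {0<..}" using p restrict ev by auto
      moreover have "E ?p \<subseteq> E p \<inter> E p'"
        using hull_mono[of "fst p \<inter> fst p'" "fst p" convex] hull_mono[of "fst p \<inter> fst p'" "fst p'" convex]
        by (auto simp: E_def)
      ultimately show "\<exists>p''\<in>\<P> \<times> {0<..}. principal (E p'') \<le> inf (principal (E p)) (principal (E p'))"
        by (intro bexI[of _ ?p]) auto
    qed
    then show ?thesis by (auto simp: eventually_principal)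
  qed
  have "G \<noteq> bot"
  proof
    assume "G = bot"
    then have "eventually (\<lambda>_. False) G" by simp
    then obtain P \<eta> where P: "P \<in> \<P>" "0 < \<eta>" "E (P, \<eta>) = {}" by (auto simp: evG)
    have "\<exists>z\<in>convex hull P. norm z < D + \<eta>"
      using cINF_less_iff[OF _ bdd, of "convex hull P" "D + \<eta>"] ne[OF P(1)] d_D[OF P(1)] P(2)
      by (auto simp: d_def)
    with P(3) show False by (auto simp: E_def)
  qed
  have hullG: "\<forall>\<^sub>F z in G. z \<in> convex hull P" if "P \<in> \<P>" for P
    unfolding evG using that by (auto simp: E_def intro!: bexI[of _ P] exI[of _ 1])
  have normG: "\<forall>\<^sub>F z in G. c \<le> norm z"
    using hullG[OF top] by eventually_elim (rule hull_c[OF _ top])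
  show ?thesis
  proof (rule that[of "filtermap (\<lambda>z. z /\<^sub>R norm z) G"])
    show "filtermap (\<lambda>z. z /\<^sub>R norm z) G \<noteq> bot"
      using \<open>G \<noteq> bot\<close> by (simp add: filtermap_bot_iff)
    show "\<forall>\<^sub>F x in filtermap (\<lambda>z. z /\<^sub>R norm z) G. norm x = 1"
      unfolding eventually_filtermap using normG
    proof eventually_elim
      case (elim z)
      with c have "0 < norm z" by linarith
      then show ?case by simp
    qed
  next
    fix L e
    assume L: "L \<in> dual_ball" and e: "\<forall>\<^sub>F x in Q. cmod (L x) \<le> e"
    let ?R = "{x. cmod (L x) \<le> e}"
    \<comment> \<open>Smallness of a functional is a convex condition, so passing to convex
      combinations preserves it.\<close>
    have "convex ?R"
    proof (rule convexI)
      fix y z and u v :: real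
      assume "y \<in> ?R" "z \<in> ?R" "0 \<le> u" "0 \<le> v" "u + v = 1"
      then show "u *\<^sub>R y + v *\<^sub>R z \<in> ?R"
        using convex_bound_le[of "cmod (L y)" e "cmod (L z)" u v]
          norm_triangle_ineq[of "u *\<^sub>R L y" "v *\<^sub>R L z"]
        by (simp add: clinearD[OF dual_ballD(1)[OF L]])
    qed
    then have "convex hull (P0 \<inter> cball 0 C \<inter> ?R) \<subseteq> ?R"
      by (intro hull_minimal) auto
    moreover have "\<forall>\<^sub>F z in G. z \<in> convex hull (P0 \<inter> cball 0 C \<inter> ?R)"
      using e by (intro hullG restrict[OF top]) simp
    ultimately have "\<forall>\<^sub>F z in G. cmod (L z) \<le> e"
      by (elim eventually_mono) auto
    then show "\<forall>\<^sub>F x in filtermap (\<lambda>z. z /\<^sub>R norm z) G. cmod (L x) \<le> e / c"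
      unfolding eventually_filtermap using normG
    proof eventually_elim
      case (elim z)
      have "cmod (L (z /\<^sub>R norm z)) = cmod (L z) / norm z"
        by (simp add: clinearD[OF dual_ballD(1)[OF L]] divide_inverse)
      also have "\<dots> \<le> e / c"
        using elim c by (intro frac_le) (auto intro: order_trans[OF norm_ge_zero])
      finally show ?case .
    qed
  next
    fix \<delta> :: real
    assume \<delta>: "0 < \<delta>"
    \<comment> \<open>On \<open>E (P, \<eta>)\<close> the value \<open>Re (L z)\<close> falls short
      of \<open>norm z\<close> by at most \<open>2 * \<eta>\<close>. For
      \<open>cmod w \<le> 1\<close> the square of \<open>cmod (w - 1)\<close> is at most
      \<open>2 * (1 - Re w)\<close>, here at most
      \<open>4 * \<eta> / c = \<delta>\<^sup>2\<close>.\<close>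
    define \<eta> where "\<eta> = c * \<delta>\<^sup>2 / 4"
    have \<eta>: "0 < \<eta>" using c \<delta> by (simp add: \<eta>_def)
    obtain P where P: "P \<in> \<P>" "D - \<eta> < d P"
      using less_cSUP_iff[OF _ bddD, of "D - \<eta>"] top \<eta> by (auto simp: D_def)
    obtain L where L: "L \<in> dual_ball" "\<And>z. z \<in> convex hull P \<Longrightarrow> d P \<le> Re (L z)"
      by (rule dual_ball_separation[of "convex hull P" "d P"])
        (use ne[OF P(1)] d_le in auto)
    have "cmod (L (z /\<^sub>R norm z) - 1) \<le> \<delta>" if z: "z \<in> E (P, \<eta>)" for z
    proof -
      have zh: "z \<in> convex hull P" "norm z < D + \<eta>" using z by (auto simp: E_def)
      have cz: "c \<le> norm z" using hull_c[OF zh(1) P(1)] .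
      with c have nz: "0 < norm z" by linarith
      define w where "w = L (z /\<^sub>R norm z)"
      have w: "Re w = Re (L z) / norm z"
        by (simp add: w_def clinearD[OF dual_ballD(1)[OF L(1)]] divide_inverse)
      have "1 - Re w = (norm z - Re (L z)) / norm z"
        using nz by (simp add: w diff_divide_distrib)
      also have "\<dots> \<le> 2 * \<eta> / norm z"
        using L(2)[OF zh(1)] zh(2) P(2) by (intro divide_right_mono) auto
      also have "\<dots> \<le> 2 * \<eta> / c"
        using cz c \<eta> by (intro divide_left_mono mult_pos_pos nz) auto
      finally have "2 * (1 - Re w) \<le> \<delta>\<^sup>2"
        using c by (simp add: \<eta>_def)
      moreover have "(cmod w)\<^sup>2 \<le> 1"
        using dual_ballD(2)[OF L(1), of "z /\<^sub>R norm z"] nz by (simp add: w_def abs_square_le_1)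
      moreover have "(cmod (w - 1))\<^sup>2 = (cmod w)\<^sup>2 + 1 - 2 * Re w"
        by (simp add: cmod_power2 power2_diff)
      ultimately have "(cmod (w - 1))\<^sup>2 \<le> \<delta>\<^sup>2" by simp
      then show ?thesis
        using \<delta> by (simp add: w_def power2_le_iff_abs_le)
    qed
    then show "\<exists>L\<in>dual_ball. \<forall>\<^sub>F x in filtermap (\<lambda>z. z /\<^sub>R norm z) G. cmod (L x - 1) \<le> \<delta>"
      using L(1) P(1) \<eta> by (auto simp: eventually_filtermap evG intro!: bexI[of _ L])
  qed
qed

text \<open>Only triangular: on \<open>F n\<close> nothing is claimed about \<open>L j\<close> with
  \<open>j > n\<close>, which is chosen after \<open>F n\<close>. Earlier functionals are made small
  by going far enough out in the weak-star null sequence.\<close>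

lemma ex_almost_biorthogonal_ultrafilters:
  fixes \<delta> :: "nat \<Rightarrow> real"
  assumes inf: "infinite_dimensional TYPE('a::complex_banach)" and \<delta>: "\<And>n. 0 < \<delta> n"
  obtains F :: "nat \<Rightarrow> 'a::complex_banach filter" and L :: "nat \<Rightarrow> 'a \<Rightarrow> complex"
    where "\<And>n. ultra (F n)" "\<And>n. \<forall>\<^sub>F x in F n. norm x = 1" "\<And>n. L n \<in> dual_ball"
      "\<And>j n. j < n \<Longrightarrow> \<forall>\<^sub>F x in F n. cmod (L j x) \<le> \<delta> n"
      "\<And>n. \<forall>\<^sub>F x in F n. cmod (L n x - 1) \<le> \<delta> n"
      "\<And>l e. l \<in> dual_ball \<Longrightarrow> 0 < e \<Longrightarrow> \<forall>\<^sub>F n in sequentially. \<forall>\<^sub>F x in F n. cmod (l x) \<le> e"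
proof -
  obtain Q :: "nat \<Rightarrow> 'a filter" and c :: real where c: "0 < c" and Q: "\<And>k. Q k \<noteq> bot"
    "\<And>k. \<forall>\<^sub>F x in Q k. norm x \<le> 2"
    "\<And>k. \<exists>P. (\<forall>\<^sub>F x in Q k. x \<in> P) \<and> (\<forall>z\<in>convex hull P. c \<le> norm z)"
    "\<And>L e. L \<in> dual_ball \<Longrightarrow> 0 < e \<Longrightarrow> \<forall>\<^sub>F k in sequentially. \<forall>\<^sub>F x in Q k. cmod (L x) \<le> e"
    by (rule ex_weak_null_filters[OF inf]) blast
  define norming where "norming k G \<longleftrightarrow> ultra G \<and> (\<forall>\<^sub>F x in G. norm x = 1) \<and>
    (\<forall>L\<in>dual_ball. \<forall>e. (\<forall>\<^sub>F x in Q k. cmod (L x) \<le> e) \<longrightarrow> (\<forall>\<^sub>F x in G. cmod (L x) \<le> e / c)) \<and>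
    (\<forall>\<delta>>0. \<exists>L\<in>dual_ball. \<forall>\<^sub>F x in G. cmod (L x - 1) \<le> \<delta>)" for k and G :: "'a filter"
  have "\<exists>G. norming k G" for k
  proof -
    obtain P where P: "\<forall>\<^sub>F x in Q k. x \<in> P" "\<And>z. z \<in> convex hull P \<Longrightarrow> c \<le> norm z"
      using Q(3)[of k] by blast
    obtain G where G: "G \<noteq> bot" "\<forall>\<^sub>F x in G. norm x = 1"
      "\<And>L e. L \<in> dual_ball \<Longrightarrow> \<forall>\<^sub>F x in Q k. cmod (L x) \<le> e \<Longrightarrow> \<forall>\<^sub>F x in G. cmod (L x) \<le> e / c"
      "\<And>\<delta>. 0 < \<delta> \<Longrightarrow> \<exists>L\<in>dual_ball. \<forall>\<^sub>F x in G. cmod (L x - 1) \<le> \<delta>"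
      by (rule ex_norming_filter[OF Q(1,2) c P]) blast+
    obtain H where H: "ultra H" "H \<le> G" by (rule ex_ultra_le[OF G(1)])
    have "norming k H"
      unfolding norming_def
    proof (intro conjI ballI allI impI)
      fix \<delta> :: real
      assume "0 < \<delta>"
      then show "\<exists>L\<in>dual_ball. \<forall>\<^sub>F x in H. cmod (L x - 1) \<le> \<delta>"
        using G(4) filter_leD[OF H(2)] by blast
    qed (use H(1) G(2,3) filter_leD[OF H(2)] in auto)
    then show ?thesis by blast
  qed
  then obtain G where G: "\<And>k. norming k (G k)" by metis
  have null: "\<forall>\<^sub>F k in sequentially. \<forall>\<^sub>F x in G k. cmod (L x) \<le> e" if "L \<in> dual_ball" "0 < e" for L e
  proof -
    have "\<forall>\<^sub>F k in sequentially. \<forall>\<^sub>F x in Q k. cmod (L x) \<le> e * c"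
      using that c by (intro Q(4)) auto
    then show ?thesis
    proof eventually_elim
      case (elim k)
      then have "\<forall>\<^sub>F x in G k. cmod (L x) \<le> e * c / c"
        using G[of k] that(1) unfolding norming_def by blast
      then show ?case using c by simp
    qed
  qed
  \<comment> \<open>The clause \<open>n \<le> k\<close> makes the selected indices tend to infinity,
    so that nullity survives the selection.\<close>
  define extends where "extends n S k l \<longleftrightarrow> (finite S \<and> S \<subseteq> dual_ball \<longrightarrow>
      n \<le> k \<and> l \<in> dual_ball \<and> (\<forall>L\<in>S. \<forall>\<^sub>F x in G k. cmod (L x) \<le> \<delta> n) \<and>
      (\<forall>\<^sub>F x in G k. cmod (l x - 1) \<le> \<delta> n))" for n S k and l :: "'a \<Rightarrow> complex"
  have "\<exists>k l. extends n S k l" for n S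
  proof (cases "finite S \<and> S \<subseteq> dual_ball")
    case True
    then have "\<forall>\<^sub>F k in sequentially. \<forall>L\<in>S. \<forall>\<^sub>F x in G k. cmod (L x) \<le> \<delta> n"
      using \<delta> by (intro eventually_ball_finite) (auto intro!: null)
    from eventually_happens'[OF sequentially_bot eventually_conj[OF this eventually_ge_at_top[of n]]]
    obtain k where k: "\<forall>L\<in>S. \<forall>\<^sub>F x in G k. cmod (L x) \<le> \<delta> n" "n \<le> k" by blast
    obtain l where "l \<in> dual_ball" "\<forall>\<^sub>F x in G k. cmod (l x - 1) \<le> \<delta> n"
      using G[of k] \<delta>[of n] unfolding norming_def by blast
    with k show ?thesis unfolding extends_def by blast
  qed (auto simp: extends_def)
  then obtain \<kappa> \<Lambda> where ext: "\<And>n S. extends n S (\<kappa> n S) (\<Lambda> n S)" by metis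
  define S where "S = rec_nat {} (\<lambda>n S. insert (\<Lambda> n S) S)"
  have S_Suc: "S (Suc n) = insert (\<Lambda> n (S n)) (S n)" for n by (simp add: S_def)
  have S: "finite (S n) \<and> S n \<subseteq> dual_ball" for n
  proof (induction n)
    case (Suc n)
    then show ?case using ext[of n "S n"] by (simp add: S_Suc extends_def)
  qed (simp add: S_def)
  have S_mono: "S m \<subseteq> S n" if "m \<le> n" for m n
    using that by (induction rule: dec_induct) (auto simp: S_Suc)
  have step: "n \<le> \<kappa> n (S n)" "\<Lambda> n (S n) \<in> dual_ball"
    "L \<in> S n \<Longrightarrow> \<forall>\<^sub>F x in G (\<kappa> n (S n)). cmod (L x) \<le> \<delta> n"
    "\<forall>\<^sub>F x in G (\<kappa> n (S n)). cmod (\<Lambda> n (S n) x - 1) \<le> \<delta> n" for n L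
    using ext[of n "S n"] S[of n] by (auto simp: extends_def)
  show ?thesis
  proof (rule that[of "\<lambda>n. G (\<kappa> n (S n))" "\<lambda>n. \<Lambda> n (S n)"])
    show "ultra (G (\<kappa> n (S n)))" "\<forall>\<^sub>F x in G (\<kappa> n (S n)). norm x = 1" for n
      using G[of "\<kappa> n (S n)"] by (auto simp: norming_def)
    fix j n :: nat
    assume "j < n"
    then have "\<Lambda> j (S j) \<in> S n"
      using S_mono[of "Suc j" n] by (auto simp: S_Suc)
    then show "\<forall>\<^sub>F x in G (\<kappa> n (S n)). cmod (\<Lambda> j (S j) x) \<le> \<delta> n" by (rule step(3))
  next
    fix l :: "'a \<Rightarrow> complex" and e :: real
    assume "l \<in> dual_ball" "0 < e"
    then obtain K where "\<And>k. K \<le> k \<Longrightarrow> \<forall>\<^sub>F x in G k. cmod (l x) \<le> e"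
      using null unfolding eventually_sequentially by blast
    then show "\<forall>\<^sub>F n in sequentially. \<forall>\<^sub>F x in G (\<kappa> n (S n)). cmod (l x) \<le> e"
      using step(1) order_trans unfolding eventually_sequentially by blast
  qed (rule step)+
qed

section \<open>Points of the Stone--Cech compactification as ultrafilters\<close>

lemma topspace_stone_cech: "topspace (stone_cech X) = sc_cube X closure_of (sc_eval X ` topspace X)"
  using closure_of_subset_topspace[of "sc_cube X"] by (simp add: stone_cech_def Int_absorb1)

lemma continuous_map_stone_cech_coord:
  assumes "u \<in> unit_maps X"
  shows "continuous_map (stone_cech X) euclideanreal (\<lambda>p. p u)"
proof -
  have "continuous_map (sc_cube X) (top_of_set {0..1}) (\<lambda>p. p u)"
    unfolding sc_cube_def using assms by (rule continuous_map_product_projection)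
  then show ?thesis
    unfolding stone_cech_def
    by (intro continuous_map_from_subtopology) (auto simp: continuous_map_in_subtopology)
qed

lemma stone_cech_approx:
  assumes p: "p \<in> topspace (stone_cech X)" and U: "finite U" "U \<subseteq> unit_maps X" and "0 < e"
  obtains x where "x \<in> topspace X" "\<And>u. u \<in> U \<Longrightarrow> \<bar>u x - p u\<bar> < e"
proof -
  let ?T = "(\<Inter>u\<in>U. {q \<in> topspace (sc_cube X). q u \<in> ball (p u) e}) \<inter> topspace (sc_cube X)"
  have p': "p \<in> sc_cube X closure_of (sc_eval X ` topspace X)"
    using p by (simp add: topspace_stone_cech)
  have "openin (sc_cube X) {q \<in> topspace (sc_cube X). q u \<in> ball (p u) e}" if "u \<in> U" for u
  proof (rule openin_continuous_map_preimage)
    have "continuous_map (sc_cube X) (top_of_set {0..1}) (\<lambda>q. q u)"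
      unfolding sc_cube_def using that U by (intro continuous_map_product_projection) auto
    then show "continuous_map (sc_cube X) euclideanreal (\<lambda>q. q u)"
      by (simp add: continuous_map_in_subtopology)
  qed simp
  then have "openin (sc_cube X) ?T"
    using U(1) by (intro openin_INT) auto
  moreover have "p \<in> ?T"
    using p' \<open>0 < e\<close> by (auto simp: in_closure_of)
  ultimately obtain x where "x \<in> topspace X" "sc_eval X x \<in> ?T"
    using p' unfolding in_closure_of by blast
  moreover have "sc_eval X x u = u x" if "u \<in> U" for u
    using that U(2) by (auto simp: sc_eval_def)
  ultimately show ?thesis
    by (intro that[of x]) (auto simp: dist_real_def abs_minus_commute)
qed

text \<open>The trace on \<open>X\<close> of the neighbourhoods of \<open>p\<close>. For discrete
  \<open>X\<close> it is the ultrafilter with which \<open>p\<close> is usually identified.\<close>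

definition sc_filter :: "'b topology \<Rightarrow> (('b \<Rightarrow> real) \<Rightarrow> real) \<Rightarrow> 'b filter"
  where "sc_filter X p = (INF u\<in>unit_maps X. inf (filtercomap u (nhds (p u))) (principal (topspace X)))"

lemma unit_maps_nonempty: "unit_maps X \<noteq> {}"
proof -
  have "(\<lambda>x\<in>topspace X. 0) \<in> unit_maps X"
    by (auto simp: unit_maps_def continuous_map_in_subtopology intro: continuous_map_eq[of X _ "\<lambda>_. 0"])
  then show ?thesis by auto
qed

lemma tendsto_sc_filter:
  assumes "u \<in> unit_maps X"
  shows "(u \<longlongrightarrow> p u) (sc_filter X p)"
proof -
  have "sc_filter X p \<le> filtercomap u (nhds (p u))"
    unfolding sc_filter_def using assms by (rule INF_lower2) simp
  then show ?thesis
    by (simp add: filterlim_iff_le_filtercomap)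
qed

lemma eventually_sc_filter: "\<forall>\<^sub>F x in sc_filter X p. x \<in> topspace X"
proof -
  obtain u where "u \<in> unit_maps X" using unit_maps_nonempty by blast
  then have "sc_filter X p \<le> principal (topspace X)"
    unfolding sc_filter_def by (rule INF_lower2) simp
  then show ?thesis by (simp add: le_principal)
qed

text \<open>Points of \<open>X\<close> approximate any finitely many coordinates of
  \<open>p\<close>, since \<open>p\<close> lies in the closure of the evaluations. The sets
  \<open>?B e\<close> shrink with \<open>e\<close> and generate a proper filter below the finite
  infimum.\<close>

lemma sc_filter_not_bot:
  assumes p: "p \<in> topspace (stone_cech X)"
  shows "sc_filter X p \<noteq> bot"
  unfolding sc_filter_def
proof (rule INF_filter_not_bot)
  fix U
  assume U: "U \<subseteq> unit_maps X" "finite U"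
  let ?G = "INF u\<in>U. inf (filtercomap u (nhds (p u))) (principal (topspace X))"
  let ?B = "\<lambda>e. {x \<in> topspace X. \<forall>u\<in>U. \<bar>u x - p u\<bar> < e}"
  show "?G \<noteq> bot"
  proof
    assume "?G = bot"
    have le: "(INF e\<in>{0<..}. principal (?B e)) \<le> ?G"
    proof (rule INF_greatest)
      fix u
      assume u: "u \<in> U"
      show "(INF e\<in>{0<..}. principal (?B e)) \<le> inf (filtercomap u (nhds (p u))) (principal (topspace X))"
      proof (rule inf_greatest)
        have "filterlim u (nhds (p u)) (INF e\<in>{0<..}. principal (?B e))"
        proof (rule tendstoI)
          fix e :: real
          assume "0 < e"
          then show "\<forall>\<^sub>F x in INF e\<in>{0<..}. principal (?B e). dist (u x) (p u) < e"
            using u by (intro eventually_INF1[of e]) (auto simp: eventually_principal dist_real_def)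
        qed
        then show "(INF e\<in>{0<..}. principal (?B e)) \<le> filtercomap u (nhds (p u))"
          by (simp add: filterlim_iff_le_filtercomap)
        show "(INF e\<in>{0<..}. principal (?B e)) \<le> principal (topspace X)"
          by (rule INF_lower2[of 1]) auto
      qed
    qed
    have "eventually (\<lambda>_. False) (INF e\<in>{0::real<..}. principal (?B e)) \<longleftrightarrow>
      (\<exists>e\<in>{0<..}. eventually (\<lambda>_. False) (principal (?B e)))"
    proof (rule eventually_INF_base)
      show "{0::real<..} \<noteq> {}" using zero_less_one by blast
      fix a b :: real
      assume "a \<in> {0<..}" "b \<in> {0<..}"
      then show "\<exists>x\<in>{0<..}. principal (?B x) \<le> inf (principal (?B a)) (principal (?B b))"
        by (intro bexI[of _ "min a b"]) auto
    qed
    moreover have "\<not> eventually (\<lambda>_. False) (principal (?B e))" if "0 < e" for e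
      by (rule stone_cech_approx[OF p U(2,1) that]) (auto simp: eventually_principal)
    ultimately have "(INF e\<in>{0<..}. principal (?B e)) \<noteq> bot"
      by (auto simp: trivial_limit_def)
    with le \<open>?G = bot\<close> show False by (simp add: bot_unique)
  qed
qed

lemma unit_maps_discrete: "u \<in> unit_maps (discrete_topology A) \<longleftrightarrow> u \<in> extensional A \<and> u ` A \<subseteq> {0..1}"
  by (auto simp: unit_maps_def)

text \<open>On a discrete space the indicator of \<open>P\<close> is one of the coordinates, so it
  converges along the filter. A positive limit makes it eventually 1, a limit below 1 makes it
  eventually 0.\<close>

lemma ultra_sc_filter:
  assumes "p \<in> topspace (stone_cech (discrete_topology A))"
  shows "ultra (sc_filter (discrete_topology A) p)"
  unfolding ultra_def
proof (intro conjI allI)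
  let ?F = "sc_filter (discrete_topology A) p"
  show "?F \<noteq> bot" using assms by (rule sc_filter_not_bot)
  fix P
  define u where "u = (\<lambda>x\<in>A. of_bool (P x) :: real)"
  have "u \<in> unit_maps (discrete_topology A)"
    by (auto simp: unit_maps_discrete u_def)
  then have lim: "(u \<longlongrightarrow> p u) ?F" by (rule tendsto_sc_filter)
  have A: "\<forall>\<^sub>F x in ?F. x \<in> A" using eventually_sc_filter[of "discrete_topology A" p] by simp
  show "eventually P ?F \<or> (\<forall>\<^sub>F x in ?F. \<not> P x)"
  proof (cases "p u > 0")
    case True
    have "eventually P ?F"
      using order_tendstoD(1)[OF lim True] A by eventually_elim (auto simp: u_def split: if_splits)
    then show ?thesis ..
  next
    case False
    then have "p u < 1" by simp
    have "\<forall>\<^sub>F x in ?F. \<not> P x"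
      using order_tendstoD(2)[OF lim \<open>p u < 1\<close>] A by eventually_elim (auto simp: u_def)
    then show ?thesis ..
  qed
qed

lemma stone_cech_eqI:
  assumes "p \<in> topspace (stone_cech X)" "q \<in> topspace (stone_cech X)"
    and "\<And>u. u \<in> unit_maps X \<Longrightarrow> p u = q u"
  shows "p = q"
proof -
  have "topspace (stone_cech X) \<subseteq> topspace (sc_cube X)"
    by (simp add: stone_cech_def)
  then have "p \<in> extensional (unit_maps X)" "q \<in> extensional (unit_maps X)"
    using assms(1,2) by (auto simp: sc_cube_def PiE_def)
  then show ?thesis using assms(3) by (rule extensionalityI)
qed

lemma sc_eval_in_stone_cech: "x \<in> topspace X \<Longrightarrow> sc_eval X x \<in> topspace (stone_cech X)"
proof -
  have "sc_eval X ` topspace X \<subseteq> topspace (sc_cube X)"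
    by (auto simp: sc_eval_def sc_cube_def unit_maps_def continuous_map_in_subtopology PiE_def Pi_iff
        continuous_map_def)
  then show "x \<in> topspace X \<Longrightarrow> sc_eval X x \<in> topspace (stone_cech X)"
    using closure_of_subset unfolding topspace_stone_cech by blast
qed

abbreviation rem_filter :: "((nat \<Rightarrow> real) \<Rightarrow> real) \<Rightarrow> nat filter"
  where "rem_filter \<equiv> sc_filter positive_integers"

lemma topspace_remainder:
  "topspace (stone_cech_remainder X) = topspace (stone_cech X) - sc_eval X ` topspace X"
  by (auto simp: stone_cech_remainder_def)

text \<open>An ultrafilter that is not free concentrates at one \<open>m\<close>. Then
  \<open>p\<close> has the same coordinates as the evaluation at \<open>m\<close>, which is not in
  the remainder.\<close>

lemma rem_filter_le:
  assumes p: "p \<in> topspace (stone_cech_remainder positive_integers)"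
  shows "rem_filter p \<le> sequentially"
proof (rule filter_leI, unfold eventually_sequentially, safe)
  fix P :: "nat \<Rightarrow> bool" and N
  assume P: "\<forall>n\<ge>N. P n"
  let ?F = "rem_filter p"
  have p': "p \<in> topspace (stone_cech positive_integers)"
    using p by (simp add: topspace_remainder)
  have u: "ultra ?F" using p' by (rule ultra_sc_filter)
  have "\<forall>\<^sub>F n in ?F. n \<noteq> m" for m
  proof (rule ccontr)
    assume "\<not> ?thesis"
    then have m: "\<forall>\<^sub>F n in ?F. n = m" using not_eventually_ultra[OF u] by simp
    have "\<forall>\<^sub>F n in ?F. n = m \<and> 0 < n"
      using m eventually_sc_filter[of positive_integers p] by eventually_elim simp
    from eventually_happens'[OF ultra_not_bot[OF u] this] have "0 < m" by auto
    have "p = sc_eval positive_integers m"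
    proof (rule stone_cech_eqI[OF p'])
      show "sc_eval positive_integers m \<in> topspace (stone_cech positive_integers)"
        using \<open>0 < m\<close> by (intro sc_eval_in_stone_cech) simp
      fix u
      assume u': "u \<in> unit_maps positive_integers"
      have "(u \<longlongrightarrow> u m) ?F"
        using m by (intro tendsto_eventually) (auto elim: eventually_mono)
      then have "p u = u m"
        using tendsto_unique[OF ultra_not_bot[OF u] tendsto_sc_filter[OF u', of p]] by simp
      then show "p u = sc_eval positive_integers m u"
        using u' by (simp add: sc_eval_def)
    qed
    with p \<open>0 < m\<close> show False by (auto simp: topspace_remainder)
  qed
  then have "\<forall>\<^sub>F n in ?F. \<forall>m\<in>{..<N}. n \<noteq> m"
    by (intro eventually_ball_finite) auto
  then show "eventually P ?F"
    by eventually_elim (use P in \<open>metis lessThan_iff not_less\<close>)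
qed

text \<open>Limits of all coordinates along a free ultrafilter give a point. Basic open sets
  restrict finitely many coordinates, so it is in the closure; the indicator of \<open>{m}\<close>
  tends to 0, so it is not the evaluation at \<open>m\<close>.\<close>

lemma remainder_nonempty: "topspace (stone_cech_remainder positive_integers) \<noteq> {}"
proof -
  let ?X = "positive_integers"
  obtain q :: "nat filter" where q: "ultra q" "q \<le> sequentially"
    by (rule ex_ultra_le[OF sequentially_bot])
  have pos: "\<forall>\<^sub>F n in q. N < n" for N
    by (rule filter_leD[OF q(2)]) (rule eventually_gt_at_top)
  define p where "p = (\<lambda>u\<in>unit_maps ?X. Lim q u)"
  have p: "(u \<longlongrightarrow> p u) q" "p u \<in> {0..1}" if u: "u \<in> unit_maps ?X" for u
  proof -
    have "\<forall>\<^sub>F n in q. u n \<in> {0..1}"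
      using pos[of 0] by eventually_elim (use u in \<open>auto simp: unit_maps_discrete\<close>)
    then obtain l where l: "l \<in> {0..1}" "(u \<longlongrightarrow> l) q"
      by (rule ultra_tendsto_compact[OF q(1) compact_Icc])
    then have "p u = l"
      using u tendsto_Lim[OF ultra_not_bot[OF q(1)]] by (simp add: p_def)
    with l show "(u \<longlongrightarrow> p u) q" "p u \<in> {0..1}" by simp_all
  qed
  have "p \<in> sc_cube ?X closure_of (sc_eval ?X ` topspace ?X)"
    unfolding in_closure_of
  proof (intro conjI allI impI)
    show top: "p \<in> topspace (sc_cube ?X)"
      using p(2) by (auto simp: sc_cube_def p_def)
    fix T
    assume T: "p \<in> T \<and> openin (sc_cube ?X) T"
    then have "\<exists>W. finite {u \<in> unit_maps ?X. W u \<noteq> topspace (top_of_set {0..1::real})} \<and>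
        (\<forall>u\<in>unit_maps ?X. openin (top_of_set {0..1}) (W u)) \<and>
        p \<in> Pi\<^sub>E (unit_maps ?X) W \<and> Pi\<^sub>E (unit_maps ?X) W \<subseteq> T"
      unfolding sc_cube_def openin_product_topology_alt by (elim conjE) (drule bspec)
    then obtain W where W: "finite {u \<in> unit_maps ?X. W u \<noteq> {0..1}}"
      "\<And>u. u \<in> unit_maps ?X \<Longrightarrow> openin (top_of_set {0..1}) (W u)"
      "p \<in> Pi\<^sub>E (unit_maps ?X) W" "Pi\<^sub>E (unit_maps ?X) W \<subseteq> T"
      by auto
    let ?U = "{u \<in> unit_maps ?X. W u \<noteq> {0..1}}"
    have "\<forall>\<^sub>F n in q. \<forall>u\<in>?U. u n \<in> W u"
    proof (intro eventually_ball_finite W(1) ballI)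
      fix u
      assume "u \<in> ?U"
      then have u: "u \<in> unit_maps ?X" by simp
      obtain V where V: "open V" "W u = {0..1} \<inter> V"
        using W(2)[OF u] by (auto simp: openin_open)
      have "p u \<in> V" using W(3) u V(2) by auto
      then have "\<forall>\<^sub>F n in q. u n \<in> V"
        using p(1)[OF u] V(1) by (auto simp: tendsto_def)
      then show "\<forall>\<^sub>F n in q. u n \<in> W u"
        using pos[of 0] by eventually_elim (use u V in \<open>auto simp: unit_maps_discrete\<close>)
    qed
    with pos[of 0] have "\<forall>\<^sub>F n in q. 0 < n \<and> (\<forall>u\<in>?U. u n \<in> W u)"
      by (rule eventually_conj)
    from eventually_happens'[OF ultra_not_bot[OF q(1)] this]
    obtain n where n: "0 < n" "\<And>u. u \<in> ?U \<Longrightarrow> u n \<in> W u" by auto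
    have "u n \<in> W u" if "u \<in> unit_maps ?X" for u
      using that n by (cases "W u = {0..1}") (auto simp: unit_maps_discrete)
    then have "sc_eval ?X n \<in> Pi\<^sub>E (unit_maps ?X) W"
      by (auto simp: sc_eval_def)
    then show "\<exists>y. y \<in> sc_eval ?X ` topspace ?X \<and> y \<in> T"
      using n(1) W(4) by auto
  qed
  moreover have "p \<noteq> sc_eval ?X m" if "0 < m" for m
  proof
    assume eq: "p = sc_eval ?X m"
    define u where "u = (\<lambda>n\<in>{0<..}. of_bool (n = m) :: real)"
    have u: "u \<in> unit_maps ?X" by (auto simp: unit_maps_discrete u_def)
    have "\<forall>\<^sub>F n in q. u n = 0"
      using pos[of m] by eventually_elim (auto simp: u_def)
    then have "(u \<longlongrightarrow> 0) q" by (rule tendsto_eventually)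
    then have "p u = 0"
      using tendsto_unique[OF ultra_not_bot[OF q(1)] p(1)[OF u]] by simp
    then have "u m = 0" using u by (simp add: eq sc_eval_def)
    then show False using that by (simp add: u_def)
  qed
  ultimately have "p \<in> topspace (stone_cech_remainder ?X)"
    by (auto simp: topspace_remainder topspace_stone_cech)
  then show ?thesis by blast
qed

text \<open>Real and imaginary parts, moved into the unit interval by an affine map, are coordinates
  of the cube; the limit is an affine expression in these two coordinates of
  \<open>p\<close>.\<close>

lemma continuous_map_remainder_Lim:
  fixes a :: "nat \<Rightarrow> complex"
  assumes bd: "\<And>n. cmod (a n) \<le> C"
  shows "continuous_map (stone_cech_remainder positive_integers) euclidean (\<lambda>p. Lim (rem_filter p) a)"
proof -
  let ?X = positive_integers
  define D where "D = \<bar>C\<bar> + 1"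
  have D: "0 < D" by (simp add: D_def)
  define n where "n t = (\<lambda>k\<in>{0<..}. (t (a k) + D) / (2 * D))" for t :: "complex \<Rightarrow> real"
  have n: "n t \<in> unit_maps ?X" if "\<And>z. \<bar>t z\<bar> \<le> cmod z" for t
  proof -
    have "0 \<le> t (a k) + D" "t (a k) + D \<le> 2 * D" for k
      using that[of "a k"] bd[of k] by (auto simp: D_def)
    then show ?thesis
      using D by (auto simp: unit_maps_discrete n_def divide_le_eq)
  qed
  have nRe: "n Re \<in> unit_maps ?X" and nIm: "n Im \<in> unit_maps ?X"
    by (auto intro!: n abs_Re_le_cmod abs_Im_le_cmod)
  have lim: "((\<lambda>k. t (a k)) \<longlongrightarrow> 2 * D * p (n t) - D) (rem_filter p)"
    if "n t \<in> unit_maps ?X" for p t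
  proof -
    have "((\<lambda>k. 2 * D * n t k - D) \<longlongrightarrow> 2 * D * p (n t) - D) (rem_filter p)"
      by (intro tendsto_intros tendsto_sc_filter that)
    then show ?thesis
    proof (rule Lim_transform_eventually)
      show "\<forall>\<^sub>F k in rem_filter p. 2 * D * n t k - D = t (a k)"
        using eventually_sc_filter[of ?X p]
        by eventually_elim (use D in \<open>simp add: n_def field_simps\<close>)
    qed
  qed
  have eq: "Lim (rem_filter p) a = complex_of_real (2 * D * p (n Re) - D) + \<i> * complex_of_real (2 * D * p (n Im) - D)"
    if p: "p \<in> topspace (stone_cech_remainder ?X)" for p
  proof (rule tendsto_Lim)
    show "rem_filter p \<noteq> bot"
      using p by (intro sc_filter_not_bot) (simp add: topspace_remainder)
    have "((\<lambda>k. complex_of_real (Re (a k)) + \<i> * complex_of_real (Im (a k))) \<longlongrightarrow>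
       complex_of_real (2 * D * p (n Re) - D) + \<i> * complex_of_real (2 * D * p (n Im) - D)) (rem_filter p)"
      using lim[OF nRe, of p] lim[OF nIm, of p] by (intro tendsto_intros)
    then show "(a \<longlongrightarrow> complex_of_real (2 * D * p (n Re) - D) + \<i> * complex_of_real (2 * D * p (n Im) - D)) (rem_filter p)"
      by (simp flip: complex_eq)
  qed
  have coord: "continuous_map (stone_cech_remainder ?X) euclideanreal (\<lambda>p. p u)" if "u \<in> unit_maps ?X" for u
    unfolding stone_cech_remainder_def
    by (intro continuous_map_from_subtopology continuous_map_stone_cech_coord that)
  have "continuous_map (stone_cech_remainder ?X) euclidean
      (\<lambda>p. complex_of_real (2 * D * p (n Re) - D) + \<i> * complex_of_real (2 * D * p (n Im) - D))"
    using coord[OF nRe] coord[OF nIm] unfolding continuous_map_atin limitin_canonical_iff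
    by (intro ballI tendsto_intros) auto
  then show ?thesis
    by (rule continuous_map_eq) (simp add: eq)
qed

section \<open>The algebra of bounded analytic functions\<close>

lemma analytic_fun_on_cong:
  assumes "analytic_fun_on f U" "open U" "\<And>x. x \<in> U \<Longrightarrow> g x = f x"
  shows "analytic_fun_on g U"
  unfolding analytic_fun_on_def
proof
  fix x
  assume x: "x \<in> U"
  then obtain D where "(f has_derivative D) (at x)" "clinear D"
    using assms(1) by (auto simp: analytic_fun_on_def)
  then show "\<exists>D. (g has_derivative D) (at x) \<and> clinear D"
    using has_derivative_transform_within_open[of f D x UNIV U g] assms(2,3) x by auto
qed

lemma analytic_fun_on_const: "analytic_fun_on (\<lambda>_. c) U"
  by (auto simp: analytic_fun_on_def clinear_iff intro!: exI[of _ "\<lambda>_. 0"])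

lemma analytic_fun_on_add:
  assumes "analytic_fun_on f U" "analytic_fun_on g U"
  shows "analytic_fun_on (\<lambda>x. f x + g x) U"
  unfolding analytic_fun_on_def
proof
  fix x
  assume "x \<in> U"
  then obtain D E where "(f has_derivative D) (at x)" "clinear D" "(g has_derivative E) (at x)" "clinear E"
    using assms by (meson analytic_fun_on_def)
  then show "\<exists>D. ((\<lambda>x. f x + g x) has_derivative D) (at x) \<and> clinear D"
    by (intro exI[of _ "\<lambda>h. D h + E h"]) (auto intro: has_derivative_add simp: clinear_iff algebra_simps)
qed

lemma analytic_fun_on_mult:
  assumes "analytic_fun_on f U" "analytic_fun_on g U"
  shows "analytic_fun_on (\<lambda>x. f x * g x) U"
  unfolding analytic_fun_on_def
proof
  fix x
  assume "x \<in> U"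
  then obtain D E where "(f has_derivative D) (at x)" "clinear D" "(g has_derivative E) (at x)" "clinear E"
    using assms by (meson analytic_fun_on_def)
  then show "\<exists>D. ((\<lambda>x. f x * g x) has_derivative D) (at x) \<and> clinear D"
    by (intro exI[of _ "\<lambda>h. f x * E h + D h * g x"] conjI has_derivative_mult)
      (auto simp: clinear_iff algebra_simps)
qed

lemma analytic_fun_on_inverse:
  assumes "analytic_fun_on f U" "\<And>x. x \<in> U \<Longrightarrow> f x \<noteq> 0"
  shows "analytic_fun_on (\<lambda>x. 1 / f x) U"
  unfolding analytic_fun_on_def
proof
  fix x
  assume x: "x \<in> U"
  then obtain D where D: "(f has_derivative D) (at x)" "clinear D"
    using assms by (meson analytic_fun_on_def)
  have "((\<lambda>x. 1 / f x) has_derivative (\<lambda>h. (0 * f x - 1 * D h) / (f x * f x))) (at x)"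
    using D(1) assms(2)[OF x] by (intro has_derivative_divide' has_derivative_const)
  moreover have "clinear (\<lambda>h. (0 * f x - 1 * D h) / (f x * f x))"
    using D(2) by (simp add: clinear_iff add_divide_distrib)
  ultimately show "\<exists>D. ((\<lambda>x. 1 / f x) has_derivative D) (at x) \<and> clinear D" by blast
qed

lemma HinfI:
  assumes "analytic_fun_on f unit_ball" "\<And>x. x \<in> unit_ball \<Longrightarrow> cmod (f x) \<le> C"
  shows "restrict f unit_ball \<in> Hinf"
  using analytic_fun_on_cong[OF assms(1) open_ball, of "restrict f unit_ball"] assms(2)
  by (auto simp: Hinf_def bounded_iff intro!: exI[of _ C])

lemma HinfE:
  assumes "f \<in> Hinf"
  obtains C where "analytic_fun_on f unit_ball" "0 \<le> C" "\<And>x. x \<in> unit_ball \<Longrightarrow> cmod (f x) \<le> C"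
proof -
  obtain C where C: "\<And>x. x \<in> unit_ball \<Longrightarrow> cmod (f x) \<le> C"
    using assms unfolding Hinf_def bounded_iff by blast
  from order_trans[OF norm_ge_zero C[of 0]] have "0 \<le> C" by simp
  with C show ?thesis using assms that by (auto simp: Hinf_def)
qed

lemma Hinf_add: "f \<in> Hinf \<Longrightarrow> g \<in> Hinf \<Longrightarrow> (\<lambda>x\<in>unit_ball. f x + g x) \<in> Hinf"
proof (elim HinfE)
  fix C D
  assume "analytic_fun_on f unit_ball" "analytic_fun_on g unit_ball"
    and bd: "\<And>x. x \<in> unit_ball \<Longrightarrow> cmod (f x) \<le> C" "\<And>x. x \<in> unit_ball \<Longrightarrow> cmod (g x) \<le> D"
  then show ?thesis
    by (intro HinfI[where C = "C + D"] analytic_fun_on_add norm_triangle_mono)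
qed

lemma Hinf_mult: "f \<in> Hinf \<Longrightarrow> g \<in> Hinf \<Longrightarrow> (\<lambda>x\<in>unit_ball. f x * g x) \<in> Hinf"
proof (elim HinfE)
  fix C D
  assume an: "analytic_fun_on f unit_ball" "analytic_fun_on g unit_ball" and "0 \<le> C"
    and bd: "\<And>x. x \<in> unit_ball \<Longrightarrow> cmod (f x) \<le> C" "\<And>x. x \<in> unit_ball \<Longrightarrow> cmod (g x) \<le> D"
  then show ?thesis
    by (intro HinfI[where C = "C * D"] analytic_fun_on_mult an) (simp add: norm_mult mult_mono)
qed

lemma Hinf_const: "(\<lambda>x\<in>unit_ball. c) \<in> Hinf"
  by (rule HinfI[where C = "cmod c"]) (simp_all add: analytic_fun_on_const)

lemma Hinf_dual_space:
  assumes "l \<in> dual_space"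
  shows "restrict l unit_ball \<in> Hinf"
proof -
  obtain M l' where l: "0 < M" "l' \<in> dual_ball" "\<And>x. l x = of_real M * l' x"
    by (rule dual_space_scale[OF assms]) blast
  show ?thesis
  proof (rule HinfI[where C = M])
    show "analytic_fun_on l unit_ball"
      using assms by (auto simp: dual_space_def analytic_fun_on_def intro: bounded_linear_imp_has_derivative)
    fix x :: 'a
    assume "x \<in> unit_ball"
    then have "cmod (l' x) \<le> 1" using dual_ballD(2)[OF l(2), of x] by simp
    then show "cmod (l x) \<le> M" using l(1,3) by (simp add: norm_mult)
  qed
qed

text \<open>By the chain rule and complex linearity of the Frechet derivative, the real derivative
  is multiplication by \<open>b * D x\<close>.\<close>

lemma holomorphic_along_line:
  fixes x :: "'a::complex_banach"
  assumes f: "analytic_fun_on f unit_ball"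
    and ball: "\<And>z. z \<in> unit_disk \<Longrightarrow> (a + b * z) *\<^sub>C x \<in> unit_ball"
  shows "(\<lambda>z. f ((a + b * z) *\<^sub>C x)) holomorphic_on unit_disk"
  unfolding holomorphic_on_open[OF open_ball]
proof
  fix z :: complex
  assume z: "z \<in> unit_disk"
  have lin: "bounded_linear (\<lambda>c. c *\<^sub>C x)"
  proof (rule bounded_linear_intro[where K = "norm x"])
    show "(r *\<^sub>R c) *\<^sub>C x = r *\<^sub>R (c *\<^sub>C x)" for r c
      by (simp only: scaleR_conv_of_real scaleC_scaleC[symmetric] scaleC_of_real)
  qed (simp_all add: scaleC_add_left norm_scaleC)
  obtain D where D: "(f has_derivative D) (at ((a + b * z) *\<^sub>C x))" "clinear D"
    using f ball[OF z] unfolding analytic_fun_on_def by blast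
  have "((\<lambda>z. a + b * z) has_derivative (\<lambda>h. b * h)) (at z)"
    by (auto intro!: derivative_eq_intros)
  then have "((\<lambda>z. (a + b * z) *\<^sub>C x) has_derivative (\<lambda>h. (b * h) *\<^sub>C x)) (at z)"
    by (rule bounded_linear.has_derivative[OF lin])
  then have "((\<lambda>z. f ((a + b * z) *\<^sub>C x)) has_derivative (\<lambda>h. D ((b * h) *\<^sub>C x))) (at z)"
    using D(1) by (rule has_derivative_compose)
  moreover have "(\<lambda>h. D ((b * h) *\<^sub>C x)) = (*) (b * D x)"
    by (simp add: clinearD(2)[OF D(2)] fun_eq_iff mult.assoc mult.left_commute)
  ultimately show "\<exists>f'. ((\<lambda>z. f ((a + b * z) *\<^sub>C x)) has_field_derivative f') (at z)"
    unfolding has_field_derivative_def by (auto intro: exI[of _ "b * D x"])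
qed

section \<open>Test functions\<close>

definition pole_sum :: "(nat \<Rightarrow> real) \<Rightarrow> (nat \<Rightarrow> 'a::complex_banach \<Rightarrow> complex) \<Rightarrow> 'a \<Rightarrow> complex"
  where "pole_sum a L x = (\<Sum>k. of_real (a k) / (1 - L k x))"

context
  fixes a :: "nat \<Rightarrow> real" and L :: "nat \<Rightarrow> 'a::complex_banach \<Rightarrow> complex"
  assumes a: "\<And>k. 0 \<le> a k" "summable a" and L: "\<And>k. L k \<in> dual_ball"
begin

lemma one_minus_L:
  assumes "norm x \<le> r"
  shows "1 - r \<le> cmod (1 - L k x)" "1 - r \<le> Re (1 - L k x)"
proof -
  have "cmod (L k x) \<le> r"
    using dual_ballD(2)[OF L, of k x] assms by simp
  then show "1 - r \<le> cmod (1 - L k x)" "1 - r \<le> Re (1 - L k x)"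
    using norm_triangle_ineq2[of 1 "L k x"] complex_Re_le_cmod[of "L k x"] by auto
qed

lemma pole_sum_summable:
  assumes "norm x < 1"
  shows "summable (\<lambda>k. of_real (a k) / (1 - L k x))"
proof (rule summable_comparison_test')
  show "summable (\<lambda>k. a k / (1 - norm x))" using a(2) by (rule summable_divide)
  show "norm (of_real (a k) / (1 - L k x)) \<le> a k / (1 - norm x)" for k
    using one_minus_L(1)[of x "norm x" k] a(1)[of k] assms
    by (simp add: norm_divide frac_le)
qed

lemma Re_pole_sum_nonneg:
  assumes "norm x < 1"
  shows "0 \<le> Re (pole_sum a L x)"
proof -
  have "Re (pole_sum a L x) = (\<Sum>k. Re (of_real (a k) / (1 - L k x)))"
    unfolding pole_sum_def using pole_sum_summable[OF assms] by (rule Re_suminf)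
  also have "0 \<le> \<dots>"
  proof (rule suminf_nonneg)
    show "summable (\<lambda>k. Re (of_real (a k) / (1 - L k x)))"
      using pole_sum_summable[OF assms] by (rule summable_Re)
    show "0 \<le> Re (of_real (a k) / (1 - L k x))" for k
      using one_minus_L(2)[of x "norm x" k] a(1)[of k] assms by (simp add: Re_divide)
  qed
  finally show ?thesis .
qed

text \<open>On \<open>ball 0 r\<close> with \<open>r < 1\<close> the differentiated terms are
  dominated by \<open>a k * (norm h / (1 - r)\<^sup>2)\<close> uniformly in \<open>x\<close>, which
  permits differentiation term by term.\<close>

lemma analytic_pole_sum: "analytic_fun_on (pole_sum a L) unit_ball"
  unfolding analytic_fun_on_def
proof
  fix x0 :: 'a
  assume "x0 \<in> unit_ball"
  then have "norm x0 < 1" by simp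
  then obtain r where r: "norm x0 < r" "r < 1" using dense by blast
  define c where "c k x h = of_real (a k) * L k h / (1 - L k x)\<^sup>2" for k x h
  define D where "D x h = (\<Sum>k. c k x h)" for x h
  have ne: "1 - L k x \<noteq> 0" if "x \<in> ball 0 r" for k x
    using one_minus_L(1)[of x r k] that r by auto
  have c_le: "cmod (c k x h) \<le> a k * (norm h / (1 - r)\<^sup>2)" if "x \<in> ball 0 r" for k x h
  proof -
    have "(1 - r)\<^sup>2 \<le> (cmod (1 - L k x))\<^sup>2"
      using one_minus_L(1)[of x r k] that r by (intro power_mono) auto
    then have "cmod (L k h) / (cmod (1 - L k x))\<^sup>2 \<le> norm h / (1 - r)\<^sup>2"
      using r dual_ballD(2)[OF L] by (intro frac_le) auto
    then have "a k * (cmod (L k h) / (cmod (1 - L k x))\<^sup>2) \<le> a k * (norm h / (1 - r)\<^sup>2)"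
      using a(1) by (rule mult_left_mono)
    then show ?thesis
      using a(1)[of k] by (simp add: c_def norm_mult norm_divide norm_power)
  qed
  have sum_c: "summable (\<lambda>k. c k x h)" if "x \<in> ball 0 r" for x h
    by (rule summable_comparison_test'[of "\<lambda>k. a k * (norm h / (1 - r)\<^sup>2)" 0])
      (use a(2) c_le[OF that] in \<open>auto intro: summable_mult2\<close>)
  have tail: "cmod ((\<Sum>k<n. c k x h) - D x h) \<le> (\<Sum>k. a (k + n)) / (1 - r)\<^sup>2 * norm h"
    if "x \<in> ball 0 r" for n x h
  proof -
    have a': "summable (\<lambda>k. a (k + n) * (norm h / (1 - r)\<^sup>2))"
      using a(2) by (intro summable_mult2) (simp add: summable_iff_shift)
    have "cmod ((\<Sum>k<n. c k x h) - D x h) = cmod (\<Sum>k. c (k + n) x h)"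
      unfolding D_def using suminf_minus_initial_segment[OF sum_c[OF that], of n h]
      by (simp add: norm_minus_commute)
    also have "\<dots> \<le> (\<Sum>k. a (k + n) * (norm h / (1 - r)\<^sup>2))"
      using c_le[OF that] by (intro norm_suminf_le a')
    also have "\<dots> = (\<Sum>k. a (k + n)) / (1 - r)\<^sup>2 * norm h"
      using a(2) by (subst suminf_mult2[symmetric]) (auto simp: summable_iff_shift)
    finally show ?thesis .
  qed
  have "\<exists>g. \<forall>x\<in>ball 0 r. (\<lambda>k. of_real (a k) / (1 - L k x)) sums g x \<and>
      (g has_derivative D x) (at x within ball 0 r)"
  proof (rule has_derivative_series[OF convex_ball])
    fix k and x :: 'a
    assume x: "x \<in> ball 0 r"
    have "(L k has_derivative L k) (at x within ball 0 r)"
      using dual_ballD(3)[OF L] by (rule bounded_linear_imp_has_derivative)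
    then show "((\<lambda>x. of_real (a k) / (1 - L k x)) has_derivative c k x) (at x within ball 0 r)"
      using ne[OF x, of k]
      by (auto intro!: derivative_eq_intros simp: c_def fun_eq_iff power2_eq_square field_simps)
  next
    fix e :: real
    assume e: "0 < e"
    have "(\<lambda>n. (\<Sum>k. a (k + n)) / (1 - r)\<^sup>2) \<longlonglongrightarrow> 0 / (1 - r)\<^sup>2"
      using r by (intro tendsto_divide suminf_exist_split2 a(2) tendsto_const) auto
    then have "\<forall>\<^sub>F n in sequentially. (\<Sum>k. a (k + n)) / (1 - r)\<^sup>2 < e"
      using e by (intro order_tendstoD(2)[where y = 0]) auto
    then show "\<forall>\<^sub>F n in sequentially. \<forall>x\<in>ball 0 r. \<forall>h. cmod ((\<Sum>k<n. c k x h) - D x h) \<le> e * norm h"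
    proof eventually_elim
      case (elim n)
      show ?case
      proof (intro ballI allI)
        fix x h :: 'a
        assume "x \<in> ball 0 r"
        then have "cmod ((\<Sum>k<n. c k x h) - D x h) \<le> (\<Sum>k. a (k + n)) / (1 - r)\<^sup>2 * norm h"
          by (rule tail)
        also have "\<dots> \<le> e * norm h" using elim by (intro mult_right_mono) auto
        finally show "cmod ((\<Sum>k<n. c k x h) - D x h) \<le> e * norm h" .
      qed
    qed
  next
    show "x0 \<in> ball 0 r" using r by simp
    show "(\<lambda>k. of_real (a k) / (1 - L k x0)) sums pole_sum a L x0"
      unfolding pole_sum_def using \<open>norm x0 < 1\<close> by (intro summable_sums pole_sum_summable)
  qed
  then obtain g where g: "\<And>x. x \<in> ball 0 r \<Longrightarrow> (\<lambda>k. of_real (a k) / (1 - L k x)) sums g x"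
    "\<And>x. x \<in> ball 0 r \<Longrightarrow> (g has_derivative D x) (at x within ball 0 r)" by blast
  have x0: "x0 \<in> ball 0 r" using r by simp
  have "(g has_derivative D x0) (at x0)"
    using g(2)[OF x0] x0 by (simp add: at_within_open[OF _ open_ball])
  then have "(pole_sum a L has_derivative D x0) (at x0)"
    by (rule has_derivative_transform_within_open[OF _ open_ball x0])
      (use g(1) in \<open>auto simp: pole_sum_def sums_iff\<close>)
  moreover have "clinear (D x0)"
  proof -
    have "c k x0 (u + v) = c k x0 u + c k x0 v" "c k x0 (b *\<^sub>C u) = b * c k x0 u" for k u v b
      by (simp_all add: c_def clinearD[OF dual_ballD(1)[OF L]] ring_distribs add_divide_distrib)
    then show ?thesis
      unfolding clinear_iff D_def using sum_c[OF x0] by (simp add: suminf_add suminf_mult)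
  qed
  ultimately show "\<exists>D. (pole_sum a L has_derivative D) (at x0) \<and> clinear D" by blast
qed

lemma pole_sum_Hinf: "(\<lambda>x\<in>unit_ball. 1 / (1 + pole_sum a L x)) \<in> Hinf"
proof (rule HinfI[where C = 1])
  have ge: "1 \<le> cmod (1 + pole_sum a L x)" if "x \<in> unit_ball" for x
    using Re_pole_sum_nonneg[of x] that complex_Re_le_cmod[of "1 + pole_sum a L x"] by simp
  show "analytic_fun_on (\<lambda>x. 1 / (1 + pole_sum a L x)) unit_ball"
  proof (intro analytic_fun_on_inverse analytic_fun_on_add analytic_fun_on_const analytic_pole_sum)
    show "1 + pole_sum a L x \<noteq> 0" if "x \<in> unit_ball" for x
      using ge[OF that] by auto
  qed
  show "cmod (1 / (1 + pole_sum a L x)) \<le> 1" if "x \<in> unit_ball" for x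
    using ge[OF that] by (simp add: norm_divide divide_le_eq)
qed

end

section \<open>The analytic disks\<close>

definition eps :: "nat \<Rightarrow> real"
  where "eps n = (1 / 2) ^ (n\<^sup>2)"

lemma eps_pos: "0 < eps n" and eps_le_1: "eps n \<le> 1"
  by (simp_all add: eps_def power_le_one)

lemma eps_le: "eps n \<le> (1 / 2) ^ n"
  unfolding eps_def by (rule power_decreasing) (auto simp: power2_nat_le_imp_le power2_eq_square)

text \<open>Since \<open>k\<^sup>2 - n\<^sup>2 = (k - n) * (k + n)\<close> is at least
  \<open>k + n\<close>, the square in the exponent of \<open>eps\<close> leaves one factor summable
  in \<open>k\<close> and another that tends to 0 in \<open>n\<close>.\<close>

lemma eps_ratio:
  assumes "n < k"
  shows "eps k \<le> eps n * ((1 / 2) ^ k * (1 / 2) ^ n)"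
proof -
  have "n\<^sup>2 + (k + n) \<le> k\<^sup>2"
  proof -
    obtain d where "k = n + Suc d" using less_imp_Suc_add[OF assms] by auto
    then show ?thesis by (simp add: power2_eq_square algebra_simps)
  qed
  then have "eps k \<le> (1 / 2) ^ (n\<^sup>2 + (k + n))"
    unfolding eps_def by (rule power_decreasing) auto
  then show ?thesis by (simp add: eps_def power_add)
qed

lemma half_power_le: "(1 / 2 :: real) ^ n \<le> 1 / (real n + 1)"
proof -
  have "n + 1 \<le> 2 ^ n" using less_exp[of n] by (simp add: Suc_le_eq)
  then have "real (n + 1) \<le> real (2 ^ n)" by (rule of_nat_mono)
  then show ?thesis by (simp add: power_divide field_simps)
qed

lemma summable_eps: "summable eps"
  by (rule summable_comparison_test'[OF summable_geometric[of "1 / 2"], of 0])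
    (use eps_le eps_pos in \<open>auto simp: less_imp_le\<close>)

definition eps_on :: "nat set \<Rightarrow> nat \<Rightarrow> real"
  where "eps_on A k = (if k \<in> A then eps k else 0)"

lemma eps_on_nonneg: "0 \<le> eps_on A k"
  by (simp add: eps_on_def less_imp_le[OF eps_pos])

lemma summable_eps_on: "summable (eps_on A)"
  by (rule summable_comparison_test'[OF summable_eps, of 0]) (use eps_pos in \<open>auto simp: eps_on_def less_imp_le\<close>)

text \<open>Maps the unit disk onto the disk of radius \<open>eps n\<close> that touches the unit
  circle from inside at 1, the pole of \<open>1 / (1 - w)\<close>.\<close>

definition disk_pt :: "nat \<Rightarrow> complex \<Rightarrow> complex"
  where "disk_pt n z = of_real (1 - eps n) + of_real (eps n) * z"

lemma norm_disk_pt: "cmod (disk_pt n z) \<le> 1 - eps n * (1 - cmod z)"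
proof -
  have "cmod (disk_pt n z) \<le> cmod (of_real (1 - eps n)) + cmod (of_real (eps n) * z)"
    unfolding disk_pt_def by (rule norm_triangle_ineq)
  also have "\<dots> = (1 - eps n) + eps n * cmod z"
    using eps_pos[of n] eps_le_1[of n] by (simp only: norm_mult norm_of_real)
  finally show ?thesis by (simp add: algebra_simps)
qed

lemma norm_disk_pt_less:
  assumes "z \<in> unit_disk"
  shows "cmod (disk_pt n z) < 1"
proof -
  have "0 < eps n * (1 - cmod z)" using assms eps_pos[of n] by simp
  with norm_disk_pt[of n z] show ?thesis by linarith
qed

lemma disk_pt_scaleC_in_ball:
  assumes "z \<in> unit_disk" "norm x = 1"
  shows "disk_pt n z *\<^sub>C x \<in> unit_ball"
  using norm_disk_pt_less[OF assms(1), of n] assms(2) by (simp add: norm_scaleC)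

lemma pole_sum_disk_pt:
  fixes L :: "nat \<Rightarrow> 'a::complex_banach \<Rightarrow> complex"
  assumes L: "\<And>k. L k \<in> dual_ball" and x: "norm x = 1" and z: "z \<in> unit_disk" and n: "0 < n"
    and head: "\<And>j. j < n \<Longrightarrow> cmod (L j x) \<le> eps n / (n + 1)"
    and diag: "cmod (L n x - 1) \<le> eps n / (n + 1)"
  defines "\<kappa> \<equiv> 1 / (1 - cmod z)"
  shows "cmod (pole_sum (eps_on A) L (disk_pt n z *\<^sub>C x) -
      (of_real (suminf (eps_on A)) + (if n \<in> A then 1 / (1 - z) else 0))) \<le> (4 * \<kappa> + 1 + \<kappa>\<^sup>2) / (n + 1)"
proof -
  let ?w = "\<lambda>k. disk_pt n z * L k x"
  define c where "c = (if n \<in> A then 1 / (1 - z) else 0)"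
  define d where "d k = of_real (eps_on A k) / (1 - ?w k) - (of_real (eps_on A k) + (if k = n then c else 0))" for k
  \<comment> \<open>The geometric part sums to \<open>4 * \<kappa> / (n + 1)\<close>, the single
    entry at \<open>n\<close> contributes the rest.\<close>
  define B where "B k = 2 * \<kappa> / (n + 1) * (1 / 2) ^ k + (if k = n then (1 + \<kappa>\<^sup>2) / (n + 1) else 0)" for k
  have z1: "cmod z < 1" using z by simp
  have \<kappa>: "1 \<le> \<kappa>" "0 < 1 - cmod z" using z1 by (auto simp: \<kappa>_def)
  have Lx: "cmod (L k x) \<le> 1" for k using dual_ballD(2)[OF L, of k x] x by simp
  have w_le: "cmod (?w k) \<le> cmod (disk_pt n z)" for k
    using Lx[of k] by (simp add: norm_mult mult_left_le)
  \<comment> \<open>Valid for every \<open>k\<close>, with no information on \<open>L k x\<close>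
    beyond membership of \<open>L k\<close> in the dual ball.\<close>
  have dist: "eps n / \<kappa> \<le> cmod (1 - ?w k)" for k
    using norm_disk_pt[of n z] w_le[of k] norm_triangle_ineq2[of 1 "?w k"] by (simp add: \<kappa>_def)
  have dist_pos: "0 < cmod (1 - ?w k)" for k
    using dist[of k] eps_pos[of n] \<kappa> by (smt (verit) divide_pos_pos)
  have inv_dist: "1 / cmod (1 - ?w k) \<le> \<kappa> / eps n" for k
    using dist[of k] dist_pos[of k] eps_pos[of n] \<kappa> by (simp add: field_simps)
  have halfn: "(1 / 2) ^ n \<le> 1 / (real n + 1)" by (rule half_power_le)
  have d_le: "cmod (d k) \<le> B k" for k
  proof -
    have B1: "0 \<le> 2 * \<kappa> / (n + 1) * (1 / 2) ^ k" using \<kappa> by simp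
    show ?thesis
    proof (cases "k \<in> A")
      case False
      then show ?thesis using B1 \<kappa> by (auto simp: d_def B_def c_def eps_on_def)
    next
      case True
      consider "k < n" | "k = n" | "n < k" by linarith
      then show ?thesis
      proof cases
        case 1
        have w: "cmod (?w k) \<le> 1 / (n + 1)"
        proof -
          have "cmod (?w k) \<le> cmod (L k x)"
            using norm_disk_pt_less[OF z, of n] by (simp add: norm_mult mult_left_le_one_le)
          also have "\<dots> \<le> eps n / (n + 1)" by (rule head[OF 1])
          also have "\<dots> \<le> 1 / (n + 1)" using eps_le_1[of n] by (intro divide_right_mono) auto
          finally show ?thesis .
        qed
        also have "\<dots> \<le> 1 / 2" using n by (simp add: field_simps)
        finally have "cmod (?w k) \<le> 1 / 2" .
        then have ge: "1 / 2 \<le> cmod (1 - ?w k)"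
          using norm_triangle_ineq2[of 1 "?w k"] by simp
        have "d k = of_real (eps k) * ?w k / (1 - ?w k)"
          using True 1 dist_pos[of k] by (simp add: d_def eps_on_def field_simps)
        then have "cmod (d k) = eps k * (cmod (?w k) / cmod (1 - ?w k))"
          using eps_pos[of k] by (simp add: norm_mult norm_divide)
        also have "\<dots> \<le> (1 / 2) ^ k * ((1 / (n + 1)) / (1 / 2))"
          using ge w eps_le[of k] eps_pos[of k] by (intro mult_mono frac_le) auto
        also have "\<dots> = 1 * (2 / (n + 1) * (1 / 2) ^ k)" by simp
        also have "\<dots> \<le> \<kappa> * (2 / (n + 1) * (1 / 2) ^ k)"
          using \<kappa> by (intro mult_right_mono) auto
        finally show ?thesis using 1 by (simp add: B_def ac_simps)
      next
        case 2
        \<comment> \<open>Because \<open>1 - disk_pt n z = eps n * (1 - z)\<close>, the weight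
          cancels up to the error in \<open>L n x\<close>. That error is at most
          \<open>eps n / (n + 1)\<close> and survives division by a distance of order
          \<open>eps n\<close>.\<close>
        have "1 - ?w n = of_real (eps n) * (1 - z) - disk_pt n z * (L n x - 1)"
          by (simp add: disk_pt_def algebra_simps)
        then have "of_real (eps n) / (1 - ?w n) - 1 / (1 - z) = disk_pt n z * (L n x - 1) / ((1 - ?w n) * (1 - z))"
          using dist_pos[of n] z1 by (simp add: divide_simps) (auto simp: algebra_simps)
        then have "cmod (of_real (eps n) / (1 - ?w n) - 1 / (1 - z)) =
            cmod (disk_pt n z) * cmod (L n x - 1) * (1 / cmod (1 - ?w n)) * (1 / cmod (1 - z))"
          by (simp add: norm_mult norm_divide)
        also have "\<dots> \<le> 1 * (eps n / (n + 1)) * (\<kappa> / eps n) * \<kappa>"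
        proof (intro mult_mono inv_dist diag)
          show "1 / cmod (1 - z) \<le> \<kappa>"
            using norm_triangle_ineq2[of 1 z] z1 unfolding \<kappa>_def by (intro frac_le) auto
        qed (use norm_disk_pt_less[OF z, of n] eps_pos[of n] \<kappa> in auto)
        also have "\<dots> = \<kappa>\<^sup>2 / (n + 1)"
          using eps_pos[of n] by (simp add: power2_eq_square)
        finally have "cmod (of_real (eps n) / (1 - ?w n) - 1 / (1 - z)) \<le> \<kappa>\<^sup>2 / (n + 1)" .
        moreover have "eps n \<le> 1 / (n + 1)" using eps_le[of n] halfn by (simp add: add.commute)
        moreover have "d k = (of_real (eps n) / (1 - ?w n) - 1 / (1 - z)) - of_real (eps n)"
          using True 2 by (simp add: d_def c_def eps_on_def)
        ultimately have "cmod (d k) \<le> \<kappa>\<^sup>2 / (n + 1) + 1 / (n + 1)"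
          using norm_triangle_ineq4[of "of_real (eps n) / (1 - ?w n) - 1 / (1 - z)" "of_real (eps n)"]
            eps_pos[of n] by simp
        then show ?thesis
          using B1 2 by (simp add: B_def add_divide_distrib)
      next
        case 3
        \<comment> \<open>The general bound on the distance to the pole costs a factor
          \<open>1 / eps n\<close>; \<open>eps_ratio\<close> pays for it.\<close>
        have "cmod (d k) \<le> eps k * (1 / cmod (1 - ?w k)) + eps k"
          using True 3 eps_pos[of k] norm_triangle_ineq4[of "of_real (eps k) / (1 - ?w k)" "of_real (eps k)"]
          by (simp add: d_def eps_on_def norm_divide)
        also have "\<dots> \<le> eps k * (\<kappa> / eps n) + eps k"
          using eps_pos[of k] inv_dist[of k] by (intro add_mono mult_left_mono) auto
        also have "\<dots> \<le> eps k * (\<kappa> / eps n) + eps k * (\<kappa> / eps n)"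
          using eps_pos[of k] eps_pos[of n] eps_le_1[of n] \<kappa> by (intro add_mono mult_le_cancel_left1[THEN iffD2]) auto
        also have "\<dots> = 2 * (\<kappa> / eps n) * eps k" by simp
        also have "\<dots> \<le> 2 * (\<kappa> / eps n) * (eps n * ((1 / 2) ^ k * (1 / 2) ^ n))"
          using \<kappa> eps_pos[of n] by (intro mult_left_mono eps_ratio 3) auto
        also have "\<dots> = 2 * \<kappa> * (1 / 2) ^ k * (1 / 2) ^ n"
          using eps_pos[of n] by simp
        also have "\<dots> \<le> 2 * \<kappa> * (1 / 2) ^ k * (1 / (real n + 1))"
          using \<kappa> halfn by (intro mult_left_mono) auto
        finally show ?thesis using 3 by (simp add: B_def add.commute)
      qed
    qed
  qed
  have "(\<lambda>k. (1 / 2 :: real) ^ k) sums 2" using geometric_sums[of "1 / 2 :: real"] by simp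
  from sums_add[OF sums_mult[OF this, of "2 * \<kappa> / (n + 1)"] sums_single[of n "\<lambda>_. (1 + \<kappa>\<^sup>2) / (n + 1)"]]
  have B: "B sums ((4 * \<kappa> + 1 + \<kappa>\<^sup>2) / (n + 1))"
    by (simp add: B_def[abs_def] add_divide_distrib add.assoc)
  have ball: "norm (disk_pt n z *\<^sub>C x) < 1"
    using disk_pt_scaleC_in_ball[OF z x, of n] by simp
  have "(\<lambda>k. of_real (eps_on A k) / (1 - ?w k)) sums pole_sum (eps_on A) L (disk_pt n z *\<^sub>C x)"
    using summable_sums[OF pole_sum_summable[OF eps_on_nonneg summable_eps_on L ball, of A]]
    by (simp add: pole_sum_def clinearD[OF dual_ballD(1)[OF L]])
  moreover have "(\<lambda>k. complex_of_real (eps_on A k) + (if k = n then c else 0)) sums (of_real (suminf (eps_on A)) + c)"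
    using sums_add[OF sums_of_real[OF summable_sums[OF summable_eps_on[of A]]] sums_single[of n "\<lambda>_. c"]] by simp
  ultimately have "d sums (pole_sum (eps_on A) L (disk_pt n z *\<^sub>C x) - (of_real (suminf (eps_on A)) + c))"
    unfolding d_def[abs_def] by (rule sums_diff)
  then have "cmod (pole_sum (eps_on A) L (disk_pt n z *\<^sub>C x) - (of_real (suminf (eps_on A)) + c)) = cmod (suminf d)"
    by (simp add: sums_iff)
  also have "\<dots> \<le> suminf B"
    using B by (intro norm_suminf_le d_le) (simp add: sums_iff)
  also have "\<dots> = (4 * \<kappa> + 1 + \<kappa>\<^sup>2) / (n + 1)" using B by (simp add: sums_iff)
  finally show ?thesis by (simp add: c_def)
qed

section \<open>Characters as iterated limits along the disks\<close>

locale disk_family =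
  fixes F :: "nat \<Rightarrow> 'a::complex_banach filter" and L :: "nat \<Rightarrow> 'a \<Rightarrow> complex"
  assumes ultra_F: "ultra (F n)" and norm_F: "\<forall>\<^sub>F x in F n. norm x = 1" and L: "L n \<in> dual_ball"
    and head: "j < n \<Longrightarrow> \<forall>\<^sub>F x in F n. cmod (L j x) \<le> eps n / (n + 1)"
    and diag: "\<forall>\<^sub>F x in F n. cmod (L n x - 1) \<le> eps n / (n + 1)"
    and null: "l \<in> dual_ball \<Longrightarrow> 0 < e \<Longrightarrow> \<forall>\<^sub>F n in sequentially. \<forall>\<^sub>F x in F n. cmod (l x) \<le> e"
begin

abbreviation Rem :: "((nat \<Rightarrow> real) \<Rightarrow> real) topology"
  where "Rem \<equiv> stone_cech_remainder positive_integers"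

definition inner_lim :: "('a \<Rightarrow> complex) \<Rightarrow> nat \<Rightarrow> complex \<Rightarrow> complex"
  where "inner_lim f n z = Lim (F n) (\<lambda>x. f (disk_pt n z *\<^sub>C x))"

definition Psi :: "((nat \<Rightarrow> real) \<Rightarrow> real) \<Rightarrow> complex \<Rightarrow> ('a \<Rightarrow> complex) \<Rightarrow> complex"
  where "Psi p z = (\<lambda>f\<in>Hinf. Lim (rem_filter p) (\<lambda>n. inner_lim f n z))"

lemma inner_lim_eqI: "((\<lambda>x. f (disk_pt n z *\<^sub>C x)) \<longlongrightarrow> l) (F n) \<Longrightarrow> inner_lim f n z = l"
  unfolding inner_lim_def by (rule tendsto_Lim[OF ultra_not_bot[OF ultra_F]])

lemma inner_lim_tendsto:
  assumes f: "\<And>x. x \<in> unit_ball \<Longrightarrow> cmod (f x) \<le> C" and z: "z \<in> unit_disk"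
  shows "((\<lambda>x. f (disk_pt n z *\<^sub>C x)) \<longlongrightarrow> inner_lim f n z) (F n)" "cmod (inner_lim f n z) \<le> C"
proof -
  have "\<forall>\<^sub>F x in F n. cmod (f (disk_pt n z *\<^sub>C x)) \<le> C"
    using norm_F[of n] by eventually_elim (intro f disk_pt_scaleC_in_ball z)
  from ultra_tendsto_Lim[OF ultra_F this]
  show "((\<lambda>x. f (disk_pt n z *\<^sub>C x)) \<longlongrightarrow> inner_lim f n z) (F n)" "cmod (inner_lim f n z) \<le> C"
    by (simp_all add: inner_lim_def)
qed

lemma inner_lim_holomorphic:
  assumes f: "analytic_fun_on f unit_ball" "\<And>x. x \<in> unit_ball \<Longrightarrow> cmod (f x) \<le> C"
  shows "inner_lim f n holomorphic_on unit_disk"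
proof (rule holomorphic_tendsto[OF ultra_not_bot[OF ultra_F]])
  show "\<forall>\<^sub>F x in F n. (\<lambda>z. f (disk_pt n z *\<^sub>C x)) holomorphic_on unit_disk \<and>
      (\<forall>z\<in>unit_disk. cmod (f (disk_pt n z *\<^sub>C x)) \<le> C)"
    using norm_F[of n]
  proof eventually_elim
    case (elim x)
    then show ?case
      using disk_pt_scaleC_in_ball[OF _ elim, of _ n] f(2)
        holomorphic_along_line[OF f(1), of "of_real (1 - eps n)" "of_real (eps n)" x]
      by (simp add: disk_pt_def)
  qed
  show "((\<lambda>x. f (disk_pt n z *\<^sub>C x)) \<longlongrightarrow> inner_lim f n z) (F n)" if "z \<in> unit_disk" for z
    using inner_lim_tendsto(1)[OF f(2) that] .
qed

lemma ultra_rem: "p \<in> topspace Rem \<Longrightarrow> ultra (rem_filter p)"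
  by (rule ultra_sc_filter) (simp add: topspace_remainder)

lemma rem_not_bot: "p \<in> topspace Rem \<Longrightarrow> rem_filter p \<noteq> bot"
  by (rule ultra_not_bot[OF ultra_rem])

lemma Psi_eqI:
  assumes "f \<in> Hinf" "p \<in> topspace Rem" "((\<lambda>n. inner_lim f n z) \<longlongrightarrow> l) (rem_filter p)"
  shows "Psi p z f = l"
  using tendsto_Lim[OF rem_not_bot[OF assms(2)] assms(3)] assms(1) by (simp add: Psi_def)

lemma Psi_tendsto:
  assumes f: "f \<in> Hinf" "\<And>x. x \<in> unit_ball \<Longrightarrow> cmod (f x) \<le> C" and p: "p \<in> topspace Rem"
    and z: "z \<in> unit_disk"
  shows "((\<lambda>n. inner_lim f n z) \<longlongrightarrow> Psi p z f) (rem_filter p)" "cmod (Psi p z f) \<le> C"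
proof -
  have "\<forall>\<^sub>F n in rem_filter p. cmod (inner_lim f n z) \<le> C"
    using inner_lim_tendsto(2)[OF f(2) z] by simp
  from ultra_tendsto_Lim[OF ultra_rem[OF p] this]
  show "((\<lambda>n. inner_lim f n z) \<longlongrightarrow> Psi p z f) (rem_filter p)" "cmod (Psi p z f) \<le> C"
    using f(1) by (simp_all add: Psi_def)
qed

lemma Psi_holomorphic:
  assumes f: "f \<in> Hinf" and p: "p \<in> topspace Rem"
  shows "(\<lambda>z. Psi p z f) holomorphic_on unit_disk"
proof -
  obtain C where C: "analytic_fun_on f unit_ball" "\<And>x. x \<in> unit_ball \<Longrightarrow> cmod (f x) \<le> C"
    using HinfE[OF f] by metis
  show ?thesis
  proof (rule holomorphic_tendsto[OF rem_not_bot[OF p]])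
    show "\<forall>\<^sub>F n in rem_filter p. inner_lim f n holomorphic_on unit_disk \<and>
        (\<forall>z\<in>unit_disk. cmod (inner_lim f n z) \<le> C)"
      using inner_lim_holomorphic[OF C] inner_lim_tendsto(2)[OF C(2)] by simp
    show "((\<lambda>n. inner_lim f n z) \<longlongrightarrow> Psi p z f) (rem_filter p)" if "z \<in> unit_disk" for z
      using Psi_tendsto(1)[OF f C(2) p that] .
  qed
qed

text \<open>Both limits exist for all of \<open>Hinf\<close>, so sums and products pass through
  them. The clause on constants yields scalar multiples as products and shows that the character is
  nonzero.\<close>

lemma Psi_homomorphism:
  assumes p: "p \<in> topspace Rem" and z: "z \<in> unit_disk"
  shows "f \<in> Hinf \<Longrightarrow> g \<in> Hinf \<Longrightarrow> Psi p z (\<lambda>x\<in>unit_ball. f x + g x) = Psi p z f + Psi p z g"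
    and "f \<in> Hinf \<Longrightarrow> g \<in> Hinf \<Longrightarrow> Psi p z (\<lambda>x\<in>unit_ball. f x * g x) = Psi p z f * Psi p z g"
    and "Psi p z (\<lambda>x\<in>unit_ball. c) = c"
proof -
  have inner_eq: "inner_lim (restrict h unit_ball) n z = l"
    if "((\<lambda>x. h (disk_pt n z *\<^sub>C x)) \<longlongrightarrow> l) (F n)" for h n l
  proof (rule inner_lim_eqI, rule Lim_transform_eventually[OF that])
    show "\<forall>\<^sub>F x in F n. h (disk_pt n z *\<^sub>C x) = restrict h unit_ball (disk_pt n z *\<^sub>C x)"
      using norm_F[of n]
    proof eventually_elim
      case (elim x)
      show ?case using disk_pt_scaleC_in_ball[OF z elim, of n] by simp
    qed
  qed
  show "Psi p z (\<lambda>x\<in>unit_ball. c) = c"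
    by (rule Psi_eqI[OF Hinf_const p]) (simp add: inner_eq[where h = "\<lambda>_. c", OF tendsto_const])
  assume f: "f \<in> Hinf" and g: "g \<in> Hinf"
  obtain C where C: "\<And>x. x \<in> unit_ball \<Longrightarrow> cmod (f x) \<le> C" using HinfE[OF f] by metis
  obtain D where D: "\<And>x. x \<in> unit_ball \<Longrightarrow> cmod (g x) \<le> D" using HinfE[OF g] by metis
  note lim = inner_lim_tendsto(1)[OF C z] inner_lim_tendsto(1)[OF D z]
  note Lim = Psi_tendsto(1)[OF f C p z] Psi_tendsto(1)[OF g D p z]
  show "Psi p z (\<lambda>x\<in>unit_ball. f x + g x) = Psi p z f + Psi p z g"
  proof (rule Psi_eqI[OF Hinf_add[OF f g] p])
    have "inner_lim (\<lambda>x\<in>unit_ball. f x + g x) n z = inner_lim f n z + inner_lim g n z" for n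
      by (rule inner_eq) (rule tendsto_add[OF lim])
    then show "((\<lambda>n. inner_lim (\<lambda>x\<in>unit_ball. f x + g x) n z) \<longlongrightarrow> Psi p z f + Psi p z g) (rem_filter p)"
      using tendsto_add[OF Lim] by simp
  qed
  show "Psi p z (\<lambda>x\<in>unit_ball. f x * g x) = Psi p z f * Psi p z g"
  proof (rule Psi_eqI[OF Hinf_mult[OF f g] p])
    have "inner_lim (\<lambda>x\<in>unit_ball. f x * g x) n z = inner_lim f n z * inner_lim g n z" for n
      by (rule inner_eq) (rule tendsto_mult[OF lim])
    then show "((\<lambda>n. inner_lim (\<lambda>x\<in>unit_ball. f x * g x) n z) \<longlongrightarrow> Psi p z f * Psi p z g) (rem_filter p)"
      using tendsto_mult[OF Lim] by simp
  qed
qed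

lemma Psi_in_spectrum:
  assumes p: "p \<in> topspace Rem" and z: "z \<in> unit_disk"
  shows "Psi p z \<in> spectrum"
  unfolding spectrum_def
proof (intro CollectI conjI ballI allI)
  note hom = Psi_homomorphism[OF p z]
  show "Psi p z \<in> extensional Hinf" by (simp add: Psi_def)
  fix c and f :: "'a \<Rightarrow> complex"
  assume f: "f \<in> Hinf"
  have "Psi p z (\<lambda>x\<in>unit_ball. c * f x) = Psi p z (\<lambda>x\<in>unit_ball. (\<lambda>x\<in>unit_ball. c) x * f x)"
    by (rule arg_cong[where f = "Psi p z"]) (auto simp: restrict_def)
  also have "\<dots> = c * Psi p z f"
    using hom(2)[OF Hinf_const f] hom(3) by simp
  finally show "Psi p z (\<lambda>x\<in>unit_ball. c * f x) = c * Psi p z f" .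
next
  show "\<exists>f\<in>Hinf. Psi p z f \<noteq> 0"
    using Psi_homomorphism(3)[OF p z, of 1] Hinf_const by (intro bexI[of _ "\<lambda>x\<in>unit_ball. 1"]) auto
qed (use Psi_homomorphism[OF p z] in auto)

text \<open>As \<open>disk_pt n z\<close> has modulus below 1, a functional is no larger on the disk
  than at \<open>x\<close>. Its inner limits tend to 0 for every \<open>z\<close>, also along
  \<open>rem_filter p\<close>, which is finer than \<open>sequentially\<close>.\<close>

lemma Psi_in_fiber0:
  assumes p: "p \<in> topspace Rem" and z: "z \<in> unit_disk"
  shows "Psi p z \<in> fiber0"
  unfolding fiber0_def
proof (intro CollectI conjI ballI Psi_in_spectrum p z)
  fix l :: "'a \<Rightarrow> complex"
  assume l: "l \<in> dual_space"
  obtain M l' where M: "0 < M" "l' \<in> dual_ball" "\<And>x. l x = of_real M * l' x"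
    by (rule dual_space_scale[OF l]) blast
  let ?f = "restrict l unit_ball"
  obtain C where C: "\<And>x. x \<in> unit_ball \<Longrightarrow> cmod (?f x) \<le> C"
    using HinfE[OF Hinf_dual_space[OF l]] by metis
  have "(\<lambda>n. inner_lim ?f n z) \<longlonglongrightarrow> 0"
  proof (rule tendstoI)
    fix e :: real
    assume e: "0 < e"
    have "\<forall>\<^sub>F n in sequentially. \<forall>\<^sub>F x in F n. cmod (l' x) \<le> e / (2 * M)"
      using e M(1) by (intro null M(2)) simp
    then show "\<forall>\<^sub>F n in sequentially. dist (inner_lim ?f n z) 0 < e"
    proof eventually_elim
      case (elim n)
      have "\<forall>\<^sub>F x in F n. cmod (?f (disk_pt n z *\<^sub>C x)) \<le> e / 2"
        using elim norm_F[of n]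
      proof eventually_elim
        case (elim x)
        have "cmod (?f (disk_pt n z *\<^sub>C x)) = cmod (l (disk_pt n z *\<^sub>C x))"
          using disk_pt_scaleC_in_ball[OF z elim(2)] by simp
        also have "\<dots> = cmod (disk_pt n z) * (M * cmod (l' x))"
          using M by (simp add: clinearD[OF dual_ballD(1)[OF M(2)]] norm_mult)
        also have "\<dots> \<le> 1 * (M * (e / (2 * M)))"
          using norm_disk_pt_less[OF z, of n] elim(1) M(1) by (intro mult_mono) auto
        finally show ?case using M(1) by simp
      qed
      then have "cmod (inner_lim ?f n z) \<le> e / 2"
        using inner_lim_tendsto(1)[OF C z, where n = n] ultra_not_bot[OF ultra_F]
        by (intro tendsto_upperbound[OF tendsto_norm])
      then show ?case using e by simp
    qed
  qed
  then have "((\<lambda>n. inner_lim ?f n z) \<longlongrightarrow> 0) (rem_filter p)"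
    using rem_filter_le[OF p] by (rule tendsto_mono[rotated])
  then show "Psi p z ?f = 0"
    by (rule Psi_eqI[OF Hinf_dual_space[OF l] p])
qed

section \<open>Limits of the test functions\<close>

definition test_fun :: "nat set \<Rightarrow> 'a \<Rightarrow> complex"
  where "test_fun A = (\<lambda>x\<in>unit_ball. 1 / (1 + pole_sum (eps_on A) L x))"

lemma test_fun_Hinf: "test_fun A \<in> Hinf"
  unfolding test_fun_def by (rule pole_sum_Hinf[OF eps_on_nonneg summable_eps_on L])

definition test_val :: "nat set \<Rightarrow> complex \<Rightarrow> complex"
  where "test_val A w = 1 / (1 + of_real (suminf (eps_on A)) + w)"

lemma Re_one_minus_inverse:
  assumes "z \<in> unit_disk"
  shows "0 < Re (1 / (1 - z))"
proof -
  have "Re z < 1" using assms complex_Re_le_cmod[of z] by simp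
  then show ?thesis by (simp add: Re_divide complex_eq_iff add_pos_nonneg)
qed

lemma suminf_eps_on_nonneg: "0 \<le> suminf (eps_on A)"
  by (intro suminf_nonneg summable_eps_on eps_on_nonneg)

lemma test_val_inj:
  assumes "test_val A v = test_val A w" "0 \<le> Re v" "0 \<le> Re w"
  shows "v = w"
proof -
  have "1 + of_real (suminf (eps_on A)) + v \<noteq> 0" if "0 \<le> Re v" for v
    using that suminf_eps_on_nonneg[of A] by (auto simp: complex_eq_iff)
  then show ?thesis using assms by (simp add: test_val_def)
qed

text \<open>The ultrafilter decides \<open>A\<close>: for almost all \<open>n\<close> the pole at
  the index \<open>n\<close> is present, or for almost all \<open>n\<close> it is absent.\<close>

lemma Psi_test_fun:
  assumes p: "p \<in> topspace Rem" and z: "z \<in> unit_disk"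
  shows "Psi p z (test_fun A) = test_val A (if \<forall>\<^sub>F n in rem_filter p. n \<in> A then 1 / (1 - z) else 0)"
proof (rule Psi_eqI[OF test_fun_Hinf p])
  define \<kappa> where "\<kappa> = 1 / (1 - cmod z)"
  define w where "w n = (if n \<in> A then 1 / (1 - z) else 0)" for n
  define r where "r n = (4 * \<kappa> + 1 + \<kappa>\<^sup>2) / (real n + 1)" for n
  have Re_w: "0 \<le> Re (w n)" for n
    using Re_one_minus_inverse[OF z] by (simp add: w_def)
  \<comment> \<open>On the right half plane \<open>1 / (1 + a)\<close> is 1-Lipschitz, so the
    estimate for pole sums carries over to the bounded test functions.\<close>
  have lip: "cmod (1 / (1 + a) - 1 / (1 + b)) \<le> cmod (a - b)" if "0 \<le> Re a" "0 \<le> Re b" for a b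
  proof -
    have ge: "1 \<le> cmod (1 + a)" "1 \<le> cmod (1 + b)"
      using that complex_Re_le_cmod[of "1 + a"] complex_Re_le_cmod[of "1 + b"] by auto
    then have "1 + a \<noteq> 0" "1 + b \<noteq> 0" by auto
    then have "1 / (1 + a) - 1 / (1 + b) = (b - a) / ((1 + a) * (1 + b))"
      by (simp add: divide_simps)
    then have "cmod (1 / (1 + a) - 1 / (1 + b)) = cmod (a - b) / (cmod (1 + a) * cmod (1 + b))"
      by (simp add: norm_divide norm_mult norm_minus_commute)
    also have "\<dots> \<le> cmod (a - b) / 1"
      using ge mult_mono[OF ge] by (intro divide_left_mono) auto
    finally show ?thesis by simp
  qed
  obtain C where C: "\<And>x. x \<in> unit_ball \<Longrightarrow> cmod (test_fun A x) \<le> C"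
    using HinfE[OF test_fun_Hinf] by metis
  have near: "cmod (inner_lim (test_fun A) n z - test_val A (w n)) \<le> r n" if n: "0 < n" for n
  proof (rule tendsto_upperbound[OF _ _ ultra_not_bot[OF ultra_F]])
    show "((\<lambda>x. cmod (test_fun A (disk_pt n z *\<^sub>C x) - test_val A (w n))) \<longlongrightarrow>
        cmod (inner_lim (test_fun A) n z - test_val A (w n))) (F n)"
      by (intro tendsto_intros inner_lim_tendsto(1)[OF C z])
    have "\<forall>\<^sub>F x in F n. \<forall>j\<in>{..<n}. cmod (L j x) \<le> eps n / (n + 1)"
      by (intro eventually_ball_finite ballI head) auto
    then show "\<forall>\<^sub>F x in F n. cmod (test_fun A (disk_pt n z *\<^sub>C x) - test_val A (w n)) \<le> r n"
      using norm_F[of n] diag[of n]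
    proof eventually_elim
      case (elim x)
      let ?y = "disk_pt n z *\<^sub>C x"
      have y: "?y \<in> unit_ball" using disk_pt_scaleC_in_ball[OF z elim(2)] .
      have "cmod (test_fun A ?y - test_val A (w n)) \<le>
          cmod (pole_sum (eps_on A) L ?y - (of_real (suminf (eps_on A)) + w n))"
        using lip[of "pole_sum (eps_on A) L ?y" "of_real (suminf (eps_on A)) + w n"] y Re_w[of n]
          Re_pole_sum_nonneg[OF eps_on_nonneg summable_eps_on L, of ?y A] suminf_eps_on_nonneg[of A]
        by (simp add: test_fun_def test_val_def add.assoc)
      also have "\<dots> \<le> (4 * \<kappa> + 1 + \<kappa>\<^sup>2) / (n + 1)"
        unfolding w_def \<kappa>_def using elim n by (intro pole_sum_disk_pt L z) auto
      finally show ?case by (simp add: r_def add.commute)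
    qed
  qed
  have "r \<longlonglongrightarrow> 0"
    unfolding r_def by real_asymp
  then have r0: "(r \<longlongrightarrow> 0) (rem_filter p)"
    using rem_filter_le[OF p] by (rule tendsto_mono[rotated])
  have pos: "\<forall>\<^sub>F n in rem_filter p. 0 < n"
    using eventually_sc_filter[of positive_integers p] by simp
  have "((\<lambda>n. inner_lim (test_fun A) n z - test_val A (w n)) \<longlongrightarrow> 0) (rem_filter p)"
    by (rule Lim_null_comparison[OF _ r0]) (use pos near in \<open>auto elim: eventually_mono\<close>)
  moreover have "\<forall>\<^sub>F n in rem_filter p. w n = (if \<forall>\<^sub>F n in rem_filter p. n \<in> A then 1 / (1 - z) else 0)"
  proof (cases "\<forall>\<^sub>F n in rem_filter p. n \<in> A")
    case True
    then show ?thesis by eventually_elim (simp add: w_def True)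
  next
    case False
    then have "\<forall>\<^sub>F n in rem_filter p. n \<notin> A"
      using not_eventually_ultra[OF ultra_rem[OF p]] by simp
    then show ?thesis by eventually_elim (simp add: w_def False)
  qed
  then have "((\<lambda>n. test_val A (w n)) \<longlongrightarrow>
      test_val A (if \<forall>\<^sub>F n in rem_filter p. n \<in> A then 1 / (1 - z) else 0)) (rem_filter p)"
    by (intro tendsto_eventually) (auto elim: eventually_mono)
  ultimately show "((\<lambda>n. inner_lim (test_fun A) n z) \<longlongrightarrow>
      test_val A (if \<forall>\<^sub>F n in rem_filter p. n \<in> A then 1 / (1 - z) else 0)) (rem_filter p)"
    using tendsto_add[of _ 0 "rem_filter p" "\<lambda>n. test_val A (w n)"] by fastforce
qed

end

section \<open>The embedding\<close>

lemma continuous_map_euclidean_metricI: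
  fixes f :: "'b \<Rightarrow> 'c::metric_space"
  assumes "\<And>x e. x \<in> topspace X \<Longrightarrow> 0 < e \<Longrightarrow> \<exists>U. openin X U \<and> x \<in> U \<and> (\<forall>y\<in>U. dist (f y) (f x) < e)"
  shows "continuous_map X euclidean f"
  unfolding mtopology_is_euclidean[symmetric] Met_TC.continuous_map_to_metric
  using assms by (simp add: dist_commute)

lemma continuous_map_gelfand_coord:
  assumes "f \<in> Hinf"
  shows "continuous_map (subtopology (subtopology gelfand_topology S) T) euclidean (\<lambda>\<phi>. \<phi> f)"
  unfolding gelfand_topology_def
  by (intro continuous_map_from_subtopology continuous_map_product_projection assms)

text \<open>With its counterpart \<open>eventually_near_sc_filter\<close> it translates between
  closeness of coordinates of \<open>p\<close> and membership of sets in the ultrafilter, the only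
  thing that test functions see of \<open>p\<close>.\<close>

lemma eventually_sc_filter_near:
  assumes "p \<in> topspace (stone_cech X)" "u \<in> unit_maps X" "\<forall>\<^sub>F n in sc_filter X p. \<bar>u n - c\<bar> < d"
  shows "\<bar>p u - c\<bar> \<le> d"
proof (rule tendsto_upperbound[OF _ _ sc_filter_not_bot[OF assms(1)]])
  show "((\<lambda>n. \<bar>u n - c\<bar>) \<longlongrightarrow> \<bar>p u - c\<bar>) (sc_filter X p)"
    by (intro tendsto_intros tendsto_sc_filter assms(2))
  show "\<forall>\<^sub>F n in sc_filter X p. \<bar>u n - c\<bar> \<le> d"
    using assms(3) by eventually_elim simp
qed

lemma eventually_near_sc_filter:
  assumes "u \<in> unit_maps X" "0 < d"
  shows "\<forall>\<^sub>F n in sc_filter X p. \<bar>u n - p u\<bar> < d"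
  using tendstoD[OF tendsto_sc_filter[OF assms(1)] assms(2)] by (simp add: dist_real_def)

context disk_family
begin

abbreviation Dom :: "(((nat \<Rightarrow> real) \<Rightarrow> real) \<times> complex) topology"
  where "Dom \<equiv> prod_topology Rem (top_of_set unit_disk)"

abbreviation PsiP :: "((nat \<Rightarrow> real) \<Rightarrow> real) \<times> complex \<Rightarrow> ('a \<Rightarrow> complex) \<Rightarrow> complex"
  where "PsiP \<equiv> \<lambda>(p, z). Psi p z"

text \<open>Joint continuity: for fixed \<open>z0\<close> the value is continuous in
  \<open>p\<close>, and near \<open>z0\<close> it is Lipschitz in \<open>z\<close> with a constant
  independent of \<open>p\<close>.\<close>

lemma continuous_map_Psi_coord:
  assumes f: "f \<in> Hinf"
  shows "continuous_map Dom euclidean (\<lambda>(p, z). Psi p z f)"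
proof (rule continuous_map_euclidean_metricI)
  fix x and e :: real
  assume "x \<in> topspace Dom" and e: "0 < e"
  then obtain p0 z0 where x: "x = (p0, z0)" and p0: "p0 \<in> topspace Rem" and z0: "z0 \<in> unit_disk"
    by auto
  obtain C where C: "0 \<le> C" "\<And>x. x \<in> unit_ball \<Longrightarrow> cmod (f x) \<le> C"
    using HinfE[OF f] by metis
  from z0 have "cmod z0 < 1" by simp
  then obtain r where r: "cmod z0 < r" "r < 1" using dense by blast
  then have r0: "0 < r" using norm_ge_zero[of z0] by linarith
  define K where "K = 2 * C / (1 - r) + 1"
  have K: "0 < K" using C(1) r by (simp add: K_def add_nonneg_pos)
  have Lip: "cmod (Psi p z f - Psi p z0 f) \<le> K * cmod (z - z0)"
    if "p \<in> topspace Rem" "cmod z \<le> r" for p z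
  proof -
    have "cmod (Psi p z f - Psi p z0 f) \<le> 2 * C / (1 - r) * cmod (z - z0)"
      using r r0 that Psi_tendsto(2)[OF f C(2) that(1)]
      by (intro bounded_holomorphic_Lipschitz Psi_holomorphic f) auto
    also have "\<dots> \<le> K * cmod (z - z0)"
      by (intro mult_right_mono) (auto simp: K_def)
    finally show ?thesis .
  qed
  have "continuous_map Rem euclidean (\<lambda>p. Lim (rem_filter p) (\<lambda>n. inner_lim f n z0))"
    using inner_lim_tendsto(2)[OF C(2) z0] by (rule continuous_map_remainder_Lim)
  then have cont: "continuous_map Rem euclidean (\<lambda>p. Psi p z0 f)"
    using f by (simp add: Psi_def)
  let ?U = "{p \<in> topspace Rem. Psi p z0 f \<in> ball (Psi p0 z0 f) (e / 2)}"
  let ?V = "unit_disk \<inter> (ball z0 (e / (2 * K)) \<inter> ball 0 r)"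
  show "\<exists>U. openin Dom U \<and> x \<in> U \<and> (\<forall>y\<in>U. dist (case y of (p, z) \<Rightarrow> Psi p z f) (case x of (p, z) \<Rightarrow> Psi p z f) < e)"
  proof (intro exI[of _ "?U \<times> ?V"] conjI)
    have "openin Rem ?U"
      using cont by (rule openin_continuous_map_preimage) simp
    moreover have "openin (top_of_set unit_disk) ?V"
      by (rule openin_open_Int) auto
    ultimately show "openin Dom (?U \<times> ?V)" by (simp add: openin_prod_Times_iff)
    show "x \<in> ?U \<times> ?V" using x p0 z0 r e K by simp
    show "\<forall>y\<in>?U \<times> ?V. dist (case y of (p, z) \<Rightarrow> Psi p z f) (case x of (p, z) \<Rightarrow> Psi p z f) < e"
    proof
      fix y
      assume "y \<in> ?U \<times> ?V"
      then obtain p z where y: "y = (p, z)"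
        and p: "p \<in> topspace Rem" "Psi p z0 f \<in> ball (Psi p0 z0 f) (e / 2)"
        and z: "z \<in> ball z0 (e / (2 * K))" "z \<in> ball 0 r"
        by auto
      have "cmod (Psi p z f - Psi p z0 f) \<le> K * cmod (z - z0)"
        using p(1) z(2) by (intro Lip) auto
      also have "\<dots> < K * (e / (2 * K))"
        using K z(1) by (intro mult_strict_left_mono) (auto simp: dist_norm norm_minus_commute)
      also have "\<dots> = e / 2" using K by simp
      finally have "dist (Psi p z f) (Psi p z0 f) < e / 2" by (simp add: dist_norm)
      moreover have "dist (Psi p z0 f) (Psi p0 z0 f) < e / 2"
        using p(2) by (simp add: dist_commute)
      ultimately have "dist (Psi p z f) (Psi p0 z0 f) < e"
        using dist_triangle[of "Psi p z f" "Psi p0 z0 f" "Psi p z0 f"] by simp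
      then show "dist (case y of (p, z) \<Rightarrow> Psi p z f) (case x of (p, z) \<Rightarrow> Psi p z f) < e"
        by (simp add: x y)
    qed
  qed
qed

lemma continuous_map_Psi: "continuous_map Dom (subtopology gelfand_topology fiber0) PsiP"
proof -
  have "continuous_map Dom (product_topology (\<lambda>_. euclidean) Hinf) PsiP"
    unfolding continuous_map_componentwise
  proof (intro conjI ballI)
    show "PsiP ` topspace Dom \<subseteq> extensional Hinf" by (auto simp: Psi_def)
    show "continuous_map Dom euclidean (\<lambda>x. PsiP x f)" if "f \<in> Hinf" for f
      using continuous_map_Psi_coord[OF that] by (simp add: case_prod_unfold)
  qed
  then show ?thesis
    using Psi_in_spectrum Psi_in_fiber0 by (auto simp: gelfand_topology_def continuous_map_in_subtopology)
qed

lemma Psi_test_fun_UNIV: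
  assumes "p \<in> topspace Rem" "z \<in> unit_disk"
  shows "Psi p z (test_fun UNIV) = test_val UNIV (1 / (1 - z))"
  using Psi_test_fun[OF assms, of UNIV] by simp

text \<open>Makes membership of \<open>A\<close> in the ultrafilter an open condition on the
  character: one value avoids one point.\<close>

lemma Psi_test_fun_iff:
  assumes "p \<in> topspace Rem" "z \<in> unit_disk"
  shows "Psi p z (test_fun A) = test_val A 0 \<longleftrightarrow> \<not> (\<forall>\<^sub>F n in rem_filter p. n \<in> A)"
proof -
  have "test_val A (1 / (1 - z)) \<noteq> test_val A 0"
    using test_val_inj[of A "1 / (1 - z)" 0] Re_one_minus_inverse[OF assms(2)] by auto
  then show ?thesis using Psi_test_fun[OF assms, of A] by auto
qed

text \<open>The set \<open>UNIV\<close> belongs to every ultrafilter and returns \<open>z\<close>;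
  the remaining sets return the ultrafilter, and with it the coordinates of the point.\<close>

lemma Psi_inj:
  assumes p: "p \<in> topspace Rem" "q \<in> topspace Rem" and z: "z \<in> unit_disk" "w \<in> unit_disk"
    and eq: "Psi p z = Psi q w"
  shows "p = q" "z = w"
proof -
  have "test_val UNIV (1 / (1 - z)) = test_val UNIV (1 / (1 - w))"
    using Psi_test_fun_UNIV[OF p(1) z(1)] Psi_test_fun_UNIV[OF p(2) z(2)] eq by simp
  then have "1 / (1 - z) = 1 / (1 - w)"
    by (rule test_val_inj) (intro less_imp_le Re_one_minus_inverse z)+
  then show "z = w" by simp
  have ev: "(\<forall>\<^sub>F n in rem_filter p. n \<in> A) \<longleftrightarrow> (\<forall>\<^sub>F n in rem_filter q. n \<in> A)" for A
    using Psi_test_fun_iff[OF p(1) z(1), of A] Psi_test_fun_iff[OF p(2) z(2), of A] eq by simp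
  show "p = q"
  proof (rule stone_cech_eqI)
    show pq: "p \<in> topspace (stone_cech positive_integers)" "q \<in> topspace (stone_cech positive_integers)"
      using p by (simp_all add: topspace_remainder)
    fix u :: "nat \<Rightarrow> real"
    assume u: "u \<in> unit_maps positive_integers"
    have "\<bar>q u - p u\<bar> \<le> e" if "0 < e" for e
      using eventually_near_sc_filter[OF u that, of p] ev[of "{n. \<bar>u n - p u\<bar> < e}"]
      by (intro eventually_sc_filter_near[OF pq(2) u]) simp
    then have "\<bar>q u - p u\<bar> \<le> 0" by (rule dense_ge)
    then show "p u = q u" by simp
  qed
qed

lemma embedding_map_Psi: "embedding_map Dom (subtopology gelfand_topology fiber0) PsiP"
proof -
  let ?Z = "subtopology gelfand_topology fiber0"
  let ?Y = "subtopology ?Z (PsiP ` topspace Dom)"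
  define g where "g = inv_into (topspace Dom) PsiP"
  have inj: "inj_on PsiP (topspace Dom)"
    by (rule inj_onI) (auto dest: Psi_inj)
  have g: "g (Psi p z) = (p, z)" if "p \<in> topspace Rem" "z \<in> unit_disk" for p z
    using inv_into_f_f[OF inj, of "(p, z)"] that by (simp add: g_def)
  have topY: "topspace ?Y = PsiP ` topspace Dom"
    using continuous_map_image_subset_topspace[OF continuous_map_Psi] by auto
  have YE: "\<exists>p z. p \<in> topspace Rem \<and> z \<in> unit_disk \<and> \<phi> = Psi p z" if "\<phi> \<in> topspace ?Y" for \<phi>
  proof -
    obtain x where "x \<in> topspace Dom" "\<phi> = PsiP x"
      using \<open>\<phi> \<in> topspace ?Y\<close> unfolding topY by blast
    then show ?thesis
      by (cases x, intro exI[of _ "fst x"] exI[of _ "snd x"]) auto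
  qed
  have coord: "continuous_map ?Y euclidean (\<lambda>\<phi>. \<phi> f)" if "f \<in> Hinf" for f
    using that by (rule continuous_map_gelfand_coord)
  have fst: "continuous_map ?Y Rem (fst \<circ> g)"
  proof -
    have "continuous_map ?Y (top_of_set {0..1}) (\<lambda>\<phi>. (fst \<circ> g) \<phi> u)"
      if u: "u \<in> unit_maps positive_integers" for u
      unfolding continuous_map_in_subtopology
    proof
      show "continuous_map ?Y euclidean (\<lambda>\<phi>. (fst \<circ> g) \<phi> u)"
      proof (rule continuous_map_euclidean_metricI)
        fix \<phi>0 and e :: real
        assume "\<phi>0 \<in> topspace ?Y" and e: "0 < e"
        then obtain p0 z0 where p0: "p0 \<in> topspace Rem" "z0 \<in> unit_disk" "\<phi>0 = Psi p0 z0"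
          using YE by blast
        \<comment> \<open>\<open>A\<close> belongs to the ultrafilter of \<open>p0\<close>.
          Characters near \<open>\<phi>0\<close> also have it in their ultrafilters, which keeps
          their \<open>u\<close>-coordinates within \<open>e / 2\<close> of
          \<open>p0 u\<close>.\<close>
        define A where "A = {n. \<bar>u n - p0 u\<bar> < e / 2}"
        let ?U = "{\<phi> \<in> topspace ?Y. \<phi> (test_fun A) \<in> - {test_val A 0}}"
        have "openin ?Y ?U"
          by (rule openin_continuous_map_preimage[OF coord[OF test_fun_Hinf]]) auto
        moreover have "\<forall>\<^sub>F n in rem_filter p0. n \<in> A"
          using eventually_near_sc_filter[OF u, of "e / 2" p0] e by (simp add: A_def)
        then have "\<phi>0 \<in> ?U"
          using \<open>\<phi>0 \<in> topspace ?Y\<close> Psi_test_fun_iff[OF p0(1,2), of A] p0(3) by simp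
        moreover have "dist ((fst \<circ> g) \<phi> u) ((fst \<circ> g) \<phi>0 u) < e" if \<phi>: "\<phi> \<in> ?U" for \<phi>
        proof -
          obtain p z where p: "p \<in> topspace Rem" "z \<in> unit_disk" "\<phi> = Psi p z"
            using YE \<phi> by blast
          then have "\<forall>\<^sub>F n in rem_filter p. n \<in> A"
            using Psi_test_fun_iff[OF p(1,2), of A] \<phi> by simp
          then have "\<bar>p u - p0 u\<bar> \<le> e / 2"
            using p(1) by (intro eventually_sc_filter_near[OF _ u]) (simp_all add: A_def topspace_remainder)
          then show ?thesis using p p0 e by (simp add: g dist_real_def)
        qed
        ultimately show "\<exists>U. openin ?Y U \<and> \<phi>0 \<in> U \<and> (\<forall>\<phi>\<in>U. dist ((fst \<circ> g) \<phi> u) ((fst \<circ> g) \<phi>0 u) < e)"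
          by blast
      qed
      show "(\<lambda>\<phi>. (fst \<circ> g) \<phi> u) \<in> topspace ?Y \<rightarrow> {0..1}"
      proof
        fix \<phi>
        assume "\<phi> \<in> topspace ?Y"
        then obtain p z where p: "p \<in> topspace Rem" "z \<in> unit_disk" "\<phi> = Psi p z" using YE by blast
        have "p \<in> topspace (sc_cube positive_integers)"
          using p(1) by (simp add: topspace_remainder stone_cech_def)
        then have "p u \<in> {0..1}" using u by (auto simp: sc_cube_def)
        then show "(fst \<circ> g) \<phi> u \<in> {0..1}" using p by (simp add: g)
      qed
    qed
    moreover have range: "(fst \<circ> g) \<phi> \<in> topspace Rem" if "\<phi> \<in> topspace ?Y" for \<phi>
      using YE[OF that] g by auto
    then have "(fst \<circ> g) ` topspace ?Y \<subseteq> extensional (unit_maps positive_integers)"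
      by (auto simp: topspace_remainder stone_cech_def sc_cube_def PiE_def)
    ultimately have "continuous_map ?Y (sc_cube positive_integers) (fst \<circ> g)"
      unfolding sc_cube_def continuous_map_componentwise by blast
    with range show ?thesis
      by (simp add: stone_cech_remainder_def stone_cech_def continuous_map_in_subtopology Pi_iff)
  qed
  have snd: "continuous_map ?Y (top_of_set unit_disk) (snd \<circ> g)"
    unfolding continuous_map_in_subtopology
  proof
    define s where "s = complex_of_real (suminf (eps_on UNIV))"
    \<comment> \<open>Solves \<open>\<phi> (test_fun UNIV) = 1 / (1 + s + 1 / (1 - z))\<close> for
      \<open>z\<close>.\<close>
    define \<Lambda> where "\<Lambda> \<phi> = 1 - 1 / (1 / \<phi> (test_fun UNIV) - 1 - s)" for \<phi> :: "('a \<Rightarrow> complex) \<Rightarrow> complex"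
    have val: "\<phi> (test_fun UNIV) \<noteq> 0" "1 / \<phi> (test_fun UNIV) - 1 - s \<noteq> 0" "\<Lambda> \<phi> = (snd \<circ> g) \<phi>"
      if \<phi>: "\<phi> \<in> topspace ?Y" for \<phi>
    proof -
      obtain p z where p: "p \<in> topspace Rem" "z \<in> unit_disk" "\<phi> = Psi p z" using YE[OF \<phi>] by blast
      have z: "1 - z \<noteq> 0" using Re_one_minus_inverse[OF p(2)] by auto
      have "0 < Re (1 + s + 1 / (1 - z))"
        using Re_one_minus_inverse[OF p(2)] suminf_eps_on_nonneg[of UNIV] by (simp add: s_def)
      then have "1 + s + 1 / (1 - z) \<noteq> 0" by (metis less_irrefl zero_complex.sel(1))
      moreover have "\<phi> (test_fun UNIV) = 1 / (1 + s + 1 / (1 - z))"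
        using Psi_test_fun_UNIV[OF p(1,2)] p(3) by (simp add: test_val_def s_def)
      ultimately have *: "\<phi> (test_fun UNIV) \<noteq> 0" "1 / \<phi> (test_fun UNIV) - 1 - s = 1 / (1 - z)" by auto
      then show "\<phi> (test_fun UNIV) \<noteq> 0" "1 / \<phi> (test_fun UNIV) - 1 - s \<noteq> 0"
        using z by auto
      show "\<Lambda> \<phi> = (snd \<circ> g) \<phi>"
        unfolding \<Lambda>_def *(2) using p z by (simp add: g)
    qed
    have "continuous_map ?Y euclidean \<Lambda>"
      using coord[OF test_fun_Hinf, of UNIV] val(1,2)
      unfolding continuous_map_atin limitin_canonical_iff \<Lambda>_def
      by (intro ballI tendsto_intros) auto
    then show "continuous_map ?Y euclidean (snd \<circ> g)"
      by (rule continuous_map_eq) (rule val(3))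
    show "snd \<circ> g \<in> topspace ?Y \<rightarrow> unit_disk"
    proof
      show "(snd \<circ> g) \<phi> \<in> unit_disk" if "\<phi> \<in> topspace ?Y" for \<phi>
        using YE[OF that] g by auto
    qed
  qed
  have "homeomorphic_maps Dom ?Y PsiP g"
    unfolding homeomorphic_maps_def
  proof (intro conjI ballI)
    show "continuous_map Dom ?Y PsiP"
      using continuous_map_Psi by (simp add: continuous_map_in_subtopology)
    show "continuous_map ?Y Dom g"
      using fst snd by (simp add: continuous_map_pairwise)
    show "g (PsiP x) = x" if "x \<in> topspace Dom" for x
      using that g by auto
    show "PsiP (g \<phi>) = \<phi>" if "\<phi> \<in> topspace ?Y" for \<phi>
      using YE[OF that] g by auto
  qed
  then show ?thesis
    unfolding embedding_map_def homeomorphic_maps_map by blast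
qed

end

theorem corollary5p2:
  assumes "infinite_dimensional TYPE('a::complex_banach)"
  shows "(\<exists>\<tau> :: complex \<Rightarrow> ('a \<Rightarrow> complex) \<Rightarrow> complex. analytic_disk_map \<tau>) \<and>
    (\<exists>\<Psi> :: ((nat \<Rightarrow> real) \<Rightarrow> real) \<times> complex \<Rightarrow> ('a \<Rightarrow> complex) \<Rightarrow> complex.
      embedding_map
        (prod_topology (stone_cech_remainder positive_integers) (top_of_set unit_disk))
        (subtopology gelfand_topology fiber0) \<Psi> \<and>
      (\<forall>f\<in>Hinf. \<forall>p\<in>topspace (stone_cech_remainder positive_integers).
        (\<lambda>z. \<Psi> (p, z) f) holomorphic_on unit_disk))"
proof -
  \<comment> \<open>This accuracy tends to 0 even relative to the radius \<open>eps n\<close> of the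
    \<open>n\<close>-th disk.\<close>
  have "0 < eps n / (real n + 1)" for n
    using eps_pos[of n] by simp
  then obtain F :: "nat \<Rightarrow> 'a filter" and L :: "nat \<Rightarrow> 'a \<Rightarrow> complex"
    where FL: "\<And>n. ultra (F n)" "\<And>n. \<forall>\<^sub>F x in F n. norm x = 1" "\<And>n. L n \<in> dual_ball"
      "\<And>j n. j < n \<Longrightarrow> \<forall>\<^sub>F x in F n. cmod (L j x) \<le> eps n / (real n + 1)"
      "\<And>n. \<forall>\<^sub>F x in F n. cmod (L n x - 1) \<le> eps n / (real n + 1)"
      "\<And>l e. l \<in> dual_ball \<Longrightarrow> 0 < e \<Longrightarrow> \<forall>\<^sub>F n in sequentially. \<forall>\<^sub>F x in F n. cmod (l x) \<le> e"
    using ex_almost_biorthogonal_ultrafilters[OF assms, of "\<lambda>n. eps n / (real n + 1)"] by metis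
  interpret disk_family F L
    by unfold_locales (use FL in \<open>simp_all add: add.commute\<close>)
  \<comment> \<open>Every slice of the embedding is an analytic disk, so one point of the remainder
    suffices for the first claim.\<close>
  obtain p where p: "p \<in> topspace Rem" using remainder_nonempty by blast
  have "analytic_disk_map (Psi p)"
    unfolding analytic_disk_map_def
    using Psi_in_fiber0[OF p] Psi_holomorphic[OF _ p] Psi_inj(2)[OF p p] by (auto intro: inj_onI)
  moreover have "\<forall>f\<in>Hinf. \<forall>p\<in>topspace Rem. (\<lambda>z. PsiP (p, z) f) holomorphic_on unit_disk"
    using Psi_holomorphic by simp
  ultimately show ?thesis using embedding_map_Psi by blast
qed

end
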